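(* Let $X$ and $Y$ be independent real-valued Lévy processes with $m_X=\mathbb{E}X_1>0$ and $m_Y=\mathbb{E}Y_1<\infty$, and write $\omega_X^2=\mathrm{Var}(X_1)$, $\omega_Y^2=\mathrm{Var}(Y_1)$. Let $Z_t=X_t-Y_t$, $V_t=X_t-\inf_{0\le s\le t}(X_s-Y_s)$ and $\tau(u)=\inf\{t\ge0:V_t>u\}$. (i) If $\mathbb{E}Z_1>0$, then as $u\to\infty$, $\frac{\tau(u)}{u}\to\frac1{m_X}$ in probability and $\frac{\tau(u)-u/m_X}{\sqrt u}$ converges in distribution to $N\left(0,\frac{\omega_X^2}{m_X^3}\right)$. (ii) If $\mathbb{E}Z_1<0$, then as $u\to\infty$, $\frac{\tau(u)}{u}\to\frac1{m_Y}$ in probability and $\frac{\tau(u)-u/m_Y}{\sqrt u}$ converges in distribution to $N\left(0,\frac{\omega_Y^2}{m_Y^3}\right)$.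
   Context: $N(m,\sigma^2)$ denotes a Gaussian random variable with mean $m$ and variance $\sigma^2$. Lévy processes start at $0$. The process $V$ is called the process $X$ reflected from the barrier $Y$. *)

theory Defs
  imports "HOL-Probability.Probability"
begin

section \<open>Levy processes\<close>

text \<open>Processes are indexed by all reals, but only times \<open>t \<ge> 0\<close> are ever inspected.\<close>

definition cadlag :: "(real \<Rightarrow> real) \<Rightarrow> bool" where
  "cadlag x \<longleftrightarrow>
     (\<forall>t\<ge>0. (x \<longlongrightarrow> x t) (at_right t)) \<and>
     (\<forall>t>0. \<exists>l. (x \<longlongrightarrow> l) (at_left t))"

text \<open>
  As usual, the start at 0 and the path regularity are required almost surely only. Stochastic
  continuity is not listed, since it follows from right-continuity and stationary increments.
\<close>

definition levy_process :: "'a measure \<Rightarrow> (real \<Rightarrow> 'a \<Rightarrow> real) \<Rightarrow> bool" where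
  "levy_process M X \<longleftrightarrow>
     prob_space M \<and>
     (\<forall>t\<ge>0. X t \<in> borel_measurable M) \<and>
     (AE \<omega> in M. X 0 \<omega> = 0) \<and>
     (\<forall>(t :: nat \<Rightarrow> real) n. 0 \<le> t 0 \<and> mono t \<longrightarrow>
        prob_space.indep_vars M (\<lambda>_. borel) (\<lambda>i \<omega>. X (t (Suc i)) \<omega> - X (t i) \<omega>) {..<n}) \<and>
     (\<forall>s\<ge>0. \<forall>h\<ge>0. distr M borel (\<lambda>\<omega>. X (s + h) \<omega> - X s \<omega>) = distr M borel (X h)) \<and>
     (AE \<omega> in M. cadlag (\<lambda>t. X t \<omega>))"

definition indep_processes ::
    "'a measure \<Rightarrow> (real \<Rightarrow> 'a \<Rightarrow> real) \<Rightarrow> (real \<Rightarrow> 'a \<Rightarrow> real) \<Rightarrow> bool" where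
  "indep_processes M X Y \<longleftrightarrow>
     prob_space.indep_var M
       (PiM {0..} (\<lambda>_. borel)) (\<lambda>\<omega>. \<lambda>t\<in>{0..}. X t \<omega>)
       (PiM {0..} (\<lambda>_. borel)) (\<lambda>\<omega>. \<lambda>t\<in>{0..}. Y t \<omega>)"


section \<open>Extended expectation\<close>

text \<open>
  The expectation with values in \<open>[-\<infinity>, \<infinity>]\<close>, which exists if the positive or the negative part
  has finite expectation. Without that proviso \<open>ext_expectation\<close> is meaningless: on \<^typ>\<open>ereal\<close>,
  \<open>\<infinity> - \<infinity> = \<infinity>\<close>. Note that \<open>ennreal\<close> maps negative reals to 0.
\<close>

definition expectation_exists :: "'a measure \<Rightarrow> ('a \<Rightarrow> real) \<Rightarrow> bool" where
  "expectation_exists M f \<longleftrightarrow>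
     f \<in> borel_measurable M \<and>
     ((\<integral>\<^sup>+\<omega>. ennreal (f \<omega>) \<partial>M) < \<infinity> \<or> (\<integral>\<^sup>+\<omega>. ennreal (- f \<omega>) \<partial>M) < \<infinity>)"

definition ext_expectation :: "'a measure \<Rightarrow> ('a \<Rightarrow> real) \<Rightarrow> ereal" where
  "ext_expectation M f =
     enn2ereal (\<integral>\<^sup>+\<omega>. ennreal (f \<omega>) \<partial>M) - enn2ereal (\<integral>\<^sup>+\<omega>. ennreal (- f \<omega>) \<partial>M)"

lemma
  assumes "integrable M f"
  shows expectation_exists_integrable: "expectation_exists M f"
    and ext_expectation_integrable: "ext_expectation M f = ereal (\<integral>\<omega>. f \<omega> \<partial>M)"
proof -
  have p: "(\<integral>\<^sup>+\<omega>. ennreal (f \<omega>) \<partial>M) < \<infinity>"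
    using assms by (auto simp: real_integrable_def less_top)
  have n: "(\<integral>\<^sup>+\<omega>. ennreal (- f \<omega>) \<partial>M) < \<infinity>"
    using assms by (auto simp: real_integrable_def less_top)
  show "expectation_exists M f"
    using assms p by (auto simp: expectation_exists_def)
  have e: "enn2ereal x = ereal (enn2real x)" if "x < \<infinity>" for x
    using that by (cases x) auto
  show "ext_expectation M f = ereal (\<integral>\<omega>. f \<omega> \<partial>M)"
    by (simp add: ext_expectation_def e[OF p] e[OF n] real_lebesgue_integral_def[OF assms])
qed


section \<open>Reflection from a barrier and first passage\<close>

definition reflected ::
    "(real \<Rightarrow> 'a \<Rightarrow> real) \<Rightarrow> (real \<Rightarrow> 'a \<Rightarrow> real) \<Rightarrow> real \<Rightarrow> 'a \<Rightarrow> real" where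
  "reflected X Y t \<omega> = X t \<omega> - (INF s\<in>{0..t}. X s \<omega> - Y s \<omega>)"

text \<open>The infimum is taken in \<^typ>\<open>ereal\<close>, so it is \<open>\<infinity>\<close> if the level is never exceeded.
  As paths are only almost surely cadlag, the first passage time of a reflected Levy process is a
  random variable on the completion of the probability space, but not necessarily on the space
  itself.\<close>

definition first_passage :: "(real \<Rightarrow> 'a \<Rightarrow> real) \<Rightarrow> real \<Rightarrow> 'a \<Rightarrow> ereal" where
  "first_passage V u \<omega> = Inf (ereal ` {t. 0 \<le> t \<and> V t \<omega> > u})"


section \<open>Modes of convergence\<close>

text \<open>
  The library only has convergence in distribution for sequences of real random variables. Here the
  index runs along an arbitrary filter and the random variables may take infinite values, while the
  limits are finite. Measurability is part of both notions.
\<close>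

definition tendsto_in_prob ::
    "'a measure \<Rightarrow> ('i \<Rightarrow> 'a \<Rightarrow> ereal) \<Rightarrow> ereal \<Rightarrow> 'i filter \<Rightarrow> bool" where
  "tendsto_in_prob M T c F \<longleftrightarrow>
     (\<forall>i. T i \<in> borel_measurable M) \<and>
     (\<forall>\<epsilon>>0. ((\<lambda>i. measure M {\<omega>\<in>space M. \<bar>T i \<omega> - c\<bar> > ereal \<epsilon>}) \<longlongrightarrow> 0) F)"

definition tendsto_in_distribution ::
    "'a measure \<Rightarrow> ('i \<Rightarrow> 'a \<Rightarrow> ereal) \<Rightarrow> real measure \<Rightarrow> 'i filter \<Rightarrow> bool" where
  "tendsto_in_distribution M T N F \<longleftrightarrow>
     (\<forall>i. T i \<in> borel_measurable M) \<and>
     (\<forall>x. isCont (cdf N) x \<longrightarrow>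
        ((\<lambda>i. measure M {\<omega>\<in>space M. T i \<omega> \<le> ereal x}) \<longlongrightarrow> cdf N x) F)"

lemma tendsto_in_distribution_iff_weak_conv_m:
  assumes "\<And>n. T n \<in> borel_measurable M"
  shows "tendsto_in_distribution M (\<lambda>n \<omega>. ereal (T n \<omega>)) N sequentially \<longleftrightarrow>
         weak_conv_m (\<lambda>n. distr M borel (T n)) N"
proof -
  have "cdf (distr M borel (T n)) x = measure M {\<omega>\<in>space M. T n \<omega> \<le> x}" for n x
    using assms[of n] by (auto simp: cdf_def measure_distr intro!: arg_cong[where f="measure M"])
  then show ?thesis
    using assms by (simp add: tendsto_in_distribution_def weak_conv_m_def weak_conv_def)
qed

text \<open>
  The normal distribution with mean \<open>m\<close> and variance \<open>v\<close>. The degenerate case has to be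
  treated separately, as \<open>normal_density m 0\<close> is the zero function.
\<close>

definition normal_distribution :: "real \<Rightarrow> real \<Rightarrow> real measure" where
  "normal_distribution m v =
     (if v = 0 then return borel m else density lborel (normal_density m (sqrt v)))"

end

theory Submission
  imports Defs
begin

text \<open>
  The time \<open>\<tau>(u)\<close> is the first \<open>s\<close> such that \<open>X\<^sub>s - X\<^sub>r + Y\<^sub>r > u\<close> for some \<open>r \<le> s\<close>. Taking
  \<open>r = 0\<close> or \<open>r = s\<close> shows that \<open>V\<close> dominates both \<open>X\<close> and \<open>Y\<close>. Conversely, for \<open>r \<le> s \<le> n\<close>,
  \<open>X\<^sub>s - X\<^sub>r + Y\<^sub>r = X\<^sub>n - (X\<^sub>n - X\<^sub>s) - Z\<^sub>r = Y\<^sub>n - (X\<^sub>n - X\<^sub>s) + (Z\<^sub>n - Z\<^sub>r)\<close>.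
  A Levy process with negative mean has a finite supremum, and by time reversal the suprema of
  \<open>W\<^sub>n - W\<^sub>s\<close> and of \<open>W\<^sub>s\<close> over \<open>s \<le> n\<close> have the same law. Hence the running supremum of \<open>V\<close> at time \<open>n\<close> is \<open>X\<^sub>n\<close> plus a tight term if
  \<open>Z\<close> has positive mean, and \<open>Y\<^sub>n\<close> plus a tight term if \<open>Z\<close> has negative mean. Integer times suffice, so
  the limit theorems for sums of independent variables can be inverted to give those for \<open>\<tau>\<close>.
\<close>

section \<open>Maxima of partial sums and independent identically distributed families\<close>

text \<open>Only one-sided first moments are at hand for the law of large numbers, and the mean of
  \<open>X 1\<close> may be \<infinity>, so variance bounds are out of reach. Everything of first
  order rests on one statement: a walk with iid steps of mean below \<open>c\<close> rarely rises
  far above the line of slope \<open>c\<close>. Truncating the steps from below makes them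
  integrable and keeps the mean below \<open>c\<close>, even if it was -\<infinity>; negated steps
  give the opposite direction. The same statement yields the tight suprema. Continuous time is the
  other obstacle. Suprema are taken over dyadic times, where they are countable, and Ottaviani's
  inequality compares a grid with the integers; its constant is uniform in the mesh because cadlag
  paths are bounded on [0,1]. The positive mean of \<open>X\<close> enters in both cases, since
  \<open>X\<close> must not fall far below its past maximum. The cube in the variance comes from the
  inversion: at time \<open>u / m\<close> the walk has variance \<open>v * u / m\<close>, and
  dividing a deviation in space by the speed \<open>m\<close> to get one in time divides this by
  \<open>m ^ 2\<close>.\<close>

text \<open>The maximum of the partial sums \<open>0, x 0, x 0 + x 1, \<dots>\<close>, by Lindley's recursion.\<close>

primrec max_sum :: "nat \<Rightarrow> (nat \<Rightarrow> real) \<Rightarrow> real" where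
  "max_sum 0 x = 0"
| "max_sum (Suc n) x = max 0 (x 0 + max_sum n (\<lambda>i. x (Suc i)))"

lemma max_sum_nonneg: "0 \<le> max_sum n x"
  by (cases n) auto

lemma max_sum_mono: "max_sum n x \<le> max_sum (Suc n) x"
proof (induction n arbitrary: x)
  case (Suc n)
  show ?case using Suc[of "\<lambda>i. x (Suc i)"] by simp
qed simp

lemma max_sum_cong: "(\<And>i. i < n \<Longrightarrow> x i = y i) \<Longrightarrow> max_sum n x = max_sum n y"
proof (induction n arbitrary: x y)
  case (Suc n)
  have "max_sum n (\<lambda>i. x (Suc i)) = max_sum n (\<lambda>i. y (Suc i))"
    using Suc.prems by (intro Suc.IH) auto
  then show ?case using Suc.prems[of 0] by simp
qed simp

lemma sum_le_max_sum: "(\<Sum>i<n. x i) \<le> max_sum n x"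
proof (induction n arbitrary: x)
  case (Suc n)
  show ?case
    using Suc[of "\<lambda>i. x (Suc i)"] by (simp only: sum.lessThan_Suc_shift max_sum.simps)
qed simp

lemma abs_max_sum_le: "\<bar>max_sum n x\<bar> \<le> (\<Sum>i<n. \<bar>x i\<bar>)"
proof (induction n arbitrary: x)
  case (Suc n)
  show ?case
    using Suc[of "\<lambda>i. x (Suc i)"] by (simp only: sum.lessThan_Suc_shift max_sum.simps)
qed simp

lemma measurable_max_sum [measurable (raw)]:
  "(\<And>i. i < n \<Longrightarrow> (\<lambda>\<omega>. x \<omega> i) \<in> borel_measurable N) \<Longrightarrow> (\<lambda>\<omega>. max_sum n (x \<omega>)) \<in> borel_measurable N"
proof (induction n arbitrary: x)
  case (Suc n)
  have "(\<lambda>\<omega>. max_sum n (\<lambda>i. x \<omega> (Suc i))) \<in> borel_measurable N"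
    using Suc.prems by (intro Suc.IH) auto
  then show ?case using Suc.prems[of 0] by simp
qed simp

context prob_space
begin

lemma indep_vars_reindex:
  assumes "indep_vars N X (f ` I)" and f: "inj_on f I"
  shows "indep_vars (\<lambda>i. N (f i)) (\<lambda>i. X (f i)) I"
proof -
  let ?F = "\<lambda>i. {X i -` A \<inter> space M | A. A \<in> sets (N i)}"
  have ind: "indep_sets ?F (f ` I)" and rv: "\<forall>i\<in>I. random_variable (N (f i)) (X (f i))"
    using assms(1) by (simp_all add: indep_vars_def2)
  have "indep_sets (\<lambda>i. ?F (f i)) I"
  proof (rule indep_setsI)
    show "?F (f i) \<subseteq> events" if "i \<in> I" for i
      using rv that by (auto simp: measurable_sets)
  next
    fix A J assume J: "J \<noteq> {}" "J \<subseteq> I" "finite J" and A: "\<forall>j\<in>J. A j \<in> ?F (f j)"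
    \<comment> \<open>\<open>B\<close> carries the chosen events over to the image indices;
      injectivity makes this well defined.\<close>
    define B where "B k = A (the_inv_into J f k)" for k
    have inj: "inj_on f J" using f J(2) by (rule inj_on_subset)
    have B: "B (f j) = A j" if "j \<in> J" for j
      using that by (simp add: B_def the_inv_into_f_f[OF inj])
    have "prob (\<Inter>k\<in>f ` J. B k) = (\<Prod>k\<in>f ` J. prob (B k))"
      using J A by (intro indep_setsD[OF ind]) (auto simp: B)
    then show "prob (\<Inter>j\<in>J. A j) = (\<Prod>j\<in>J. prob (A j))"
      by (simp add: prod.reindex[OF inj] B)
  qed
  then show ?thesis using rv by (simp add: indep_vars_def2)
qed

text \<open>The index set is a parameter because time reversal acts on a finite segment, whereas the
  limit theorems need all indices.\<close>

definition iid_vars :: "(nat \<Rightarrow> 'a \<Rightarrow> real) \<Rightarrow> nat set \<Rightarrow> bool" where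
  "iid_vars \<xi> I \<longleftrightarrow> indep_vars (\<lambda>_. borel) \<xi> I \<and>
     (\<exists>\<mu>. \<forall>i\<in>I. distr M borel (\<xi> i) = \<mu>)"

lemma iid_vars_measurable: "iid_vars \<xi> I \<Longrightarrow> i \<in> I \<Longrightarrow> random_variable borel (\<xi> i)"
  by (auto simp: iid_vars_def indep_vars_def)

lemma iid_vars_distr_eq:
  "iid_vars \<xi> I \<Longrightarrow> i \<in> I \<Longrightarrow> j \<in> I \<Longrightarrow> distr M borel (\<xi> i) = distr M borel (\<xi> j)"
  by (auto simp: iid_vars_def)

lemma iid_vars_subset: "iid_vars \<xi> I \<Longrightarrow> J \<subseteq> I \<Longrightarrow> iid_vars \<xi> J"
  using indep_vars_subset[of "\<lambda>_. borel" \<xi> I J] by (auto simp: iid_vars_def)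

lemma iid_vars_reindex:
  assumes "iid_vars \<xi> J" "inj_on f I" "f ` I \<subseteq> J"
  shows "iid_vars (\<lambda>i. \<xi> (f i)) I"
proof -
  have "indep_vars (\<lambda>_. borel) \<xi> (f ` I)"
    using assms(1,3) indep_vars_subset[of "\<lambda>_. borel" \<xi> J "f ` I"] by (simp add: iid_vars_def)
  from indep_vars_reindex[OF this assms(2)]
  have "indep_vars (\<lambda>_. borel) (\<lambda>i. \<xi> (f i)) I" .
  moreover have "\<exists>\<mu>. \<forall>i\<in>I. distr M borel (\<xi> (f i)) = \<mu>"
    using assms(1,3) by (auto simp: iid_vars_def image_subset_iff)
  ultimately show ?thesis by (simp add: iid_vars_def)
qed

lemma iid_vars_compose:
  assumes "iid_vars \<xi> I" and [measurable]: "g \<in> borel_measurable borel"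
  shows "iid_vars (\<lambda>i \<omega>. g (\<xi> i \<omega>)) I"
proof -
  have eq: "distr M borel (\<lambda>\<omega>. g (\<xi> i \<omega>)) = distr (distr M borel (\<xi> i)) borel g"
    if "i \<in> I" for i
    using iid_vars_measurable[OF assms(1) that] by (simp add: distr_distr comp_def)
  have "indep_vars (\<lambda>_. borel) (\<lambda>i \<omega>. g (\<xi> i \<omega>)) I"
    by (rule indep_vars_compose2[of "\<lambda>_. borel"]) (use assms in \<open>auto simp: iid_vars_def\<close>)
  moreover obtain \<mu> where "\<forall>i\<in>I. distr M borel (\<xi> i) = \<mu>"
    using assms(1) by (auto simp: iid_vars_def)
  then have "\<exists>\<mu>. \<forall>i\<in>I. distr M borel (\<lambda>\<omega>. g (\<xi> i \<omega>)) = \<mu>"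
    by (intro exI[of _ "distr \<mu> borel g"]) (simp add: eq)
  ultimately show ?thesis by (simp add: iid_vars_def)
qed

text \<open>Under independence the joint law is the product of the marginal laws.\<close>

lemma joint_distr_eqI:
  assumes X: "indep_vars N X I" and Y: "indep_vars N Y I"
    and eq: "\<And>i. i \<in> I \<Longrightarrow> distr M (N i) (X i) = distr M (N i) (Y i)"
  shows "distr M (PiM I N) (\<lambda>\<omega>. \<lambda>i\<in>I. X i \<omega>) = distr M (PiM I N) (\<lambda>\<omega>. \<lambda>i\<in>I. Y i \<omega>)"
proof (cases "I = {}")
  case True
  then show ?thesis by (simp add: restrict_def)
next
  case False
  have "random_variable (N i) (X i)" "random_variable (N i) (Y i)" if "i \<in> I" for i
    using X Y that by (auto simp: indep_vars_def)
  from indep_vars_iff_distr_eq_PiM'[OF False this(1)] indep_vars_iff_distr_eq_PiM'[OF False this(2)]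
  show ?thesis using X Y eq by (auto cong: PiM_cong)
qed

text \<open>Serves both rearrangements that occur: the shift of a walk by one step and its reversal
  in time.\<close>

lemma iid_vars_joint_distr_eq:
  assumes "iid_vars \<xi> J" "iid_vars \<eta> I" "inj_on f I" "f ` I \<subseteq> J" "\<And>i. i \<in> I \<Longrightarrow> distr M borel (\<eta> i) = distr M borel (\<xi> (f i))"
  shows "distr M (PiM I (\<lambda>_. borel)) (\<lambda>\<omega>. \<lambda>i\<in>I. \<eta> i \<omega>) =
    distr M (PiM I (\<lambda>_. borel)) (\<lambda>\<omega>. \<lambda>i\<in>I. \<xi> (f i) \<omega>)"
  by (rule joint_distr_eqI)
    (use assms(2,5) iid_vars_reindex[OF assms(1,3,4)] in \<open>auto simp: iid_vars_def\<close>)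

text \<open>Removing the first \<open>m\<close> steps changes all later partial sums by the same
  finite amount, so unboundedness from above is a tail event.\<close>

lemma unbounded_sums_0_1:
  fixes \<xi> :: "nat \<Rightarrow> 'a \<Rightarrow> real"
  assumes ind: "indep_vars (\<lambda>_. borel) \<xi> UNIV"
  defines "A \<equiv> {\<omega>\<in>space M. \<forall>a::nat. \<exists>n. (\<Sum>i<n. \<xi> i \<omega>) > real a}"
  shows "prob A = 0 \<or> prob A = 1"
proof (rule kolmogorov_0_1_law)
  let ?F = "\<lambda>i. sigma_sets (space M) {\<xi> i -` B \<inter> space M |B. B \<in> sets borel}"
  show "sigma_algebra (space M) (?F i)" for i
    by (intro sigma_algebra_sigma_sets) auto
  show "indep_sets ?F UNIV" using ind by (simp add: indep_vars_def)
  show "A \<in> tail_events ?F"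
    unfolding tail_events_def
  proof
    fix m :: nat
    \<comment> \<open>\<open>N\<close> carries the sigma-algebra generated by the steps from index
      \<open>m\<close> on; as a measure space it reduces the tail property to a measurability
      proof.\<close>
    define N where "N = sigma (space M) (\<Union> (?F ` {m..}))"
    have sub: "\<Union> (?F ` {m..}) \<subseteq> Pow (space M)"
      by (auto dest: sigma_sets_into_sp[rotated])
    have space: "space N = space M" and sets: "sets N = sigma_sets (space M) (\<Union> (?F ` {m..}))"
      unfolding N_def using sub by (auto simp: space_measure_of_conv sets_measure_of)
    have [measurable]: "\<xi> i \<in> borel_measurable N" if "m \<le> i" for i
    proof (rule measurableI)
      fix B :: "real set" assume "B \<in> sets borel"
      then show "\<xi> i -` B \<inter> space N \<in> sets N"
        unfolding space sets using that by (intro sigma_sets.Basic) auto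
    qed simp
    have "A = {\<omega>\<in>space N. \<forall>a::nat. \<exists>n. (\<Sum>i\<in>{m..<m+n}. \<xi> i \<omega>) > real a}"
    proof -
      have "(\<forall>a::nat. \<exists>n. (\<Sum>i<n. x i) > real a) \<longleftrightarrow> (\<forall>a::nat. \<exists>n. (\<Sum>i\<in>{m..<m+n}. x i) > real a)"
        for x :: "nat \<Rightarrow> real"
      proof
        assume L: "\<forall>a::nat. \<exists>n. (\<Sum>i<n. x i) > real a"
        \<comment> \<open>\<open>c\<close> bounds every partial sum of at most \<open>m\<close>
          steps, so a sum above \<open>a + c\<close> reaches beyond \<open>m\<close>, and its part
          from \<open>m\<close> on still exceeds \<open>a\<close>.\<close>
        define c where "c = (\<Sum>i<m. \<bar>x i\<bar>)"
        show "\<forall>a::nat. \<exists>n. (\<Sum>i\<in>{m..<m+n}. x i) > real a"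
        proof
          fix a :: nat
          obtain n where n: "(\<Sum>i<n. x i) > real (a + nat \<lceil>c\<rceil>)" using L by blast
          have c: "c \<le> real (nat \<lceil>c\<rceil>)" by linarith
          have "m \<le> n"
          proof (rule ccontr)
            assume "\<not> m \<le> n"
            then have "(\<Sum>i<n. x i) \<le> c"
              unfolding c_def by (intro order_trans[OF sum_mono sum_mono2]) auto
            then show False using n c by simp
          qed
          then have "(\<Sum>i<n. x i) = (\<Sum>i<m. x i) + (\<Sum>i\<in>{m..<m+(n-m)}. x i)"
            by (simp add: sum.atLeastLessThan_concat lessThan_atLeast0)
          moreover have "(\<Sum>i<m. x i) \<le> c" unfolding c_def by (intro sum_mono) auto
          ultimately show "\<exists>n. (\<Sum>i\<in>{m..<m+n}. x i) > real a"
            using n c by (intro exI[of _ "n-m"]) simp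
        qed
      next
        assume R: "\<forall>a::nat. \<exists>n. (\<Sum>i\<in>{m..<m+n}. x i) > real a"
        show "\<forall>a::nat. \<exists>n. (\<Sum>i<n. x i) > real a"
        proof
          fix a :: nat
          define c where "c = (\<Sum>i<m. x i)"
          obtain n where n: "(\<Sum>i\<in>{m..<m+n}. x i) > real (a + nat \<lceil>-c\<rceil>)" using R by blast
          have c: "-c \<le> real (nat \<lceil>-c\<rceil>)" by linarith
          have "(\<Sum>i<m+n. x i) = c + (\<Sum>i\<in>{m..<m+n}. x i)"
            unfolding c_def by (simp add: sum.atLeastLessThan_concat lessThan_atLeast0)
          then show "\<exists>n. (\<Sum>i<n. x i) > real a"
            using n c by (intro exI[of _ "m+n"]) simp
        qed
      qed
      then show ?thesis unfolding A_def space by simp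
    qed
    also have "\<dots> \<in> sets N" by measurable
    finally show "A \<in> sigma_sets (space M) (\<Union> (?F ` {m..}))" by (simp only: sets)
  qed
qed

end

section \<open>Random walks with negative drift\<close>

lemma antimono_tendsto_0_at_top:
  fixes f :: "real \<Rightarrow> real"
  assumes anti: "\<And>x y. x \<le> y \<Longrightarrow> f y \<le> f x" and nonneg: "\<And>x. 0 \<le> f x"
    and lim: "(\<lambda>n. f (real n)) \<longlonglongrightarrow> 0"
  shows "(f \<longlongrightarrow> 0) at_top"
proof (rule order_tendstoI)
  fix e :: real assume "0 < e"
  from order_tendstoD(2)[OF lim this] obtain n where n: "f (real n) < e"
    by (auto simp: eventually_sequentially)
  show "eventually (\<lambda>x. f x < e) at_top"
    using eventually_ge_at_top[of "real n"]
    by eventually_elim (use anti n in \<open>force intro: le_less_trans\<close>)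
next
  fix e :: real assume "e < 0"
  then show "eventually (\<lambda>x. e < f x) at_top"
    using nonneg by (intro always_eventually allI) (rule less_le_trans)
qed

text \<open>Truncation at \<open>L \<le> 0\<close> leaves the positive part alone, and by monotone
  convergence the negative part of the truncated function increases to that of \<open>f\<close> as
  \<open>L\<close> decreases. This disposes of expectation -\<infinity>.\<close>

lemma ext_expectation_less_truncate:
  assumes "prob_space M" and [measurable]: "f \<in> borel_measurable M"
    and less: "ext_expectation M f < ereal c"
  shows "\<exists>L. integrable M (\<lambda>\<omega>. max (f \<omega>) L) \<and> (\<integral>\<omega>. max (f \<omega>) L \<partial>M) < c"
proof -
  interpret prob_space M by fact
  let ?P = "\<integral>\<^sup>+\<omega>. ennreal (f \<omega>) \<partial>M" and ?N = "\<integral>\<^sup>+\<omega>. ennreal (- f \<omega>) \<partial>M"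
  let ?Nk = "\<lambda>k::nat. \<integral>\<^sup>+\<omega>. min (ennreal (- f \<omega>)) (of_nat k) \<partial>M"
  \<comment> \<open>By the convention \<infinity> - \<infinity> = \<infinity>, an extended
    expectation below \<open>c\<close> already forces a finite positive part.\<close>
  have "?P \<noteq> \<infinity>"
    using less by (auto simp: ext_expectation_def)
  then obtain p where p: "0 \<le> p" "?P = ennreal p"
    by (cases ?P) auto
  have SUP: "(SUP k. ?Nk k) = ?N"
  proof -
    have "(SUP k. min x (of_nat k)) = x" for x :: ennreal
    proof (rule antisym)
      show "x \<le> (SUP k. min x (of_nat k))"
      proof (cases x)
        case (real r)
        then have "x \<le> of_nat (nat \<lceil>r\<rceil>)"
          by (simp add: ennreal_of_nat_eq_real_of_nat)
        then have "x = min x (of_nat (nat \<lceil>r\<rceil>))" by simp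
        also have "\<dots> \<le> (SUP k. min x (of_nat k))" by (rule SUP_upper) simp
        finally show ?thesis .
      qed (simp add: ennreal_SUP_of_nat_eq_top)
    qed (auto intro: SUP_least)
    moreover have "(SUP k. ?Nk k) = (\<integral>\<^sup>+\<omega>. (SUP k::nat. min (ennreal (- f \<omega>)) (of_nat k)) \<partial>M)"
      by (intro nn_integral_monotone_convergence_SUP[symmetric])
        (auto simp: incseq_def le_fun_def intro: min.coboundedI2)
    ultimately show ?thesis by simp
  qed
  have fin: "?Nk k < \<infinity>" for k
  proof -
    have "?Nk k \<le> (\<integral>\<^sup>+\<omega>. of_nat k \<partial>M)" by (intro nn_integral_mono) auto
    also have "\<dots> < \<infinity>" by (simp add: emeasure_space_1 ennreal_of_nat_eq_real_of_nat)
    finally show ?thesis .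
  qed
  have "\<exists>k. p - c < enn2real (?Nk k)"
  proof (cases "p < c")
    case True
    then show ?thesis using enn2real_nonneg[of "?Nk 0"] by (intro exI[of _ 0]) linarith
  next
    case False
    have "ennreal (p - c) < ?N"
      using less False p unfolding ext_expectation_def
      by (cases ?N) (auto simp: ennreal_less_iff)
    then obtain k where "ennreal (p - c) < ?Nk k"
      unfolding SUP[symmetric] less_SUP_iff by auto
    then show ?thesis using fin[of k] False
      by (intro exI[of _ k]) (cases "?Nk k", auto simp: ennreal_less_iff)
  qed
  then obtain k where k: "p - c < enn2real (?Nk k)" by blast
  let ?g = "\<lambda>\<omega>. max (f \<omega>) (- real k)"
  have pos: "(\<integral>\<^sup>+\<omega>. ennreal (?g \<omega>) \<partial>M) = ennreal p"
    unfolding p(2)[symmetric] by (intro nn_integral_cong) (auto simp: max_def ennreal_neg)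
  have neg: "(\<integral>\<^sup>+\<omega>. ennreal (- ?g \<omega>) \<partial>M) = ?Nk k"
  proof (intro nn_integral_cong)
    fix \<omega>
    have "- ?g \<omega> = min (- f \<omega>) (real k)" by (simp add: max_def min_def)
    moreover have "ennreal (min a b) = min (ennreal a) (ennreal b)" for a b
      by (cases "a \<le> b") (simp_all add: min_def ennreal_leI antisym)
    ultimately show "ennreal (- ?g \<omega>) = min (ennreal (- f \<omega>)) (of_nat k)"
      by (simp add: ennreal_of_nat_eq_real_of_nat)
  qed
  have int: "integrable M ?g"
    using fin[of k] unfolding real_integrable_def pos neg by auto
  have "(\<integral>\<omega>. ?g \<omega> \<partial>M) = p - enn2real (?Nk k)"
    unfolding real_lebesgue_integral_def[OF int] pos neg using p by simp
  with int k show ?thesis by (intro exI[of _ "- real k"]) auto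
qed

context prob_space
begin

lemma expectation_max_sum_shift:
  assumes iid: "iid_vars \<xi> UNIV"
  shows "expectation (\<lambda>\<omega>. max_sum n (\<lambda>i. \<xi> (Suc i) \<omega>)) = expectation (\<lambda>\<omega>. max_sum n (\<lambda>i. \<xi> i \<omega>))"
proof -
  have [measurable]: "\<xi> i \<in> borel_measurable M" for i
    using iid_vars_measurable[OF iid] by simp
  have eq: "expectation (\<lambda>\<omega>. max_sum n (\<lambda>i. \<eta> i \<omega>)) =
      (\<integral>x. max_sum n x \<partial>distr M (PiM {..<n} (\<lambda>_. borel)) (\<lambda>\<omega>. \<lambda>i\<in>{..<n}. \<eta> i \<omega>))"
    if [measurable]: "\<And>i. \<eta> i \<in> borel_measurable M" for \<eta> :: "nat \<Rightarrow> 'a \<Rightarrow> real"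
    by (subst integral_distr) (auto intro!: Bochner_Integration.integral_cong max_sum_cong)
  have "distr M (PiM {..<n} (\<lambda>_. borel)) (\<lambda>\<omega>. \<lambda>i\<in>{..<n}. \<xi> (Suc i) \<omega>) =
      distr M (PiM {..<n} (\<lambda>_. borel)) (\<lambda>\<omega>. \<lambda>i\<in>{..<n}. \<xi> i \<omega>)"
    using iid_vars_reindex[OF iid, of Suc "{..<n}"]
    by (intro iid_vars_joint_distr_eq[of \<xi> UNIV, where f="\<lambda>i. i"] iid)
      (auto intro: iid_vars_distr_eq[OF iid])
  then show ?thesis by (simp add: eq)
qed

text \<open>Let \<open>M\<^sub>n\<close> be the maximum of the first \<open>n\<close> partial sums and \<open>M'\<^sub>n\<close> that of the shifted walk. Then
  \<open>E max (- M'\<^sub>n) (\<xi> 0) = E M\<^bsub>n+1\<^esub> - E M\<^sub>n \<ge> 0\<close>, and the integrand tends to \<open>\<xi> 0\<close> wherever some partial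
  sum is positive.\<close>

lemma not_AE_positive_sum:
  assumes iid: "iid_vars \<xi> UNIV" and int: "integrable M (\<xi> 0)" and neg: "expectation (\<xi> 0) < 0"
  shows "\<not> (AE \<omega> in M. \<exists>n. (\<Sum>i<n. \<xi> i \<omega>) > 0)"
proof
  assume AE: "AE \<omega> in M. \<exists>n. (\<Sum>i<n. \<xi> i \<omega>) > 0"
  have [measurable]: "\<xi> i \<in> borel_measurable M" for i
    using iid_vars_measurable[OF iid] by simp
  have int_\<xi>: "integrable M (\<xi> i)" for i
  proof -
    have "integrable M (\<xi> i) \<longleftrightarrow> integrable (distr M borel (\<xi> i)) (\<lambda>x. x)" for i
      by (simp add: integrable_distr_eq)
    then show ?thesis using int iid_vars_distr_eq[OF iid, of i 0] by simp
  qed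
  let ?M = "\<lambda>n \<omega>. max_sum n (\<lambda>i. \<xi> i \<omega>)" and ?M' = "\<lambda>n \<omega>. max_sum n (\<lambda>i. \<xi> (Suc i) \<omega>)"
  have int_M: "integrable M (?M n)" "integrable M (?M' n)" for n
    by (rule Bochner_Integration.integrable_bound[of _ "\<lambda>\<omega>. \<Sum>i<n. \<bar>\<xi> i \<omega>\<bar>"];
        use int_\<xi> abs_max_sum_le[of n] in \<open>force intro: order_trans[OF _ abs_ge_self]\<close>)
      (rule Bochner_Integration.integrable_bound[of _ "\<lambda>\<omega>. \<Sum>i<n. \<bar>\<xi> (Suc i) \<omega>\<bar>"];
        use int_\<xi> abs_max_sum_le[of n] in \<open>force intro: order_trans[OF _ abs_ge_self]\<close>)
  have ge: "0 \<le> expectation (\<lambda>\<omega>. max (- ?M' n \<omega>) (\<xi> 0 \<omega>))" for n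
  proof -
    have "expectation (\<lambda>\<omega>. max (- ?M' n \<omega>) (\<xi> 0 \<omega>)) = expectation (\<lambda>\<omega>. ?M (Suc n) \<omega> - ?M' n \<omega>)"
      by (intro Bochner_Integration.integral_cong) (auto simp: max_def)
    also have "\<dots> = expectation (?M (Suc n)) - expectation (?M n)"
      by (simp only: Bochner_Integration.integral_diff[OF int_M] expectation_max_sum_shift[OF iid])
    also have "\<dots> \<ge> 0"
      using integral_mono[OF int_M(1) int_M(1), of n "Suc n"] max_sum_mono by (simp del: max_sum.simps)
    finally show ?thesis .
  qed
  have "(\<lambda>n. expectation (\<lambda>\<omega>. max (- ?M' n \<omega>) (\<xi> 0 \<omega>))) \<longlonglongrightarrow> expectation (\<xi> 0)"
  proof (rule integral_dominated_convergence[where w="\<lambda>\<omega>. \<bar>\<xi> 0 \<omega>\<bar>"])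
    show "AE \<omega> in M. (\<lambda>n. max (- ?M' n \<omega>) (\<xi> 0 \<omega>)) \<longlonglongrightarrow> \<xi> 0 \<omega>"
      using AE
    proof eventually_elim
      case (elim \<omega>)
      then obtain N where N: "(\<Sum>i<N. \<xi> i \<omega>) > 0" by blast
      then obtain k where k: "N = Suc k" by (cases N) auto
      have "- ?M' n \<omega> \<le> \<xi> 0 \<omega>" if "k \<le> n" for n
      proof -
        have "(\<Sum>i<N. \<xi> i \<omega>) = \<xi> 0 \<omega> + (\<Sum>i<k. \<xi> (Suc i) \<omega>)"
          unfolding k by (simp only: sum.lessThan_Suc_shift)
        also have "(\<Sum>i<k. \<xi> (Suc i) \<omega>) \<le> ?M' k \<omega>" by (rule sum_le_max_sum)
        also have "?M' k \<omega> \<le> ?M' n \<omega>" 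
          by (rule lift_Suc_mono_le[of "\<lambda>n. ?M' n \<omega>", OF max_sum_mono that])
        finally show ?thesis using N by simp
      qed
      then have "eventually (\<lambda>n. \<xi> 0 \<omega> = max (- ?M' n \<omega>) (\<xi> 0 \<omega>)) sequentially"
        unfolding eventually_sequentially by (auto simp: max_def)
      then show ?case by (rule tendsto_eventually[OF eventually_mono]) simp
    qed
    \<comment> \<open>The maximum of the shifted walk is nonnegative, so the integrand lies between
      \<open>\<xi> 0\<close> and \<open>max 0 (\<xi> 0)\<close>.\<close>
    show "AE \<omega> in M. norm (max (- ?M' n \<omega>) (\<xi> 0 \<omega>)) \<le> \<bar>\<xi> 0 \<omega>\<bar>" for n
    proof (rule AE_I2)
      show "norm (max (- ?M' n \<omega>) (\<xi> 0 \<omega>)) \<le> \<bar>\<xi> 0 \<omega>\<bar>" for \<omega>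
        using max_sum_nonneg[of n "\<lambda>i. \<xi> (Suc i) \<omega>"] unfolding real_norm_def by linarith
    qed
    show "integrable M (\<lambda>\<omega>. \<bar>\<xi> 0 \<omega>\<bar>)" using int by simp
  qed measurable
  then have "0 \<le> expectation (\<xi> 0)" using ge by (intro LIMSEQ_le_const) auto
  with neg show False by simp
qed

text \<open>As the level grows, the events shrink to the event that the partial sums are unbounded
  above. Its probability is 0 or 1, and 1 would make some partial sum positive almost surely,
  against the negative mean.\<close>

lemma walk_exceeds_tendsto_0_integrable:
  assumes iid: "iid_vars \<xi> UNIV" and int: "integrable M (\<xi> 0)" and neg: "expectation (\<xi> 0) < 0"
  shows "((\<lambda>a. prob {\<omega>\<in>space M. \<exists>n. (\<Sum>i<n. \<xi> i \<omega>) > a}) \<longlongrightarrow> 0) at_top"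
proof (rule antimono_tendsto_0_at_top)
  have [measurable]: "\<xi> i \<in> borel_measurable M" for i
    using iid_vars_measurable[OF iid] by simp
  define E where "E a = {\<omega>\<in>space M. \<exists>n. (\<Sum>i<n. \<xi> i \<omega>) > a}" for a :: real
  have [measurable]: "E a \<in> events" for a unfolding E_def by measurable
  have mono: "E b \<subseteq> E a" if "a \<le> b" for a b using that by (auto simp: E_def intro: le_less_trans)
  have INT: "(\<Inter>k. E (real k)) = {\<omega>\<in>space M. \<forall>a::nat. \<exists>n. (\<Sum>i<n. \<xi> i \<omega>) > real a}"
    by (auto simp: E_def)
  have "prob (\<Inter>k. E (real k)) \<noteq> 1"
  proof
    assume "prob (\<Inter>k. E (real k)) = 1"
    then have "AE \<omega> in M. \<omega> \<in> (\<Inter>k. E (real k))"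
      by (subst (asm) prob_eq_1) auto
    then have "AE \<omega> in M. \<exists>n. (\<Sum>i<n. \<xi> i \<omega>) > 0"
      
    proof eventually_elim
      case (elim \<omega>)
      then have "\<omega> \<in> E (real 0)" by blast
      then show ?case by (simp add: E_def)
    qed
    with not_AE_positive_sum[OF assms] show False ..
  qed
  then have "prob (\<Inter>k. E (real k)) = 0"
    using unbounded_sums_0_1[of \<xi>] iid unfolding INT by (auto simp: iid_vars_def)
  moreover have "(\<lambda>k. prob (E (real k))) \<longlonglongrightarrow> prob (\<Inter>k. E (real k))"
    by (intro finite_Lim_measure_decseq) (simp_all add: decseq_def mono image_subset_iff)
  ultimately show "(\<lambda>k. prob {\<omega>\<in>space M. \<exists>n. (\<Sum>i<n. \<xi> i \<omega>) > real k}) \<longlonglongrightarrow> 0"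
    by (simp add: E_def)
  show "prob {\<omega>\<in>space M. \<exists>n. (\<Sum>i<n. \<xi> i \<omega>) > b} \<le> prob {\<omega>\<in>space M. \<exists>n. (\<Sum>i<n. \<xi> i \<omega>) > a}"
    if "a \<le> b" for a b
    unfolding E_def[symmetric] by (intro finite_measure_mono mono[OF that]) measurable
qed simp

text \<open>The truncated steps \<open>max (\<xi> i \<omega>) L - c\<close> have negative mean and
  dominate \<open>\<xi> i \<omega> - c\<close>, so the integrable case applies to them.\<close>

lemma walk_exceeds_tendsto_0:
  assumes iid: "iid_vars \<xi> UNIV" and less: "ext_expectation M (\<xi> 0) < ereal c"
  shows "((\<lambda>a. prob {\<omega>\<in>space M. \<exists>n. (\<Sum>i<n. \<xi> i \<omega>) > real n * c + a}) \<longlongrightarrow> 0) at_top"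
proof -
  have [measurable]: "\<xi> i \<in> borel_measurable M" for i
    using iid_vars_measurable[OF iid] by simp
  obtain L where int: "integrable M (\<lambda>\<omega>. max (\<xi> 0 \<omega>) L)" and L: "(\<integral>\<omega>. max (\<xi> 0 \<omega>) L \<partial>M) < c"
    using ext_expectation_less_truncate[OF prob_space_axioms _ less] by auto
  let ?\<eta> = "\<lambda>i \<omega>. max (\<xi> i \<omega>) L - c"
  have "((\<lambda>a. prob {\<omega>\<in>space M. \<exists>n. (\<Sum>i<n. ?\<eta> i \<omega>) > a}) \<longlongrightarrow> 0) at_top"
    using int L
    by (intro walk_exceeds_tendsto_0_integrable iid_vars_compose[OF iid, where g="\<lambda>x. max x L - c"])
      (auto simp: prob_space)
  then show ?thesis
  proof (rule tendsto_sandwich[OF _ _ tendsto_const, rotated 2])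
    show "eventually (\<lambda>a. prob {\<omega>\<in>space M. \<exists>n. (\<Sum>i<n. \<xi> i \<omega>) > real n * c + a}
        \<le> prob {\<omega>\<in>space M. \<exists>n. (\<Sum>i<n. ?\<eta> i \<omega>) > a}) at_top"
    proof (intro always_eventually allI finite_measure_mono subsetI)
      fix a \<omega> assume *: "\<omega> \<in> {\<omega>\<in>space M. \<exists>n. (\<Sum>i<n. \<xi> i \<omega>) > real n * c + a}"
      then obtain n where n: "(\<Sum>i<n. \<xi> i \<omega>) > real n * c + a" by auto
      have "(\<Sum>i<n. \<xi> i \<omega>) \<le> (\<Sum>i<n. max (\<xi> i \<omega>) L)" by (intro sum_mono) auto
      then have "(\<Sum>i<n. ?\<eta> i \<omega>) > a" using n by (simp add: sum_subtractf)
      with * show "\<omega> \<in> {\<omega>\<in>space M. \<exists>n. (\<Sum>i<n. ?\<eta> i \<omega>) > a}" by auto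
    qed measurable
  qed simp_all
qed

text \<open>For a slope \<open>c'\<close> strictly between the mean and \<open>c\<close>, reaching
  \<open>n * c\<close> at time \<open>n\<close> means being \<open>n * (c - c')\<close> above the
  line of slope \<open>c'\<close>, a level that tends to infinity.\<close>

lemma weak_law_upper:
  assumes iid: "iid_vars \<xi> UNIV" and less: "ext_expectation M (\<xi> 0) < ereal c"
  shows "(\<lambda>n. prob {\<omega>\<in>space M. (\<Sum>i<n. \<xi> i \<omega>) \<ge> real n * c}) \<longlonglongrightarrow> 0"
proof -
  have [measurable]: "\<xi> i \<in> borel_measurable M" for i
    using iid_vars_measurable[OF iid] by simp
  obtain c' where c': "ext_expectation M (\<xi> 0) < ereal c'" "c' < c"
    using ereal_dense2[OF less] by (metis ereal_dense2 less less_ereal.simps(1))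
  let ?g = "\<lambda>a. prob {\<omega>\<in>space M. \<exists>n. (\<Sum>i<n. \<xi> i \<omega>) > real n * c' + a}"
  \<comment> \<open>Subtracting 1 turns the weak inequality of the claim into the strict one of the
    crossing event.\<close>
  have "filterlim (\<lambda>n. real n * (c - c') - 1) at_top sequentially"
    using c'(2) by real_asymp
  from filterlim_compose[OF walk_exceeds_tendsto_0[OF iid c'(1)] this]
  show ?thesis
  proof (rule tendsto_sandwich[OF _ _ tendsto_const, rotated 2])
    show "eventually (\<lambda>n. prob {\<omega>\<in>space M. (\<Sum>i<n. \<xi> i \<omega>) \<ge> real n * c}
        \<le> ?g (real n * (c - c') - 1)) sequentially"
    proof (intro always_eventually allI finite_measure_mono subsetI)
      fix n \<omega> assume *: "\<omega> \<in> {\<omega>\<in>space M. (\<Sum>i<n. \<xi> i \<omega>) \<ge> real n * c}"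
      have "real n * c' + (real n * (c - c') - 1) = real n * c - 1"
        by (simp add: algebra_simps)
      with * show "\<omega> \<in> {\<omega>\<in>space M. \<exists>m. (\<Sum>i<m. \<xi> i \<omega>) > real m * c' + (real n * (c - c') - 1)}"
        by (auto intro!: exI[of _ n])
    qed measurable
  qed simp_all
qed

end

section \<open>Time reversal and Ottaviani's inequality\<close>

context prob_space
begin

lemma iid_vars_prob_reindex:
  assumes iid: "iid_vars \<xi> {..<n}" and f: "inj_on f {..<n}" "f ` {..<n} \<subseteq> {..<n}"
    and B: "B \<in> sets (PiM {..<n} (\<lambda>_. borel))"
  shows "prob {\<omega>\<in>space M. (\<lambda>i\<in>{..<n}. \<xi> (f i) \<omega>) \<in> B} = prob {\<omega>\<in>space M. (\<lambda>i\<in>{..<n}. \<xi> i \<omega>) \<in> B}"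
proof -
  have rv: "random_variable borel (\<xi> i)" if "i < n" for i
    using iid_vars_measurable[OF iid] that by simp
  have rv1: "random_variable borel (\<xi> (f i))" if "i < n" for i
    using rv f(2) that by auto
  have eq: "distr M (PiM {..<n} (\<lambda>_. borel)) (\<lambda>\<omega>. \<lambda>i\<in>{..<n}. \<xi> i \<omega>) =
      distr M (PiM {..<n} (\<lambda>_. borel)) (\<lambda>\<omega>. \<lambda>i\<in>{..<n}. \<xi> (f i) \<omega>)"
    using f by (intro iid_vars_joint_distr_eq[OF iid iid f] iid_vars_distr_eq[OF iid]) auto
  have "measure (distr M (PiM {..<n} (\<lambda>_. borel)) (\<lambda>\<omega>. \<lambda>i\<in>{..<n}. \<eta> i \<omega>)) B =
      prob {\<omega>\<in>space M. (\<lambda>i\<in>{..<n}. \<eta> i \<omega>) \<in> B}"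
    if "\<And>i. i < n \<Longrightarrow> random_variable borel (\<eta> i)" for \<eta> :: "nat \<Rightarrow> 'a \<Rightarrow> real"
    using that B
    by (subst measure_distr) (auto intro!: measurable_restrict arg_cong[where f=prob])
  from this[of \<xi>, OF rv] this[of "\<lambda>i. \<xi> (f i)", OF rv1] eq show ?thesis by simp
qed

text \<open>The sums over final segments are the partial sums of the walk with its steps in reverse
  order, and reversal preserves the joint law.\<close>

lemma prob_reversed_walk_exceeds:
  assumes iid: "iid_vars \<xi> {..<n}"
  shows "prob {\<omega>\<in>space M. \<exists>k\<le>n. (\<Sum>i\<in>{k..<n}. \<xi> i \<omega>) > a} =
    prob {\<omega>\<in>space M. \<exists>k\<le>n. (\<Sum>i<k. \<xi> i \<omega>) > a}"
proof -
  \<comment> \<open>Intersecting with \<open>{..<n}\<close> keeps every coordinate inside the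
    product space, as measurability requires; for \<open>k \<le> n\<close> it changes
    nothing.\<close>
  let ?B = "{x\<in>space (PiM {..<n} (\<lambda>_. borel)). \<exists>k\<le>n. (\<Sum>i\<in>{..<k}\<inter>{..<n}. x i) > (a::real)}"
  have B: "?B \<in> sets (PiM {..<n} (\<lambda>_. borel))" by measurable
  have mem: "(\<lambda>i\<in>{..<n}. x i) \<in> ?B \<longleftrightarrow> (\<exists>k\<le>n. (\<Sum>i<k. x i) > a)" for x :: "nat \<Rightarrow> real"
  proof -
    have "(\<Sum>i\<in>{..<k}\<inter>{..<n}. (\<lambda>i\<in>{..<n}. x i) i) = (\<Sum>i<k. x i)" if "k \<le> n" for k
      using that by (intro sum.cong) auto
    then show ?thesis by (auto simp: space_PiM)
  qed
  have rev: "(\<exists>k\<le>n. (\<Sum>i<k. x (n - Suc i)) > a) \<longleftrightarrow> (\<exists>k\<le>n. (\<Sum>i\<in>{k..<n}. x i) > a)"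
    for x :: "nat \<Rightarrow> real"
  proof -
    have *: "(\<Sum>i<n - k. x (n - Suc i)) = (\<Sum>i\<in>{k..<n}. x i)" for k
      by (rule sum.reindex_bij_witness[of _ "\<lambda>i. n - Suc i" "\<lambda>i. n - Suc i"]) auto
    show ?thesis
    proof safe
      fix k assume "k \<le> n" "(\<Sum>i<k. x (n - Suc i)) > a"
      then show "\<exists>k\<le>n. (\<Sum>i\<in>{k..<n}. x i) > a"
        using *[of "n - k"] by (intro exI[of _ "n - k"]) auto
    next
      fix k assume "k \<le> n" "(\<Sum>i\<in>{k..<n}. x i) > a"
      then show "\<exists>k\<le>n. (\<Sum>i<k. x (n - Suc i)) > a"
        using *[of k] by (intro exI[of _ "n - k"]) auto
    qed
  qed
  have "inj_on (\<lambda>i. n - Suc i) {..<n}" "(\<lambda>i. n - Suc i) ` {..<n} \<subseteq> {..<n}"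
    by (auto simp: inj_on_def)
  from iid_vars_prob_reindex[OF iid this B] show ?thesis
    unfolding mem rev[of "\<lambda>i. \<xi> i \<omega>" for \<omega>] .
qed

text \<open>At the first exceedance of \<open>a + b\<close>, the future increment up to index \<open>c k\<close> is independent of
  the past and at least \<open>- b\<close> with probability at least one half.\<close>

lemma ottaviani_inequality:
  fixes n :: nat and c :: "nat \<Rightarrow> nat"
  assumes ind: "indep_vars (\<lambda>_. borel) \<xi> {..<n}"
    and c: "\<And>k. k \<le> n \<Longrightarrow> k \<le> c k" "\<And>k. k \<le> n \<Longrightarrow> c k \<le> n"
    and half: "\<And>k. k \<le> n \<Longrightarrow> 1/2 \<le> prob {\<omega>\<in>space M. (\<Sum>i\<in>{k..<c k}. \<xi> i \<omega>) \<ge> - b}"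
  shows "prob {\<omega>\<in>space M. \<exists>k\<le>n. (\<Sum>i<k. \<xi> i \<omega>) > a + b} \<le>
    2 * prob {\<omega>\<in>space M. \<exists>k\<le>n. (\<Sum>i<c k. \<xi> i \<omega>) > (a::real)}"
proof -
  have rv: "\<xi> i \<in> borel_measurable M" if "i < n" for i
    using ind that by (auto simp: indep_vars_def)
  have S: "(\<lambda>\<omega>. \<Sum>i<k. \<xi> i \<omega>) \<in> borel_measurable M" if "k \<le> n" for k
    using that by (intro borel_measurable_sum rv) (auto intro: less_le_trans)
  define A where "A k = {\<omega>\<in>space M. (\<Sum>i<k. \<xi> i \<omega>) > a + b \<and> (\<forall>j<k. (\<Sum>i<j. \<xi> i \<omega>) \<le> a + b)}" for k
  define B where "B k = {\<omega>\<in>space M. (\<Sum>i\<in>{k..<c k}. \<xi> i \<omega>) \<ge> - b}" for k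
  define E where "E = {\<omega>\<in>space M. \<exists>k\<le>n. (\<Sum>i<c k. \<xi> i \<omega>) > a}"
  \<comment> \<open>\<open>A k\<close> involves only the steps before \<open>k\<close>, and
    \<open>B k\<close> only those from \<open>k\<close> up to \<open>c k\<close>.\<close>
  have indAB: "prob (A k \<inter> B k) = prob (A k) * prob (B k)" if k: "k \<le> n" for k
  proof -
    let ?I = "{..<k}" and ?J = "{k..<c k}"
    let ?A = "{x\<in>space (PiM ?I (\<lambda>_. borel)). (\<Sum>i\<in>?I. x i) > a + b \<and> (\<forall>j<k. (\<Sum>i\<in>{..<j}\<inter>?I. x i) \<le> a + b)}"
    let ?B = "{x\<in>space (PiM ?J (\<lambda>_. borel)). (\<Sum>i\<in>?J. x i) \<ge> - b}"
    have iv: "indep_var (PiM ?I (\<lambda>_. borel)) (\<lambda>\<omega>. \<lambda>i\<in>?I. \<xi> i \<omega>) (PiM ?J (\<lambda>_. borel)) (\<lambda>\<omega>. \<lambda>i\<in>?J. \<xi> i \<omega>)"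
      using k c[OF k] by (intro indep_var_restrict[OF ind]) auto
    have AB: "?A \<in> sets (PiM ?I (\<lambda>_. borel))" "?B \<in> sets (PiM ?J (\<lambda>_. borel))"
      by measurable
    have memA: "(\<lambda>i\<in>?I. x i) \<in> ?A \<longleftrightarrow> (\<Sum>i<k. x i) > a + b \<and> (\<forall>j<k. (\<Sum>i<j. x i) \<le> a + b)"
      for x :: "nat \<Rightarrow> real"
    proof -
      have "(\<Sum>i\<in>{..<j}\<inter>?I. (\<lambda>i\<in>?I. x i) i) = (\<Sum>i<j. x i)" if "j < k" for j
        using that by (intro sum.cong) auto
      then show ?thesis by (auto simp: space_PiM)
    qed
    have memB: "(\<lambda>i\<in>?J. x i) \<in> ?B \<longleftrightarrow> (\<Sum>i\<in>?J. x i) \<ge> - b" for x :: "nat \<Rightarrow> real"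
      by (auto simp: space_PiM)
    have "(\<lambda>\<omega>. \<lambda>i\<in>?I. \<xi> i \<omega>) -` ?A \<inter> space M = A k" "(\<lambda>\<omega>. \<lambda>i\<in>?J. \<xi> i \<omega>) -` ?B \<inter> space M = B k"
      "(\<lambda>\<omega>. (\<lambda>i\<in>?I. \<xi> i \<omega>, \<lambda>i\<in>?J. \<xi> i \<omega>)) -` (?A \<times> ?B) \<inter> space M = A k \<inter> B k"
      unfolding A_def B_def vimage_def mem_Times_iff fst_conv snd_conv memA memB by auto
    with indep_varD[OF iv AB] show ?thesis by simp
  qed
  have [measurable]: "A k \<in> events" if "k \<le> n" for k
  proof -
    have "(\<lambda>\<omega>. \<Sum>i<j. \<xi> i \<omega>) \<in> borel_measurable M" if "j < k" for j
      using that \<open>k \<le> n\<close> by (intro S) simp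
    with S[OF that] show ?thesis unfolding A_def by measurable
  qed
  have [measurable]: "B k \<in> events" if "k \<le> n" for k
  proof -
    have "(\<lambda>\<omega>. \<Sum>i\<in>{k..<c k}. \<xi> i \<omega>) \<in> borel_measurable M"
      using c[OF that] rv by (intro borel_measurable_sum) auto
    then show ?thesis unfolding B_def by measurable
  qed
  have [measurable]: "E \<in> events"
  proof -
    have "(\<lambda>\<omega>. \<Sum>i<c k. \<xi> i \<omega>) \<in> borel_measurable M" if "k \<le> n" for k
      using c[OF that] by (intro S)
    then have "{\<omega>\<in>space M. (\<Sum>i<c k. \<xi> i \<omega>) > a} \<in> events" if "k \<le> n" for k
      using that by measurable
    moreover have "E = (\<Union>k\<in>{..n}. {\<omega>\<in>space M. (\<Sum>i<c k. \<xi> i \<omega>) > a})"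
      by (auto simp: E_def)
    ultimately show ?thesis by auto
  qed
  have disj: "disjoint_family_on A {..n}"
  proof (unfold disjoint_family_on_def, intro ballI impI)
    fix k m :: nat assume "k \<noteq> m"
    then show "A k \<inter> A m = {}"
      unfolding A_def by (cases k m rule: linorder_cases) force+
  qed
  then have disjB: "disjoint_family_on (\<lambda>k. A k \<inter> B k) {..n}"
    by (auto simp: disjoint_family_on_def)
  have U: "{\<omega>\<in>space M. \<exists>k\<le>n. (\<Sum>i<k. \<xi> i \<omega>) > a + b} = (\<Union>k\<in>{..n}. A k)"
  proof (intro set_eqI iffI)
    fix \<omega> assume *: "\<omega> \<in> {\<omega>\<in>space M. \<exists>k\<le>n. (\<Sum>i<k. \<xi> i \<omega>) > a + b}"
    define k where "k = (LEAST k. (\<Sum>i<k. \<xi> i \<omega>) > a + b)"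
    from * obtain m where m: "m \<le> n" "(\<Sum>i<m. \<xi> i \<omega>) > a + b" by blast
    have "(\<Sum>i<k. \<xi> i \<omega>) > a + b" unfolding k_def by (rule LeastI[of _ m]) (rule m)
    moreover have "k \<le> n" unfolding k_def using Least_le[of "\<lambda>k. (\<Sum>i<k. \<xi> i \<omega>) > a + b" m] m by simp
    moreover have "\<forall>j<k. (\<Sum>i<j. \<xi> i \<omega>) \<le> a + b"
      unfolding k_def using not_less_Least[of _ "\<lambda>k. (\<Sum>i<k. \<xi> i \<omega>) > a + b"] by (auto simp: not_less)
    ultimately show "\<omega> \<in> (\<Union>k\<in>{..n}. A k)" using * by (auto simp: A_def)
  qed (auto simp: A_def)
  have "prob (\<Union>k\<in>{..n}. A k) = (\<Sum>k\<le>n. prob (A k))"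
    using disj by (intro finite_measure_finite_Union) auto
  also have "\<dots> \<le> (\<Sum>k\<le>n. 2 * prob (A k \<inter> B k))"
  proof (rule sum_mono)
    fix k assume "k \<in> {..n}"
    then have "1/2 \<le> prob (B k)" using half[of k] by (simp add: B_def)
    then have "prob (A k) * 1 \<le> prob (A k) * (2 * prob (B k))"
      by (intro mult_left_mono) auto
    then show "prob (A k) \<le> 2 * prob (A k \<inter> B k)"
      using indAB[of k] \<open>k \<in> {..n}\<close> by simp
  qed
  also have "\<dots> = 2 * prob (\<Union>k\<in>{..n}. A k \<inter> B k)"
    unfolding sum_distrib_left[symmetric]
    using disjB by (subst finite_measure_finite_Union) auto
  \<comment> \<open>On \<open>A k \<inter> B k\<close> the sum up to \<open>c k\<close> exceeds
    \<open>(a + b) - b\<close>.\<close>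
  also have "prob (\<Union>k\<in>{..n}. A k \<inter> B k) \<le> prob E"
  proof (rule finite_measure_mono)
    show "(\<Union>k\<in>{..n}. A k \<inter> B k) \<subseteq> E"
    proof
      fix \<omega> assume "\<omega> \<in> (\<Union>k\<in>{..n}. A k \<inter> B k)"
      then obtain k where k: "k \<le> n" "\<omega> \<in> A k" "\<omega> \<in> B k" by auto
      have "(\<Sum>i<c k. \<xi> i \<omega>) = (\<Sum>i<k. \<xi> i \<omega>) + (\<Sum>i\<in>{k..<c k}. \<xi> i \<omega>)"
        using c(1)[OF k(1)] by (simp add: lessThan_atLeast0 sum.atLeastLessThan_concat)
      then show "\<omega> \<in> E" using k by (auto simp: A_def B_def E_def intro!: exI[of _ k])
    qed
  qed measurable
  finally show ?thesis unfolding U E_def by simp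
qed

end

section \<open>Levy processes\<close>

text \<open>Unbounded values would occur at times accumulating at some \<open>l\<close> of the
  compact interval, but the left and right limits bound the path near \<open>l\<close>.\<close>

lemma cadlag_bounded:
  assumes "cadlag x"
  shows "bounded (x ` {0..T})"
proof (rule ccontr)
  assume nb: "\<not> bounded (x ` {0..T})"
  have "\<exists>t\<in>{0..T}. \<bar>x t\<bar> > real n" for n :: nat
    using nb unfolding bounded_iff by (force simp: not_le)
  then obtain t where t: "\<And>n. t n \<in> {0..T}" "\<And>n. \<bar>x (t n)\<bar> > real n" by metis
  have "compact {0..T}" by simp
  then obtain l r where l: "l \<in> {0..T}" and r: "strict_mono r" and lim: "(t \<circ> r) \<longlonglongrightarrow> l"
    using t(1) unfolding compact_def by metis
  \<comment> \<open>The guard \<open>0 \<le> s\<close> is for \<open>l = 0\<close>, where a cadlag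
    path is not controlled on the left.\<close>
  have "\<exists>B. eventually (\<lambda>s. 0 \<le> s \<longrightarrow> \<bar>x s\<bar> \<le> B) (nhds l)"
  proof -
    have "(x \<longlongrightarrow> x l) (at_right l)" using assms l by (auto simp: cadlag_def)
    from order_tendstoD(2)[OF tendsto_rabs[OF this], of "\<bar>x l\<bar> + 1"]
    have R: "eventually (\<lambda>s. \<bar>x s\<bar> < \<bar>x l\<bar> + 1) (at_right l)" by simp
    have "\<exists>B. eventually (\<lambda>s. 0 \<le> s \<longrightarrow> \<bar>x s\<bar> \<le> B) (at_left l)"
    proof (cases "l = 0")
      case True
      have "eventually (\<lambda>s. s < 0) (at_left (0::real))" by (simp add: eventually_at_filter)
      then show ?thesis unfolding True by (intro exI[of _ 0]) (erule eventually_mono, simp)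
    next
      case False
      then have "0 < l" using l by simp
      then obtain m where "(x \<longlongrightarrow> m) (at_left l)" using assms by (auto simp: cadlag_def)
      from order_tendstoD(2)[OF tendsto_rabs[OF this], of "\<bar>m\<bar> + 1"]
      have "eventually (\<lambda>s. \<bar>x s\<bar> < \<bar>m\<bar> + 1) (at_left l)" by simp
      then show ?thesis by (intro exI[of _ "\<bar>m\<bar> + 1"]) (erule eventually_mono, simp)
    qed
    then obtain B where L: "eventually (\<lambda>s. 0 \<le> s \<longrightarrow> \<bar>x s\<bar> \<le> B) (at_left l)" by blast
    have "eventually (\<lambda>s. 0 \<le> s \<longrightarrow> \<bar>x s\<bar> \<le> max B (\<bar>x l\<bar> + 1)) (at l)"
      unfolding eventually_at_split
      by (intro conjI eventually_mono[OF L] eventually_mono[OF R]) auto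
    then show ?thesis
      by (intro exI[of _ "max B (\<bar>x l\<bar> + 1)"]) (simp add: eventually_nhds_conv_at le_max_iff_disj)
  qed
  then obtain B where "eventually (\<lambda>s. 0 \<le> s \<longrightarrow> \<bar>x s\<bar> \<le> B) (nhds l)" by blast
  from eventually_compose_filterlim[OF this lim]
  have "eventually (\<lambda>n. \<bar>x (t (r n))\<bar> \<le> B) sequentially"
    by (rule eventually_mono) (use t(1) in auto)
  then obtain N where N: "\<And>n. N \<le> n \<Longrightarrow> \<bar>x (t (r n))\<bar> \<le> B"
    by (auto simp: eventually_sequentially)
  \<comment> \<open>Since \<open>r n \<ge> n\<close>, the value at time \<open>t (r n)\<close> is at
    most \<open>B\<close> and yet greater than \<open>r n \<ge> B\<close> in modulus.\<close>
  define n where "n = max N (nat \<lceil>B\<rceil>)"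
  have "B \<le> real (r n)"
    using seq_suble[OF r, of n] unfolding n_def by linarith
  then show False using N[of n] t(2)[of "r n"] by (simp add: n_def)
qed

section \<open>Dyadic times\<close>

lemma countable_dyadics: "countable (dyadics :: 'a::field_char_0 set)"
  unfolding dyadics_def by (intro countable_UN) auto

lemma dyadics_nonneg: "r \<in> dyadics \<Longrightarrow> 0 \<le> (r::real)"
  by (auto simp: dyadics_def)

lemma dyadics_dense:
  assumes "0 \<le> a" "a < b"
  obtains r :: real where "r \<in> dyadics" "a < r" "r < b"
proof -
  obtain j where j: "1 / 2 ^ j < b - a"
    using assms real_arch_pow_inv[of "b - a" "1/2"] by (auto simp: power_one_over)
  \<comment> \<open>\<open>k / 2 ^ j\<close> is the first point to the right of \<open>a\<close> on
    a grid whose mesh is smaller than \<open>b - a\<close>.\<close>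
  define k where "k = Suc (nat \<lfloor>a * 2 ^ j\<rfloor>)"
  have "0 \<le> a * 2 ^ j" using assms by simp
  then have "a * 2 ^ j < real k" "real k \<le> a * 2 ^ j + 1"
    unfolding k_def by linarith+
  then have "a < real k / 2 ^ j" "real k / 2 ^ j \<le> a + 1 / 2 ^ j"
    by (simp_all add: field_simps)
  then show thesis using j
    by (intro that[of "real k / 2 ^ j"]) (auto simp: dyadics_def)
qed

section \<open>Increments of Levy processes on equidistant grids\<close>

lemma levy_processD:
  assumes "levy_process M X"
  shows levy_prob_space: "prob_space M"
    and levy_measurable: "0 \<le> t \<Longrightarrow> X t \<in> borel_measurable M"
    and levy_AE_0: "AE \<omega> in M. X 0 \<omega> = 0"
    and levy_indep: "0 \<le> u 0 \<Longrightarrow> mono u \<Longrightarrow>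
      prob_space.indep_vars M (\<lambda>_. borel) (\<lambda>i \<omega>. X (u (Suc i)) \<omega> - X (u i) \<omega>) {..<n}"
    and levy_distr: "0 \<le> s \<Longrightarrow> 0 \<le> h \<Longrightarrow>
      distr M borel (\<lambda>\<omega>. X (s + h) \<omega> - X s \<omega>) = distr M borel (X h)"
    and levy_AE_cadlag: "AE \<omega> in M. cadlag (\<lambda>t. X t \<omega>)"
  using assms unfolding levy_process_def by auto

text \<open>Independence concerns finite subfamilies only, and each of these lies in some initial
  segment.\<close>

lemma (in prob_space) indep_vars_UNIV_I:
  assumes "\<And>n. indep_vars N X {..<n::nat}"
  shows "indep_vars N X UNIV"
proof -
  have rv: "random_variable (N i) (X i)" for i
    using assms[of "Suc i"] unfolding indep_vars_def2 by (elim conjE bspec) simp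
  have "indep_sets (\<lambda>i. {X i -` A \<inter> space M |A. A \<in> sets (N i)}) J" if "finite J" for J
  proof -
    obtain n where n: "J \<subseteq> {..<n}" using finite_nat_bounded[OF \<open>finite J\<close>] by blast
    have "indep_sets (\<lambda>i. {X i -` A \<inter> space M |A. A \<in> sets (N i)}) {..<n}"
      using assms[of n] unfolding indep_vars_def2 by (rule conjunct2)
    with n show ?thesis by (rule indep_sets_mono_index)
  qed
  then have "indep_sets (\<lambda>i. {X i -` A \<inter> space M |A. A \<in> sets (N i)}) UNIV"
    by (subst indep_sets_finite_index_sets) (intro allI impI)
  with rv show ?thesis unfolding indep_vars_def2 by (intro conjI ballI)
qed

lemma levy_increments_iid:
  assumes X: "levy_process M X" and L: "0 < L"
  shows "prob_space.iid_vars M (\<lambda>i \<omega>. X (real (Suc i) / L) \<omega> - X (real i / L) \<omega>) UNIV"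
proof -
  interpret prob_space M by (rule levy_prob_space[OF X])
  have "mono (\<lambda>i. real i / L)" using L by (auto simp: mono_def divide_right_mono)
  with levy_indep[OF X, of "\<lambda>i. real i / L"]
  have "indep_vars (\<lambda>_. borel) (\<lambda>i \<omega>. X (real (Suc i) / L) \<omega> - X (real i / L) \<omega>) UNIV"
    by (intro indep_vars_UNIV_I) simp
  moreover have "distr M borel (\<lambda>\<omega>. X (real (Suc i) / L) \<omega> - X (real i / L) \<omega>) = distr M borel (X (1 / L))"
    for i using levy_distr[OF X, of "real i / L" "1 / L"] L by (simp add: add_divide_distrib add.commute)
  ultimately show ?thesis unfolding iid_vars_def by blast
qed

lemma levy_prob_increment:
  assumes X: "levy_process M X" and "0 \<le> s" "s \<le> t" and [measurable]: "Measurable.pred borel P"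
  shows "measure M {\<omega>\<in>space M. P (X t \<omega> - X s \<omega>)} = measure M {\<omega>\<in>space M. P (X (t - s) \<omega>)}"
proof -
  have [measurable]: "X t \<in> borel_measurable M" "X s \<in> borel_measurable M" "X (t - s) \<in> borel_measurable M"
    using assms by (auto intro: levy_measurable[OF X])
  have "measure (distr M borel f) {x. P x} = measure M {\<omega>\<in>space M. P (f \<omega>)}"
    if [measurable]: "f \<in> borel_measurable M" for f
    by (subst measure_distr) (auto intro!: arg_cong[where f="measure M"])
  from this[of "\<lambda>\<omega>. X t \<omega> - X s \<omega>"] this[of "X (t - s)"] levy_distr[OF X, of s "t - s"]
  show ?thesis using assms by simp
qed

lemma levy_sum_increments:
  fixes X :: "real \<Rightarrow> 'a \<Rightarrow> real"
  assumes "k \<le> m"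
  shows "(\<Sum>i\<in>{k..<m}. X (real (Suc i) / L) \<omega> - X (real i / L) \<omega>) = X (real m / L) \<omega> - X (real k / L) \<omega>"
  using sum_Suc_diff'[OF assms, of "\<lambda>i. X (real i / L) \<omega>"] .

text \<open>Almost every path is bounded on [0,1], so the probability that some dyadic value there
  falls below \<open>- n\<close> tends to 0. A single \<open>b\<close> for all these times is what
  makes Ottaviani's inequality uniform in the mesh.\<close>

lemma levy_lower_bound:
  assumes X: "levy_process M X"
  shows "\<exists>b. \<forall>r\<in>dyadics. r \<le> 1 \<longrightarrow> 1/2 \<le> measure M {\<omega>\<in>space M. X r \<omega> \<ge> - b}"
proof -
  interpret prob_space M by (rule levy_prob_space[OF X])
  let ?D = "dyadics \<inter> {..1}"
  have rv: "X r \<in> borel_measurable M" if "r \<in> ?D" for r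
    using that dyadics_nonneg by (intro levy_measurable[OF X]) auto
  define F where "F n = {\<omega>\<in>space M. \<exists>r\<in>?D. X r \<omega> < - real n}" for n :: nat
  have [measurable]: "F n \<in> events" for n
  proof -
    have "F n = (\<Union>r\<in>?D. {\<omega>\<in>space M. X r \<omega> < - real n})" by (auto simp: F_def)
    moreover have "{\<omega>\<in>space M. X r \<omega> < - real n} \<in> events" if "r \<in> ?D" for r
      using rv[OF that] by measurable
    ultimately show ?thesis
      using countable_dyadics by (auto intro!: sets.countable_UN')
  qed
  have "AE \<omega> in M. \<omega> \<notin> (\<Inter>n. F n)"
    using levy_AE_cadlag[OF X]
  proof eventually_elim
    case (elim \<omega>)
    from cadlag_bounded[OF elim, of 1] obtain B where B: "\<forall>t\<in>{0..1}. \<bar>X t \<omega>\<bar> \<le> B"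
      by (auto simp: bounded_iff)
    have "- real (nat \<lceil>B\<rceil>) \<le> X r \<omega>" if "r \<in> ?D" for r
    proof -
      have "\<bar>X r \<omega>\<bar> \<le> B" using B that dyadics_nonneg[of r] by auto
      then show ?thesis by linarith
    qed
    then have "\<omega> \<notin> F (nat \<lceil>B\<rceil>)" by (force simp: F_def)
    then show ?case by blast
  qed
  then have "prob (\<Inter>n. F n) = 0" by (subst prob_eq_0) auto
  moreover have "(\<lambda>n. prob (F n)) \<longlonglongrightarrow> prob (\<Inter>n. F n)"
  proof (intro finite_Lim_measure_decseq decseq_SucI)
    show "F (Suc n) \<subseteq> F n" for n
    proof
      fix \<omega> assume "\<omega> \<in> F (Suc n)"
      then obtain r where r: "\<omega> \<in> space M" "r \<in> ?D" "X r \<omega> < - real (Suc n)" by (auto simp: F_def)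
      from r(3) have "X r \<omega> < - real n" by simp
      with r(1,2) show "\<omega> \<in> F n" by (auto simp: F_def)
    qed
  qed auto
  ultimately have "eventually (\<lambda>n. prob (F n) < 1/2) sequentially"
    using order_tendstoD(2)[of "\<lambda>n. prob (F n)" 0 sequentially "1/2"] by simp
  then obtain n where n: "prob (F n) < 1/2" by (auto simp: eventually_sequentially)
  have "1/2 \<le> prob {\<omega>\<in>space M. X r \<omega> \<ge> - real n}" if r: "r \<in> ?D" for r
  proof -
    note [measurable] = rv[OF r]
    have "prob {\<omega>\<in>space M. \<not> X r \<omega> \<ge> - real n} \<le> prob (F n)"
    proof (rule finite_measure_mono)
      show "{\<omega>\<in>space M. \<not> X r \<omega> \<ge> - real n} \<subseteq> F n" using r by (auto simp: F_def not_le)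
    qed simp
    then show ?thesis using n prob_neg[of "\<lambda>\<omega>. X r \<omega> \<ge> - real n"] by simp
  qed
  then show ?thesis by (intro exI[of _ "real n"]) auto
qed

lemma dyadicsI: "real k / 2 ^ j \<in> dyadics"
  by (auto simp: dyadics_def)

lemma dyadicsE:
  assumes "r \<in> dyadics"
  obtains k j where "r = real k / 2 ^ j"
  using assms by (auto simp: dyadics_def)

lemma sets_dyadics_exceed:
  fixes f :: "real \<Rightarrow> 'a \<Rightarrow> real"
  assumes "\<And>r. r \<in> dyadics \<Longrightarrow> f r \<in> borel_measurable M"
  shows "{\<omega>\<in>space M. \<exists>r\<in>dyadics. r \<le> c \<and> f r \<omega> > a} \<in> sets M"
proof -
  have *: "{\<omega>\<in>space M. \<exists>r\<in>dyadics. r \<le> c \<and> f r \<omega> > a} =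
    (\<Union>r\<in>dyadics. {\<omega>\<in>space M. r \<le> c \<and> f r \<omega> > a})" by auto
  have "{\<omega>\<in>space M. r \<le> c \<and> f r \<omega> > a} \<in> sets M" if "r \<in> dyadics" for r
    using assms[OF that] by measurable
  then show ?thesis
    unfolding * by (intro sets.countable_UN' countable_dyadics image_subsetI)
qed

context prob_space
begin

text \<open>The events along the grids of mesh \<open>1 / 2 ^ j\<close> increase with
  \<open>j\<close> and exhaust the dyadic times up to \<open>N\<close>, so a bound uniform in
  \<open>j\<close> survives by continuity from below.\<close>

lemma prob_dyadics_le:
  fixes Q :: "real \<Rightarrow> 'a \<Rightarrow> bool"
  assumes meas: "\<And>r. r \<in> dyadics \<Longrightarrow> r \<le> real N \<Longrightarrow> {\<omega>\<in>space M. Q r \<omega>} \<in> events"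
    and le: "\<And>j. prob {\<omega>\<in>space M. \<exists>k\<le>N * 2 ^ j. Q (real k / 2 ^ j) \<omega>} \<le> h"
  shows "prob {\<omega>\<in>space M. \<exists>r\<in>dyadics. r \<le> real N \<and> Q r \<omega>} \<le> h"
proof -
  define E where "E j = {\<omega>\<in>space M. \<exists>k\<le>N * 2 ^ j. Q (real k / 2 ^ j) \<omega>}" for j :: nat
  have le_N: "real k / 2 ^ j \<le> real N \<longleftrightarrow> k \<le> N * 2 ^ j" for k j :: nat
  proof -
    have "real k / 2 ^ j \<le> real N \<longleftrightarrow> real k \<le> real (N * 2 ^ j)"
      by (simp add: pos_divide_le_eq)
    then show ?thesis by (simp only: of_nat_le_iff)
  qed
  have E: "E j \<in> events" for j
  proof -
    have "E j = (\<Union>k\<in>{..N * 2 ^ j}. {\<omega>\<in>space M. Q (real k / 2 ^ j) \<omega>})" by (auto simp: E_def)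
    moreover have "{\<omega>\<in>space M. Q (real k / 2 ^ j) \<omega>} \<in> events" if "k \<in> {..N * 2 ^ j}" for k
      using that le_N[of k j] by (intro meas dyadicsI) simp_all
    ultimately show ?thesis by (simp add: sets.finite_UN)
  qed
  have "incseq E"
  proof (rule incseq_SucI, rule subsetI)
    fix j \<omega> assume "\<omega> \<in> E j"
    then obtain k where k: "\<omega> \<in> space M" "k \<le> N * 2 ^ j" "Q (real k / 2 ^ j) \<omega>" by (auto simp: E_def)
    have "Q (real (2 * k) / 2 ^ Suc j) \<omega>" using k(3) by simp
    moreover have "2 * k \<le> N * 2 ^ Suc j" using k(2) by simp
    ultimately show "\<omega> \<in> E (Suc j)" unfolding E_def using k(1) by blast
  qed
  then have "(\<lambda>j. prob (E j)) \<longlonglongrightarrow> prob (\<Union>j. E j)"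
    using E by (intro finite_Lim_measure_incseq) auto
  moreover have "(\<Union>j. E j) = {\<omega>\<in>space M. \<exists>r\<in>dyadics. r \<le> real N \<and> Q r \<omega>}"
  proof (intro set_eqI iffI)
    fix \<omega> assume "\<omega> \<in> {\<omega>\<in>space M. \<exists>r\<in>dyadics. r \<le> real N \<and> Q r \<omega>}"
    then obtain r where "\<omega> \<in> space M" "r \<in> dyadics" "r \<le> real N" "Q r \<omega>" by blast
    moreover from this(2) obtain k j where "r = real k / 2 ^ j" by (rule dyadicsE)
    ultimately have "\<omega> \<in> E j" unfolding E_def using le_N[of k j] by blast
    then show "\<omega> \<in> (\<Union>j. E j)" by blast
  next
    fix \<omega> assume "\<omega> \<in> (\<Union>j. E j)"
    then obtain j k where "\<omega> \<in> space M" "k \<le> N * 2 ^ j" "Q (real k / 2 ^ j) \<omega>"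
      unfolding E_def by blast
    then show "\<omega> \<in> {\<omega>\<in>space M. \<exists>r\<in>dyadics. r \<le> real N \<and> Q r \<omega>}"
      using le_N[of k j] dyadicsI[of k j] by blast
  qed
  ultimately have "(\<lambda>j. prob (E j)) \<longlonglongrightarrow> prob {\<omega>\<in>space M. \<exists>r\<in>dyadics. r \<le> real N \<and> Q r \<omega>}"
    by simp
  then show ?thesis
    by (rule LIMSEQ_le_const2) (use le in \<open>simp add: E_def\<close>)
qed

end

section \<open>Suprema of Levy processes with negative mean\<close>

lemma ext_expectation_cong_AE:
  assumes "AE \<omega> in M. f \<omega> = g \<omega>"
  shows "ext_expectation M f = ext_expectation M g"
proof -
  have "(\<integral>\<^sup>+\<omega>. ennreal (f \<omega>) \<partial>M) = (\<integral>\<^sup>+\<omega>. ennreal (g \<omega>) \<partial>M)"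
    "(\<integral>\<^sup>+\<omega>. ennreal (- f \<omega>) \<partial>M) = (\<integral>\<^sup>+\<omega>. ennreal (- g \<omega>) \<partial>M)"
    using assms by (auto intro!: nn_integral_cong_AE elim!: eventually_mono)
  then show ?thesis unfolding ext_expectation_def by simp
qed

lemma levy_AE_increment:
  assumes "levy_process M W"
  shows "AE \<omega> in M. W t \<omega> - W 0 \<omega> = W t \<omega>"
  using levy_AE_0[OF assms] by eventually_elim simp

lemma levy_ext_expectation_increment:
  assumes W: "levy_process M W"
  shows "ext_expectation M (\<lambda>\<omega>. W 1 \<omega> - W 0 \<omega>) = ext_expectation M (W 1)"
  by (rule ext_expectation_cong_AE[OF levy_AE_increment[OF W]])

text \<open>Ottaviani's inequality, where \<open>c k\<close> is the next integer time after the \<open>k\<close>-th grid point.\<close>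

lemma levy_grid_bound:
  fixes W :: "real \<Rightarrow> 'a \<Rightarrow> real" and b :: real
  assumes W: "levy_process M W"
    and b: "\<forall>r\<in>dyadics. r \<le> 1 \<longrightarrow> 1/2 \<le> measure M {\<omega>\<in>space M. W r \<omega> \<ge> - b}"
  defines "\<eta> \<equiv> \<lambda>j i \<omega>. W (real (Suc i) / 2 ^ j) \<omega> - W (real i / 2 ^ j) \<omega>"
  shows "measure M {\<omega>\<in>space M. \<exists>k\<le>N * 2 ^ j. (\<Sum>i<k. \<eta> j i \<omega>) > a} \<le>
    2 * measure M {\<omega>\<in>space M. \<exists>m::nat. W (real m) \<omega> - W 0 \<omega> > a - b}"
proof -
  interpret prob_space M by (rule levy_prob_space[OF W])
  let ?L = "2 ^ j :: nat" and ?n = "N * 2 ^ j"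
  \<comment> \<open>\<open>c k\<close> rounds \<open>k\<close> up to a multiple of
    \<open>2 ^ j\<close>, so a grid time moves by at most 1, the range in which \<open>b\<close> is
    valid.\<close>
  define c where "c k = ((k + ?L - 1) div ?L) * ?L" for k
  have L: "?L > 0" by simp
  have c: "k \<le> c k" "c k \<le> k + ?L" for k
  proof -
    have "(k + ?L - 1) div ?L * ?L + (k + ?L - 1) mod ?L = k + ?L - 1" by (rule div_mult_mod_eq)
    moreover have "(k + ?L - 1) mod ?L < ?L" using L by (rule mod_less_divisor)
    ultimately show "k \<le> c k" "c k \<le> k + ?L" unfolding c_def using L by linarith+
  qed
  \<comment> \<open>The end point \<open>N * 2 ^ j\<close> is itself a multiple of
    \<open>2 ^ j\<close>, so rounding up never passes it.\<close>
  have c_le: "c k \<le> ?n" if "k \<le> ?n" for k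
  proof -
    have "(k + ?L - 1) div ?L \<le> (?n + ?L - 1) div ?L"
      using that by (intro div_le_mono) simp
    also have "(?n + ?L - 1) div ?L = N"
    proof -
      have "?n + ?L - 1 = (?L - 1) + N * ?L" using L by linarith
      also have "\<dots> div ?L = N + (?L - 1) div ?L" by (rule div_mult_self1) simp
      also have "(?L - 1) div ?L = 0" by (rule div_less) simp
      finally show ?thesis by simp
    qed
    finally show ?thesis unfolding c_def by simp
  qed
  have iid: "iid_vars (\<eta> j) UNIV"
    unfolding \<eta>_def using levy_increments_iid[OF W, of "2 ^ j"] by simp
  have sum: "(\<Sum>i\<in>{k..<m}. \<eta> j i \<omega>) = W (real m / 2 ^ j) \<omega> - W (real k / 2 ^ j) \<omega>" if "k \<le> m" for k m \<omega>
    unfolding \<eta>_def by (rule levy_sum_increments[OF that])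
  have half: "1/2 \<le> prob {\<omega>\<in>space M. (\<Sum>i\<in>{k..<c k}. \<eta> j i \<omega>) \<ge> - b}" for k
  proof -
    have "(\<lambda>x. - b \<le> x) \<in> measurable borel (count_space UNIV)" by measurable
    from levy_prob_increment[OF W _ _ this, of "real k / 2 ^ j" "real (c k) / 2 ^ j"]
    have "prob {\<omega>\<in>space M. (\<Sum>i\<in>{k..<c k}. \<eta> j i \<omega>) \<ge> - b} =
      prob {\<omega>\<in>space M. W (real (c k) / 2 ^ j - real k / 2 ^ j) \<omega> \<ge> - b}"
      using c(1)[of k] by (simp add: sum divide_right_mono)
    moreover have r: "real (c k) / 2 ^ j - real k / 2 ^ j = real (c k - k) / 2 ^ j"
      using c(1)[of k] by (simp add: of_nat_diff diff_divide_distrib)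
    moreover have "real (c k - k) / 2 ^ j \<in> dyadics" by (rule dyadicsI)
    moreover have "real (c k - k) / 2 ^ j \<le> 1"
    proof -
      have "c k - k \<le> ?L" using c(2)[of k] by linarith
      then have "real (c k - k) \<le> real ?L" by (simp only: of_nat_le_iff)
      then show ?thesis by simp
    qed
    ultimately show ?thesis using b by simp
  qed
  \<comment> \<open>The level \<open>a\<close> is split as \<open>(a - b) + b\<close>: returning to
    integer times costs \<open>b\<close>.\<close>
  have "prob {\<omega>\<in>space M. \<exists>k\<le>?n. (\<Sum>i<k. \<eta> j i \<omega>) > (a - b) + b} \<le>
      2 * prob {\<omega>\<in>space M. \<exists>k\<le>?n. (\<Sum>i<c k. \<eta> j i \<omega>) > a - b}"
    using iid_vars_subset[OF iid, of "{..<?n}"] c c_le half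
    by (intro ottaviani_inequality) (auto simp: iid_vars_def)
  also have "prob {\<omega>\<in>space M. \<exists>k\<le>?n. (\<Sum>i<c k. \<eta> j i \<omega>) > a - b} \<le>
      prob {\<omega>\<in>space M. \<exists>m::nat. W (real m) \<omega> - W 0 \<omega> > a - b}"
  proof (rule finite_measure_mono)
    have "(\<Sum>i<c k. \<eta> j i \<omega>) = W (real ((k + ?L - 1) div ?L)) \<omega> - W 0 \<omega>" for k \<omega>
    proof -
      have "(\<Sum>i<c k. \<eta> j i \<omega>) = W (real (c k) / 2 ^ j) \<omega> - W 0 \<omega>"
        using sum[of 0 "c k"] by (simp add: lessThan_atLeast0)
      moreover have "real (c k) / 2 ^ j = real ((k + ?L - 1) div ?L)"
        unfolding c_def by (simp only: of_nat_mult of_nat_power) simp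
      ultimately show ?thesis by simp
    qed
    then show "{\<omega>\<in>space M. \<exists>k\<le>?n. (\<Sum>i<c k. \<eta> j i \<omega>) > a - b} \<subseteq>
      {\<omega>\<in>space M. \<exists>m::nat. W (real m) \<omega> - W 0 \<omega> > a - b}" by auto
    have [measurable]: "W (real m) \<in> borel_measurable M" "W 0 \<in> borel_measurable M" for m
      by (auto intro: levy_measurable[OF W])
    show "{\<omega>\<in>space M. \<exists>m::nat. W (real m) \<omega> - W 0 \<omega> > a - b} \<in> events" by measurable
  qed
  finally show ?thesis by simp
qed

text \<open>This is tightness: \<open>h\<close> does not depend on \<open>N\<close>. The grid bound
  compares with the walk at integer times, whose negative drift controls its supremum; the second
  estimate comes from the first by reversing time on each grid.\<close>

lemma levy_exceeds_bound:
  assumes W: "levy_process M W" and neg: "ext_expectation M (W 1) < 0"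
  shows "\<exists>h. (h \<longlongrightarrow> 0) at_top \<and>
    (\<forall>a N. measure M {\<omega>\<in>space M. \<exists>r\<in>dyadics. r \<le> real N \<and> W r \<omega> > a} \<le> h a) \<and>
    (\<forall>a N. measure M {\<omega>\<in>space M. \<exists>r\<in>dyadics. r \<le> real N \<and> W (real N) \<omega> - W r \<omega> > a} \<le> h a)"
proof -
  interpret prob_space M by (rule levy_prob_space[OF W])
  have rv: "W r \<in> borel_measurable M" if "0 \<le> r" for r
    using that by (rule levy_measurable[OF W])
  obtain b where b: "\<forall>r\<in>dyadics. r \<le> 1 \<longrightarrow> 1/2 \<le> prob {\<omega>\<in>space M. W r \<omega> \<ge> - b}"
    using levy_lower_bound[OF W] by blast
  define h where "h a = 2 * prob {\<omega>\<in>space M. \<exists>m::nat. W (real m) \<omega> - W 0 \<omega> > a - b}" for a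
  have lim: "(h \<longlongrightarrow> 0) at_top"
  proof -
    have "iid_vars (\<lambda>i \<omega>. W (real (Suc i) / 1) \<omega> - W (real i / 1) \<omega>) UNIV"
      by (rule levy_increments_iid[OF W]) simp
    then have iid: "iid_vars (\<lambda>i \<omega>. W (real (Suc i)) \<omega> - W (real i) \<omega>) UNIV" by simp
    have sum: "(\<Sum>i<m. W (real (Suc i)) \<omega> - W (real i) \<omega>) = W (real m) \<omega> - W 0 \<omega>" for m \<omega>
      using sum_lessThan_telescope[of "\<lambda>i. W (real i) \<omega>" m] by simp
    have "((\<lambda>a. prob {\<omega>\<in>space M. \<exists>m. (\<Sum>i<m. W (real (Suc i)) \<omega> - W (real i) \<omega>) > real m * 0 + a}) \<longlongrightarrow> 0) at_top"
      using neg levy_ext_expectation_increment[OF W]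
      by (intro walk_exceeds_tendsto_0[OF iid]) (simp add: zero_ereal_def)
    then have "((\<lambda>a. prob {\<omega>\<in>space M. \<exists>m::nat. W (real m) \<omega> - W 0 \<omega> > a}) \<longlongrightarrow> 0) at_top"
      unfolding sum by simp
    moreover have "filterlim (\<lambda>a. a - b) at_top at_top"
      by real_asymp
    ultimately have "((\<lambda>a. prob {\<omega>\<in>space M. \<exists>m::nat. W (real m) \<omega> - W 0 \<omega> > a - b}) \<longlongrightarrow> 0) at_top"
      by (rule filterlim_compose)
    from tendsto_mult_left[OF this, of 2] show ?thesis by (simp add: h_def[abs_def])
  qed
  let ?\<eta> = "\<lambda>j i \<omega>. W (real (Suc i) / 2 ^ j) \<omega> - W (real i / 2 ^ j) \<omega>"
  have grid: "prob {\<omega>\<in>space M. \<exists>k\<le>N * 2 ^ j. (\<Sum>i<k. ?\<eta> j i \<omega>) > a} \<le> h a" for N j a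
    unfolding h_def by (rule levy_grid_bound[OF W b])
  have sum: "(\<Sum>i\<in>{k..<m}. ?\<eta> j i \<omega>) = W (real m / 2 ^ j) \<omega> - W (real k / 2 ^ j) \<omega>" if "k \<le> m" for k m j \<omega>
    by (rule levy_sum_increments[OF that])
  have forward: "prob {\<omega>\<in>space M. \<exists>r\<in>dyadics. r \<le> real N \<and> W r \<omega> > a} \<le> h a" for a N
  proof -
    \<comment> \<open>The grid estimates concern increments from time 0, and the start at 0 holds
      only almost surely.\<close>
    have "prob {\<omega>\<in>space M. \<exists>r\<in>dyadics. r \<le> real N \<and> W r \<omega> > a} =
        prob {\<omega>\<in>space M. \<exists>r\<in>dyadics. r \<le> real N \<and> W r \<omega> - W 0 \<omega> > a}"
    proof (rule measure_eq_AE)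
      show "{\<omega>\<in>space M. \<exists>r\<in>dyadics. r \<le> real N \<and> W r \<omega> > a} \<in> events"
        by (intro sets_dyadics_exceed rv dyadics_nonneg)
      show "{\<omega>\<in>space M. \<exists>r\<in>dyadics. r \<le> real N \<and> W r \<omega> - W 0 \<omega> > a} \<in> events"
        by (intro sets_dyadics_exceed borel_measurable_diff rv dyadics_nonneg order_refl)
      show "AE \<omega> in M. (\<omega> \<in> {\<omega>\<in>space M. \<exists>r\<in>dyadics. r \<le> real N \<and> W r \<omega> > a}) =
          (\<omega> \<in> {\<omega>\<in>space M. \<exists>r\<in>dyadics. r \<le> real N \<and> W r \<omega> - W 0 \<omega> > a})"
        using levy_AE_0[OF W] by eventually_elim simp
    qed
    also have "\<dots> \<le> h a"
    proof (rule prob_dyadics_le)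
      show "{\<omega>\<in>space M. W r \<omega> - W 0 \<omega> > a} \<in> events" if "r \<in> dyadics" for r
        using rv[OF dyadics_nonneg[OF that]] rv[of 0] by measurable
      show "prob {\<omega>\<in>space M. \<exists>k\<le>N * 2 ^ j. W (real k / 2 ^ j) \<omega> - W 0 \<omega> > a} \<le> h a" for j
        using grid[of N j a] sum[of 0] by (simp add: lessThan_atLeast0)
    qed
    finally show ?thesis .
  qed
  have backward: "prob {\<omega>\<in>space M. \<exists>r\<in>dyadics. r \<le> real N \<and> W (real N) \<omega> - W r \<omega> > a} \<le> h a" for a N
  proof (rule prob_dyadics_le)
    show "{\<omega>\<in>space M. W (real N) \<omega> - W r \<omega> > a} \<in> events" if "r \<in> dyadics" for r
      using rv[OF dyadics_nonneg[OF that]] rv[of "real N"] by measurable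
    fix j
    have "iid_vars (?\<eta> j) UNIV"
      by (rule levy_increments_iid[OF W]) simp
    \<comment> \<open>Reversal permutes the finitely many steps of one grid, which turns
      \<open>grid\<close> into a bound on the increments that end at \<open>N\<close>.\<close>
    from prob_reversed_walk_exceeds[OF iid_vars_subset[OF this subset_UNIV]] grid[of N j a]
    have *: "prob {\<omega>\<in>space M. \<exists>k\<le>N * 2 ^ j. (\<Sum>i\<in>{k..<N * 2 ^ j}. ?\<eta> j i \<omega>) > a} \<le> h a"
      by simp
    have "(\<exists>k\<le>N * 2 ^ j. (\<Sum>i\<in>{k..<N * 2 ^ j}. ?\<eta> j i \<omega>) > a) \<longleftrightarrow>
      (\<exists>k\<le>N * 2 ^ j. W (real N) \<omega> - W (real k / 2 ^ j) \<omega> > a)" for \<omega>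
    proof (intro ex_cong1 conj_cong refl)
      fix k assume "k \<le> N * 2 ^ j"
      from sum[OF this] show "(\<Sum>i\<in>{k..<N * 2 ^ j}. ?\<eta> j i \<omega>) > a \<longleftrightarrow>
          W (real N) \<omega> - W (real k / 2 ^ j) \<omega> > a" by simp
    qed
    with * show "prob {\<omega>\<in>space M. \<exists>k\<le>N * 2 ^ j. W (real N) \<omega> - W (real k / 2 ^ j) \<omega> > a} \<le> h a"
      by simp
  qed
  show ?thesis by (intro exI[of _ h] conjI allI lim forward backward)
qed

section \<open>Differences and negatives of Levy processes\<close>

lemma indep_processes_compose:
  assumes M: "prob_space M" and XY: "indep_processes M X Y"
    and f: "f \<in> measurable (PiM {0..} (\<lambda>_. borel)) N" and g: "g \<in> measurable (PiM {0..} (\<lambda>_. borel)) N'"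
  shows "prob_space.indep_var M N (\<lambda>\<omega>. f (\<lambda>t\<in>{0..}. X t \<omega>)) N' (\<lambda>\<omega>. g (\<lambda>t\<in>{0..}. Y t \<omega>))"
proof -
  interpret prob_space M by fact
  from indep_var_compose[OF XY[unfolded indep_processes_def] f g] show ?thesis
    by (simp only: comp_def)
qed

text \<open>A single family over pairs can be regrouped by the second component. Its joint
  probabilities factor between the two families by \<open>AB\<close>, and within each of them by
  \<open>A\<close> and \<open>B\<close>.\<close>

lemma (in prob_space) indep_vars_pair_family:
  assumes A: "indep_vars (\<lambda>_. N) A {..<n::nat}" and B: "indep_vars (\<lambda>_. N) B {..<n}"
    and AB: "indep_var (PiM {..<n} (\<lambda>_. N)) (\<lambda>\<omega>. \<lambda>i\<in>{..<n}. A i \<omega>)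
      (PiM {..<n} (\<lambda>_. N)) (\<lambda>\<omega>. \<lambda>i\<in>{..<n}. B i \<omega>)"
    and n: "0 < n"
  shows "indep_vars (\<lambda>_. N) (\<lambda>(c, i). if c then A i else B i) (UNIV \<times> {..<n})"
proof -
  let ?U = "\<lambda>(c, i). if c then A i else B i"
  let ?F = "\<lambda>p. {?U p -` S \<inter> space M |S. S \<in> sets N}"
  have rvA: "random_variable N (A i)" if "i < n" for i
    using A that unfolding indep_vars_def2 by (elim conjE bspec) simp
  have rvB: "random_variable N (B i)" if "i < n" for i
    using B that unfolding indep_vars_def2 by (elim conjE bspec) simp
  have rv: "random_variable N (?U p)" if "p \<in> UNIV \<times> {..<n}" for p
    using that rvA rvB by (cases p) auto
  have "indep_sets ?F (UNIV \<times> {..<n})"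
  proof (subst indep_sets_finite)
    show "(UNIV::bool set) \<times> {..<n} \<noteq> {}" "finite ((UNIV::bool set) \<times> {..<n})"
      using n by auto
    show "?F p \<subseteq> events" if "p \<in> UNIV \<times> {..<n}" for p
      using rv[OF that] by (blast intro: measurable_sets)
    show "space M \<in> ?F p" if "p \<in> UNIV \<times> {..<n}" for p
    proof -
      have "space M = ?U p -` space N \<inter> space M"
        using measurable_space[OF rv[OF that]] by blast
      then show ?thesis by blast
    qed
    show "\<forall>E\<in>Pi (UNIV \<times> {..<n}) ?F. prob (\<Inter>p\<in>UNIV \<times> {..<n}. E p) = (\<Prod>p\<in>UNIV \<times> {..<n}. prob (E p))"
    proof
      fix E assume "E \<in> Pi (UNIV \<times> {..<n}) ?F"
      then have "\<forall>p\<in>UNIV \<times> {..<n}. \<exists>S. S \<in> sets N \<and> E p = ?U p -` S \<inter> space M"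
        by blast
      from bchoice[OF this] obtain S where
        S0: "\<forall>p\<in>UNIV \<times> {..<n}. S p \<in> sets N \<and> E p = ?U p -` S p \<inter> space M" ..
      note S = bspec[OF S0, THEN conjunct1] and E = bspec[OF S0, THEN conjunct2]
      have E1: "E (True, i) = A i -` S (True, i) \<inter> space M" if "i < n" for i
        using E[of "(True, i)"] that by simp
      have E0: "E (False, i) = B i -` S (False, i) \<inter> space M" if "i < n" for i
        using E[of "(False, i)"] that by simp
      have P1: "prob (\<Inter>i\<in>{..<n}. E (True, i)) = (\<Prod>i<n. prob (E (True, i)))"
        using indep_varsD_finite[OF A, of "\<lambda>i. S (True, i)"] n S E1 by (simp add: lessThan_empty_iff)
      have P0: "prob (\<Inter>i\<in>{..<n}. E (False, i)) = (\<Prod>i<n. prob (E (False, i)))"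
        using indep_varsD_finite[OF B, of "\<lambda>i. S (False, i)"] n S E0 by (simp add: lessThan_empty_iff)
      let ?S1 = "PiE {..<n} (\<lambda>i. S (True, i))" and ?S0 = "PiE {..<n} (\<lambda>i. S (False, i))"
      have "?S1 \<in> sets (PiM {..<n} (\<lambda>_. N))" "?S0 \<in> sets (PiM {..<n} (\<lambda>_. N))"
        using S by (auto intro!: sets_PiM_I_finite)
      from indep_varD[OF AB this]
      have "prob ((\<lambda>\<omega>. (\<lambda>i\<in>{..<n}. A i \<omega>, \<lambda>i\<in>{..<n}. B i \<omega>)) -` (?S1 \<times> ?S0) \<inter> space M) =
        prob ((\<lambda>\<omega>. \<lambda>i\<in>{..<n}. A i \<omega>) -` ?S1 \<inter> space M) * prob ((\<lambda>\<omega>. \<lambda>i\<in>{..<n}. B i \<omega>) -` ?S0 \<inter> space M)" .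
      moreover have V1: "(\<lambda>\<omega>. \<lambda>i\<in>{..<n}. A i \<omega>) -` ?S1 \<inter> space M = (\<Inter>i\<in>{..<n}. E (True, i))"
        using n E1 by (auto simp: PiE_iff)
      moreover have V0: "(\<lambda>\<omega>. \<lambda>i\<in>{..<n}. B i \<omega>) -` ?S0 \<inter> space M = (\<Inter>i\<in>{..<n}. E (False, i))"
        using n E0 by (auto simp: PiE_iff)
      moreover have "(\<lambda>\<omega>. (\<lambda>i\<in>{..<n}. A i \<omega>, \<lambda>i\<in>{..<n}. B i \<omega>)) -` (?S1 \<times> ?S0) \<inter> space M =
        (\<Inter>p\<in>UNIV \<times> {..<n}. E p)"
      proof -
        have "(\<lambda>\<omega>. (\<lambda>i\<in>{..<n}. A i \<omega>, \<lambda>i\<in>{..<n}. B i \<omega>)) -` (?S1 \<times> ?S0) \<inter> space M =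
          (\<Inter>i\<in>{..<n}. E (True, i)) \<inter> (\<Inter>i\<in>{..<n}. E (False, i))"
          unfolding V1[symmetric] V0[symmetric] by auto
        also have "\<dots> = (\<Inter>p\<in>UNIV \<times> {..<n}. E p)"
          by (auto simp: UNIV_bool)
        finally show ?thesis .
      qed
      moreover have "(\<Prod>p\<in>UNIV \<times> {..<n}. prob (E p)) = (\<Prod>i<n. prob (E (True, i))) * (\<Prod>i<n. prob (E (False, i)))"
      proof -
        have "(\<Prod>p\<in>UNIV \<times> {..<n}. prob (E p)) = (\<Prod>c\<in>UNIV. \<Prod>i<n. prob (E (c, i)))"
          by (simp add: prod.cartesian_product case_prod_eta)
        then show ?thesis by (simp add: UNIV_bool mult.commute)
      qed
      ultimately show "prob (\<Inter>p\<in>UNIV \<times> {..<n}. E p) = (\<Prod>p\<in>UNIV \<times> {..<n}. prob (E p))"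
        using P1 P0 by simp
    qed
  qed
  with rv show ?thesis unfolding indep_vars_def2 by (intro conjI ballI)
qed

text \<open>Each difference is a function of the block of indices \<open>(True, i)\<close> and
  \<open>(False, i)\<close>, and disjoint blocks of an independent family are independent.\<close>

lemma (in prob_space) indep_vars_diff_family:
  fixes A B :: "nat \<Rightarrow> 'a \<Rightarrow> real"
  assumes A: "indep_vars (\<lambda>_. borel) A {..<n}" and B: "indep_vars (\<lambda>_. borel) B {..<n}"
    and AB: "indep_var (PiM {..<n} (\<lambda>_. borel)) (\<lambda>\<omega>. \<lambda>i\<in>{..<n}. A i \<omega>)
      (PiM {..<n} (\<lambda>_. borel)) (\<lambda>\<omega>. \<lambda>i\<in>{..<n}. B i \<omega>)"
  shows "indep_vars (\<lambda>_. borel) (\<lambda>i \<omega>. A i \<omega> - B i \<omega>) {..<n}"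
proof (cases "n = 0")
  case True
  then show ?thesis by (simp add: indep_vars_def2 indep_sets_def)
next
  case False
  let ?U = "\<lambda>(c, i). if c then A i else B i"
  let ?K = "\<lambda>i::nat. (UNIV::bool set) \<times> {i}"
  have "indep_vars (\<lambda>i. PiM (?K i) (\<lambda>_. borel)) (\<lambda>i \<omega>. restrict (\<lambda>p. ?U p \<omega>) (?K i)) {..<n}"
    using False by (intro indep_vars_restrict[OF indep_vars_pair_family[OF A B AB]])
      (auto simp: disjoint_family_on_def)
  then have "indep_vars (\<lambda>_. borel) (\<lambda>i \<omega>. (\<lambda>x. x (True, i) - x (False, i)) (restrict (\<lambda>p. ?U p \<omega>) (?K i))) {..<n}"
    by (rule indep_vars_compose2) measurable
  then show ?thesis by simp
qed

lemma cadlag_diff: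
  assumes "cadlag x" "cadlag y"
  shows "cadlag (\<lambda>t. x t - y t)"
proof -
  have "((\<lambda>t. x t - y t) \<longlongrightarrow> x t - y t) (at_right t)" if "0 \<le> t" for t
    using assms that by (intro tendsto_diff) (simp_all add: cadlag_def)
  moreover have "\<exists>l. ((\<lambda>t. x t - y t) \<longlongrightarrow> l) (at_left t)" if "0 < t" for t
  proof -
    have "\<exists>l. (x \<longlongrightarrow> l) (at_left t)" "\<exists>m. (y \<longlongrightarrow> m) (at_left t)"
      using assms that by (simp_all add: cadlag_def)
    then obtain l m where "(x \<longlongrightarrow> l) (at_left t)" "(y \<longlongrightarrow> m) (at_left t)" by (elim exE)
    from tendsto_diff[OF this] show ?thesis by (rule exI)
  qed
  ultimately show ?thesis by (simp add: cadlag_def)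
qed

lemma cadlag_const: "cadlag (\<lambda>_. c)"
  unfolding cadlag_def by (auto intro: tendsto_const)

lemma cadlag_uminus: "cadlag x \<Longrightarrow> cadlag (\<lambda>t. - x t)"
  using cadlag_diff[of "\<lambda>_. 0" x] cadlag_const[of 0] by simp

lemma levy_process_diff:
  assumes X: "levy_process M X" and Y: "levy_process M Y" and XY: "indep_processes M X Y"
  shows "levy_process M (\<lambda>t \<omega>. X t \<omega> - Y t \<omega>)"
  unfolding levy_process_def
proof (intro conjI allI impI)
  show M: "prob_space M" by (rule levy_prob_space[OF X])
  interpret prob_space M by fact
  show "(\<lambda>\<omega>. X t \<omega> - Y t \<omega>) \<in> borel_measurable M" if "0 \<le> t" for t
    using that by (intro borel_measurable_diff levy_measurable[OF X] levy_measurable[OF Y])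
  show "AE \<omega> in M. X 0 \<omega> - Y 0 \<omega> = 0"
    using levy_AE_0[OF X] levy_AE_0[OF Y] by eventually_elim simp
  show "AE \<omega> in M. cadlag (\<lambda>t. X t \<omega> - Y t \<omega>)"
    using levy_AE_cadlag[OF X] levy_AE_cadlag[OF Y]
  proof eventually_elim
    case (elim \<omega>)
    then show ?case by (rule cadlag_diff)
  qed
  show "indep_vars (\<lambda>_. borel) (\<lambda>i \<omega>. X (t (Suc i)) \<omega> - Y (t (Suc i)) \<omega> - (X (t i) \<omega> - Y (t i) \<omega>)) {..<n}"
    if "0 \<le> t 0 \<and> mono t" for t :: "nat \<Rightarrow> real" and n
  proof -
    have t0: "0 \<le> t i" for i using that monoD[of t 0 i] by (auto intro: order_trans)
    \<comment> \<open>The increments are read off from the whole path, since independence of the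
      processes is stated for paths.\<close>
    let ?f = "\<lambda>p::real \<Rightarrow> real. \<lambda>i\<in>{..<n}. p (t (Suc i)) - p (t i)"
    have f: "?f \<in> measurable (PiM {0..} (\<lambda>_. borel)) (PiM {..<n} (\<lambda>_. borel))"
      using t0 by (intro measurable_restrict borel_measurable_diff measurable_component_singleton) auto
    have "?f (\<lambda>t\<in>{0..}. Z t) = (\<lambda>i\<in>{..<n}. Z (t (Suc i)) - Z (t i))" for Z :: "real \<Rightarrow> real"
      using t0 by auto
    with indep_processes_compose[OF M XY f f]
    have "indep_var (PiM {..<n} (\<lambda>_. borel)) (\<lambda>\<omega>. \<lambda>i\<in>{..<n}. X (t (Suc i)) \<omega> - X (t i) \<omega>)
      (PiM {..<n} (\<lambda>_. borel)) (\<lambda>\<omega>. \<lambda>i\<in>{..<n}. Y (t (Suc i)) \<omega> - Y (t i) \<omega>)"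
      by (simp only:)
    from indep_vars_diff_family[OF levy_indep[OF X] levy_indep[OF Y] this]
    show ?thesis using that by (simp add: algebra_simps)
  qed
  show "distr M borel (\<lambda>\<omega>. X (s + h) \<omega> - Y (s + h) \<omega> - (X s \<omega> - Y s \<omega>)) = distr M borel (\<lambda>\<omega>. X h \<omega> - Y h \<omega>)"
    if "0 \<le> s" "0 \<le> h" for s h
  proof -
    \<comment> \<open>For independent variables the law of the difference is determined by the two
      marginal laws, so stationarity is inherited.\<close>
    have diff: "distr M borel (\<lambda>\<omega>. f \<omega> - g \<omega>) =
        distr (distr M borel f \<Otimes>\<^sub>M distr M borel g) borel (\<lambda>(x, y). x - y)"
      if "indep_var borel f borel g" for f g :: "'a \<Rightarrow> real"
      using that unfolding indep_var_distribution_eq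
      by (auto simp: distr_distr comp_def)
    have "indep_var borel (\<lambda>\<omega>. X (s + h) \<omega> - X s \<omega>) borel (\<lambda>\<omega>. Y (s + h) \<omega> - Y s \<omega>)"
      "indep_var borel (X h) borel (Y h)"
      using indep_processes_compose[OF M XY, of "\<lambda>p. p (s + h) - p s" borel "\<lambda>p. p (s + h) - p s" borel]
        indep_processes_compose[OF M XY, of "\<lambda>p. p h" borel "\<lambda>p. p h" borel] that
      by (simp_all add: borel_measurable_diff measurable_component_singleton)
    note this[THEN diff]
    moreover have "(\<lambda>\<omega>. X (s + h) \<omega> - Y (s + h) \<omega> - (X s \<omega> - Y s \<omega>)) =
      (\<lambda>\<omega>. (X (s + h) \<omega> - X s \<omega>) - (Y (s + h) \<omega> - Y s \<omega>))" by (auto simp: algebra_simps)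
    ultimately show ?thesis
      using levy_distr[OF X that] levy_distr[OF Y that] by simp
  qed
qed

lemma levy_process_uminus:
  assumes X: "levy_process M X"
  shows "levy_process M (\<lambda>t \<omega>. - X t \<omega>)"
  unfolding levy_process_def
proof (intro conjI allI impI)
  show M: "prob_space M" by (rule levy_prob_space[OF X])
  interpret prob_space M by fact
  have rv: "X t \<in> borel_measurable M" if "0 \<le> t" for t
    using that by (rule levy_measurable[OF X])
  show "(\<lambda>\<omega>. - X t \<omega>) \<in> borel_measurable M" if "0 \<le> t" for t
    using rv[OF that] by simp
  show "AE \<omega> in M. - X 0 \<omega> = 0"
    using levy_AE_0[OF X] by eventually_elim simp
  show "AE \<omega> in M. cadlag (\<lambda>t. - X t \<omega>)"
    using levy_AE_cadlag[OF X]
  proof eventually_elim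
    case (elim \<omega>)
    then show ?case by (rule cadlag_uminus)
  qed
  show "indep_vars (\<lambda>_. borel) (\<lambda>i \<omega>. - X (t (Suc i)) \<omega> - - X (t i) \<omega>) {..<n}"
    if "0 \<le> t 0 \<and> mono t" for t :: "nat \<Rightarrow> real" and n
  proof -
    have "indep_vars (\<lambda>_. borel) (\<lambda>i \<omega>. - (X (t (Suc i)) \<omega> - X (t i) \<omega>)) {..<n}"
      using that by (intro indep_vars_compose2[OF levy_indep[OF X], where Y="\<lambda>_ x. - x"]) auto
    then show ?thesis by simp
  qed
  show "distr M borel (\<lambda>\<omega>. - X (s + h) \<omega> - - X s \<omega>) = distr M borel (\<lambda>\<omega>. - X h \<omega>)"
    if "0 \<le> s" "0 \<le> h" for s h
  proof -
    have uminus: "distr M borel (\<lambda>\<omega>. - f \<omega>) = distr (distr M borel f) borel uminus"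
      if "f \<in> borel_measurable M" for f :: "'a \<Rightarrow> real"
      using that by (simp add: distr_distr comp_def)
    have "distr M borel (\<lambda>\<omega>. - (X (s + h) \<omega> - X s \<omega>)) = distr M borel (\<lambda>\<omega>. - X h \<omega>)"
      using that rv[of s] rv[of h] rv[of "s + h"] levy_distr[OF X that] by (subst (1 2) uminus) auto
    then show ?thesis by simp
  qed
qed

section \<open>Passage through dyadic times\<close>

text \<open>For cadlag paths it suffices to look at the countably many dyadic times, which makes the first
  passage time almost surely equal to a random variable on \<open>M\<close> itself.\<close>

definition dyadic_passage ::
    "(real \<Rightarrow> 'a \<Rightarrow> real) \<Rightarrow> (real \<Rightarrow> 'a \<Rightarrow> real) \<Rightarrow> real \<Rightarrow> 'a \<Rightarrow> ereal" where
  "dyadic_passage X Y u \<omega> = (INF (r, s)\<in>{(r, s). r \<in> dyadics \<and> s \<in> dyadics \<and> r \<le> s}.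
     if X s \<omega> - X r \<omega> + Y r \<omega> > u then ereal s else \<infinity>)"

lemma dyadic_passage_less_iff:
  "dyadic_passage X Y u \<omega> < ereal c \<longleftrightarrow>
    (\<exists>r\<in>dyadics. \<exists>s\<in>dyadics. r \<le> s \<and> s < c \<and> X s \<omega> - X r \<omega> + Y r \<omega> > u)"
  unfolding dyadic_passage_def INF_less_iff by (auto split: if_splits)

lemma dyadic_passage_nonneg: "0 \<le> dyadic_passage X Y u \<omega>"
  unfolding dyadic_passage_def by (rule INF_greatest) (auto simp: dyadics_nonneg)

lemma dyadic_passage_leI:
  assumes "r \<in> dyadics" "s \<in> dyadics" "r \<le> s" "X s \<omega> - X r \<omega> + Y r \<omega> > u"
  shows "dyadic_passage X Y u \<omega> \<le> ereal s"
  unfolding dyadic_passage_def by (rule INF_lower2[of "(r, s)"]) (use assms in auto)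

lemma measurable_dyadic_passage:
  assumes "\<And>t. 0 \<le> t \<Longrightarrow> X t \<in> borel_measurable M" "\<And>t. 0 \<le> t \<Longrightarrow> Y t \<in> borel_measurable M"
  shows "dyadic_passage X Y u \<in> borel_measurable M"
proof -
  have "{(r::real, s). r \<in> dyadics \<and> s \<in> dyadics \<and> r \<le> s} \<subseteq> dyadics \<times> dyadics" by auto
  then have "countable {(r::real, s). r \<in> dyadics \<and> s \<in> dyadics \<and> r \<le> s}"
    by (rule countable_subset) (simp add: countable_dyadics)
  moreover have "(\<lambda>\<omega>. case p of (r, s) \<Rightarrow> if X s \<omega> - X r \<omega> + Y r \<omega> > u then ereal s else \<infinity>) \<in> borel_measurable M"
    if "p \<in> {(r, s). r \<in> dyadics \<and> s \<in> dyadics \<and> r \<le> s}" for p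
  proof -
    obtain r s where p: "p = (r, s)" by (rule prod.exhaust)
    then have [measurable]: "X s \<in> borel_measurable M" "X r \<in> borel_measurable M" "Y r \<in> borel_measurable M"
      using that by (auto intro!: assms dyadics_nonneg)
    show ?thesis unfolding p by simp
  qed
  ultimately have "(\<lambda>\<omega>. INF p\<in>{(r, s). r \<in> dyadics \<and> s \<in> dyadics \<and> r \<le> s}.
      case p of (r, s) \<Rightarrow> if X s \<omega> - X r \<omega> + Y r \<omega> > u then ereal s else \<infinity>) \<in> borel_measurable M"
    by (rule borel_measurable_INF)
  then show ?thesis unfolding dyadic_passage_def[abs_def] .
qed

lemma eventually_at_right_dyadic:
  fixes a b :: real
  assumes "eventually P (at_right a)" "0 \<le> a" "a < b"
  obtains r where "r \<in> dyadics" "a < r" "r < b" "P r"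
proof -
  obtain c where c: "a < c" "\<And>y. a < y \<Longrightarrow> y < c \<Longrightarrow> P y"
    using assms(1) unfolding eventually_at_right_field by blast
  obtain r where "r \<in> dyadics" "a < r" "r < min b c"
    by (rule dyadics_dense[of a "min b c"]) (use assms c in auto)
  then show thesis using that[of r] c by simp
qed

lemma cadlag_at_right_greater:
  assumes "cadlag x" "0 \<le> t" "c < x t"
  shows "eventually (\<lambda>s. c < x s) (at_right t)"
  using assms by (intro order_tendstoD(1)[of x "x t"]) (auto simp: cadlag_def)

text \<open>On cadlag paths the infimum runs over a bounded set, so the real-valued
  \<open>INF\<close> is a genuine infimum, and it lies below a number exactly if some value
  does.\<close>

lemma reflected_greater_iff:
  assumes "cadlag (\<lambda>t. X t \<omega>)" "cadlag (\<lambda>t. Y t \<omega>)" "0 \<le> t"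
  shows "reflected X Y t \<omega> > u \<longleftrightarrow> (\<exists>r\<in>{0..t}. X t \<omega> - X r \<omega> + Y r \<omega> > u)"
proof -
  have "bdd_below ((\<lambda>s. X s \<omega> - Y s \<omega>) ` {0..t})"
    using cadlag_bounded[OF cadlag_diff[OF assms(1,2)]] by (rule bounded_imp_bdd_below)
  from cINF_less_iff[OF _ this, of "X t \<omega> - u"] assms(3) show ?thesis
    unfolding reflected_def by (auto simp: algebra_simps)
qed

text \<open>Right-continuity lets both times move slightly to the right, to dyadic ones, without
  losing the strict inequality. The later time grows in doing so; the strict comparison with
  \<open>c\<close> leaves room for this.\<close>

lemma first_passage_less_iff:
  assumes X: "cadlag (\<lambda>t. X t \<omega>)" and Y: "cadlag (\<lambda>t. Y t \<omega>)"
  shows "first_passage (reflected X Y) u \<omega> < ereal c \<longleftrightarrow> dyadic_passage X Y u \<omega> < ereal c"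
proof -
  have "first_passage (reflected X Y) u \<omega> < ereal c \<longleftrightarrow> (\<exists>t\<ge>0. t < c \<and> reflected X Y t \<omega> > u)"
    unfolding first_passage_def Inf_less_iff by auto
  also have "\<dots> \<longleftrightarrow> (\<exists>t\<ge>0. t < c \<and> (\<exists>r\<in>{0..t}. X t \<omega> - X r \<omega> + Y r \<omega> > u))"
    by (intro ex_cong1 conj_cong refl) (rule reflected_greater_iff[of X \<omega> Y, OF X Y])
  also have "\<dots> \<longleftrightarrow> (\<exists>r\<in>dyadics. \<exists>s\<in>dyadics. r \<le> s \<and> s < c \<and> X s \<omega> - X r \<omega> + Y r \<omega> > u)"
  proof
    assume "\<exists>t\<ge>0. t < c \<and> (\<exists>r\<in>{0..t}. X t \<omega> - X r \<omega> + Y r \<omega> > u)"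
    then obtain t r where t: "t < c" and r: "0 \<le> r" "r \<le> t" and gt: "X t \<omega> - X r \<omega> + Y r \<omega> > u"
      by auto
    show "\<exists>r\<in>dyadics. \<exists>s\<in>dyadics. r \<le> s \<and> s < c \<and> X s \<omega> - X r \<omega> + Y r \<omega> > u"
    proof (cases "r = t")
      \<comment> \<open>For \<open>r = t\<close> the values of \<open>X\<close> cancel. Moving the
        two times separately could destroy their order, so one dyadic time replaces both.\<close>
      case True
      then have "u < Y t \<omega>" using gt by simp
      then obtain s where "s \<in> dyadics" "s < c" "u < Y s \<omega>"
        using eventually_at_right_dyadic[OF cadlag_at_right_greater[OF Y]] t r True by blast
      then show ?thesis by (intro bexI[of _ s]) auto
    next
      case False
      \<comment> \<open>Half of the excess over \<open>u\<close> pays for moving \<open>r\<close>,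
        the other half for moving \<open>t\<close>.\<close>
      define e where "e = (X t \<omega> - X r \<omega> + Y r \<omega> - u) / 2"
      have e: "0 < e" using gt by (simp add: e_def)
      have "eventually (\<lambda>s. Y r \<omega> - X r \<omega> - e < Y s \<omega> - X s \<omega>) (at_right r)"
        using e r by (intro cadlag_at_right_greater cadlag_diff X Y) auto
      then obtain r' where r': "r' \<in> dyadics" "r' < t" "Y r \<omega> - X r \<omega> - e < Y r' \<omega> - X r' \<omega>"
        by (rule eventually_at_right_dyadic[of _ r t]) (use r False in auto)
      have "eventually (\<lambda>s. X t \<omega> - e < X s \<omega>) (at_right t)"
        using e r by (intro cadlag_at_right_greater X) auto
      then obtain s' where s': "s' \<in> dyadics" "t < s'" "s' < c" "X t \<omega> - e < X s' \<omega>"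
        by (rule eventually_at_right_dyadic[of _ t c]) (use r t in auto)
      have "X s' \<omega> - X r' \<omega> + Y r' \<omega> > u"
        using r'(3) s'(4) unfolding e_def by argo
      with r' s' show ?thesis by (intro bexI[of _ r'] bexI[of _ s']) auto
    qed
  next
    assume "\<exists>r\<in>dyadics. \<exists>s\<in>dyadics. r \<le> s \<and> s < c \<and> X s \<omega> - X r \<omega> + Y r \<omega> > u"
    then obtain r s where "r \<in> dyadics" "s \<in> dyadics" "r \<le> s" "s < c" "X s \<omega> - X r \<omega> + Y r \<omega> > u"
      by blast
    then show "\<exists>t\<ge>0. t < c \<and> (\<exists>r\<in>{0..t}. X t \<omega> - X r \<omega> + Y r \<omega> > u)"
      using dyadics_nonneg[of r] by (intro exI[of _ s]) auto
  qed
  finally show ?thesis unfolding dyadic_passage_less_iff .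
qed

text \<open>Extended reals that compare alike with every real number are equal.\<close>

lemma first_passage_eq_dyadic_passage:
  assumes "cadlag (\<lambda>t. X t \<omega>)" "cadlag (\<lambda>t. Y t \<omega>)"
  shows "first_passage (reflected X Y) u \<omega> = dyadic_passage X Y u \<omega>"
proof (rule linorder_cases[of "first_passage (reflected X Y) u \<omega>" "dyadic_passage X Y u \<omega>"])
  assume "first_passage (reflected X Y) u \<omega> < dyadic_passage X Y u \<omega>"
  from ereal_dense2[OF this] show ?thesis
    using first_passage_less_iff[of X \<omega> Y, OF assms] by (metis less_asym)
next
  assume "dyadic_passage X Y u \<omega> < first_passage (reflected X Y) u \<omega>"
  from ereal_dense2[OF this] show ?thesis
    using first_passage_less_iff[of X \<omega> Y, OF assms] by (metis less_asym)
qed simp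

section \<open>Transfer of the limits to the completed space\<close>

lemma measurable_completion_AE_eq:
  assumes f: "f \<in> measurable M N" and AE: "AE \<omega> in M. g \<omega> = f \<omega>" and g: "g \<in> space M \<rightarrow> space N"
  shows "g \<in> measurable (completion M) N"
proof (rule measurableI)
  show "g \<omega> \<in> space N" if "\<omega> \<in> space (completion M)" for \<omega> using that g by auto
  fix A assume A: "A \<in> sets N"
  \<comment> \<open>Both sets lie in a null set, outside of which \<open>g\<close> and
    \<open>f\<close> agree, so they belong to the completion.\<close>
  have "{\<omega>\<in>space (completion M). g \<omega> \<noteq> f \<omega> \<and> g \<omega> \<in> A} \<in> sets (completion M)"
    "{\<omega>\<in>space (completion M). g \<omega> \<noteq> f \<omega>} \<in> sets (completion M)"
    by (intro predE sets_completion_AE eventually_mono[OF AE]; simp)+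
  moreover have "f -` A \<inter> space M \<in> sets (completion M)"
    using f A by (auto intro: measurable_sets)
  moreover have "g -` A \<inter> space (completion M) =
      ((f -` A \<inter> space M) - {\<omega>\<in>space (completion M). g \<omega> \<noteq> f \<omega>}) \<union> {\<omega>\<in>space (completion M). g \<omega> \<noteq> f \<omega> \<and> g \<omega> \<in> A}"
    by auto
  ultimately show "g -` A \<inter> space (completion M) \<in> sets (completion M)"
    by (simp only: sets.Un sets.Diff)
qed

lemma measure_completion_AE_eq:
  assumes f: "f \<in> borel_measurable M" and AE: "AE \<omega> in M. g \<omega> = f \<omega>" and P: "Measurable.pred borel P"
  shows "measure (completion M) {\<omega>\<in>space (completion M). P (g \<omega>)} = measure M {\<omega>\<in>space M. P (f \<omega> :: ereal)}"
proof -
  have "g \<in> borel_measurable (completion M)"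
    by (rule measurable_completion_AE_eq[OF f AE]) simp
  then have "{\<omega>\<in>space (completion M). P (g \<omega>)} \<in> sets (completion M)"
    using P by measurable
  moreover have fP: "{\<omega>\<in>space M. P (f \<omega>)} \<in> sets M"
    using f P by measurable
  moreover have "AE \<omega> in completion M. (\<omega> \<in> {\<omega>\<in>space (completion M). P (g \<omega>)}) = (\<omega> \<in> {\<omega>\<in>space M. P (f \<omega>)})"
    using AE_completion[OF AE] by eventually_elim simp
  ultimately have "measure (completion M) {\<omega>\<in>space (completion M). P (g \<omega>)} = measure (completion M) {\<omega>\<in>space M. P (f \<omega>)}"
    by (intro measure_eq_AE) auto
  with fP show ?thesis by simp
qed

lemma tendsto_in_prob_completion:
  assumes T: "tendsto_in_prob M T c F" and AE: "\<And>i. AE \<omega> in M. T' i \<omega> = T i \<omega>"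
  shows "tendsto_in_prob (completion M) T' c F"
proof -
  have T_meas: "T i \<in> borel_measurable M" for i using T by (simp add: tendsto_in_prob_def)
  have "T' i \<in> borel_measurable (completion M)" for i
    by (rule measurable_completion_AE_eq[OF T_meas AE]) simp
  moreover have "measure (completion M) {\<omega>\<in>space (completion M). \<bar>T' i \<omega> - c\<bar> > ereal e} =
      measure M {\<omega>\<in>space M. \<bar>T i \<omega> - c\<bar> > ereal e}" for i e
    by (rule measure_completion_AE_eq[OF T_meas AE, where P="\<lambda>x. \<bar>x - c\<bar> > ereal e"]) measurable
  ultimately show ?thesis using T by (simp add: tendsto_in_prob_def)
qed

lemma tendsto_in_distribution_completion:
  assumes T: "tendsto_in_distribution M T N F" and AE: "\<And>i. AE \<omega> in M. T' i \<omega> = T i \<omega>"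
  shows "tendsto_in_distribution (completion M) T' N F"
proof -
  have T_meas: "T i \<in> borel_measurable M" for i using T by (simp add: tendsto_in_distribution_def)
  have "T' i \<in> borel_measurable (completion M)" for i
    by (rule measurable_completion_AE_eq[OF T_meas AE]) simp
  moreover have "measure (completion M) {\<omega>\<in>space (completion M). T' i \<omega> \<le> ereal x} =
      measure M {\<omega>\<in>space M. T i \<omega> \<le> ereal x}" for i x
    by (rule measure_completion_AE_eq[OF T_meas AE, where P="\<lambda>y. y \<le> ereal x"]) measurable
  ultimately show ?thesis using T by (simp add: tendsto_in_distribution_def)
qed

section \<open>Central limit theorem\<close>

lemma real_distribution_normal_distribution:
  assumes "0 \<le> v"
  shows "real_distribution (normal_distribution m v)"
proof (cases "v = 0")
  case True
  then show ?thesis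
    by (auto simp: normal_distribution_def real_distribution_def real_distribution_axioms_def prob_space_return)
next
  case False
  then have "prob_space (density lborel (normal_density m (sqrt v)))"
    using assms by (intro prob_space_normal_density) simp
  with False show ?thesis
    by (simp add: normal_distribution_def real_distribution_def real_distribution_axioms_def)
qed

text \<open>Stated for distribution functions, so that variance 0, the point mass at 0, is
  included.\<close>

lemma cdf_normal_distribution_scale:
  assumes c: "0 < c" and v: "0 \<le> v"
  shows "cdf (normal_distribution 0 (c\<^sup>2 * v)) (c * x) = cdf (normal_distribution 0 v) x"
proof (cases "v = 0")
  case True
  have "indicator {..c * x} (0::real) = (indicator {..x} 0 :: real)"
    using c by (auto simp: indicator_def zero_le_mult_iff)
  with True show ?thesis
    by (simp add: normal_distribution_def cdf_def measure_return)
next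
  case False
  with v have v0: "0 < v" by simp
  let ?N = "density lborel (normal_density 0 (sqrt v))"
  interpret prob_space ?N using v0 by (intro prob_space_normal_density) simp
  have "distributed ?N lborel (\<lambda>x. x) (normal_density 0 (sqrt v))"
    by (auto simp: distributed_def distr_id2)
  from normal_density_affine[OF this, of c 0]
  have "distributed ?N lborel (\<lambda>x. c * x) (normal_density 0 (c * sqrt v))"
    using c v0 by simp
  then have "distr ?N lborel (\<lambda>x. c * x) = density lborel (normal_density 0 (c * sqrt v))"
    by (simp add: distributed_def)
  moreover have "sqrt (c\<^sup>2 * v) = c * sqrt v"
    using c by (simp add: real_sqrt_mult)
  ultimately have "cdf (normal_distribution 0 (c\<^sup>2 * v)) (c * x) = measure (distr ?N lborel (\<lambda>x. c * x)) {..c * x}"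
    using False c by (simp add: normal_distribution_def cdf_def)
  also have "\<dots> = measure ?N {..x}"
    using c by (subst measure_distr) (auto intro!: arg_cong[where f="measure ?N"])
  finally show ?thesis using False by (simp add: normal_distribution_def cdf_def)
qed

text \<open>For variance 0 the distribution function jumps at 0, so continuity points have to be
  carried along with the scaling.\<close>

lemma isCont_cdf_normal_distribution_scale:
  assumes c: "0 < c" and v: "0 \<le> v" and cont: "isCont (cdf (normal_distribution 0 (c\<^sup>2 * v))) (c * x)"
  shows "isCont (cdf (normal_distribution 0 v)) x"
proof -
  have "isCont (\<lambda>x. cdf (normal_distribution 0 (c\<^sup>2 * v)) (c * x)) x"
    by (rule isCont_o2[where f="\<lambda>x. c * x", OF _ cont]) (intro continuous_intros)
  then show ?thesis by (simp only: cdf_normal_distribution_scale[OF c v])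
qed

text \<open>The moving end point is eventually trapped between two continuity points of
  \<open>cdf N\<close> close to \<open>y\<close>. Such points are dense, since a monotone function
  has only countably many jumps. The open half-line \<open>{..<z u}\<close> lies between the two
  closed ones.\<close>

lemma weak_conv_moving_point:
  fixes \<mu> :: "nat \<Rightarrow> real measure"
  assumes \<mu>: "\<And>n. real_distribution (\<mu> n)" and N: "real_distribution N" and conv: "weak_conv_m \<mu> N"
    and k: "filterlim k sequentially F" and z: "(z \<longlongrightarrow> y) F" and cont: "isCont (cdf N) y"
  shows "((\<lambda>u. measure (\<mu> (k u)) {..<z u}) \<longlongrightarrow> cdf N y) F"
proof (rule order_tendstoI)
  interpret N: real_distribution N by fact
  have mono: "mono (cdf N)" by (auto simp: mono_def N.cdf_nondecreasing)
  have conv': "((\<lambda>u. cdf (\<mu> (k u)) w) \<longlongrightarrow> cdf N w) F" if "isCont (cdf N) w" for w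
  proof -
    have "(\<lambda>n. cdf (\<mu> n) w) \<longlonglongrightarrow> cdf N w"
      using conv that by (simp add: weak_conv_m_def weak_conv_def)
    then show ?thesis by (rule filterlim_compose[OF _ k])
  qed
  have avoid: "\<exists>w\<in>{a<..<b}. isCont (cdf N) w" if "a < b" for a b
    using real_interval_avoid_countable_set[OF that mono_ctble_discont[OF mono]] by auto
  {
    fix a assume "a < cdf N y"
    have "(cdf N \<longlongrightarrow> cdf N y) (at_left y)"
      using cont by (auto simp: isCont_def intro: tendsto_mono[OF at_le])
    from order_tendstoD(1)[OF this \<open>a < cdf N y\<close>] obtain b where b: "b < y" "\<And>w. b < w \<Longrightarrow> w < y \<Longrightarrow> a < cdf N w"
      unfolding eventually_at_left_field by blast
    from avoid[OF b(1)] obtain w where w: "b < w" "w < y" "isCont (cdf N) w" by auto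
    have "eventually (\<lambda>u. a < cdf (\<mu> (k u)) w) F"
      using order_tendstoD(1)[OF conv'[OF w(3)]] b w by blast
    moreover have "eventually (\<lambda>u. w < z u) F" using order_tendstoD(1)[OF z w(2)] .
    ultimately show "eventually (\<lambda>u. a < measure (\<mu> (k u)) {..<z u}) F"
    proof eventually_elim
      case (elim u)
      interpret \<mu>: real_distribution "\<mu> (k u)" by (rule \<mu>)
      have "cdf (\<mu> (k u)) w \<le> measure (\<mu> (k u)) {..<z u}"
        unfolding cdf_def using elim by (intro \<mu>.finite_measure_mono) auto
      with elim show ?case by simp
    qed
  next
    fix a assume "cdf N y < a"
    have "(cdf N \<longlongrightarrow> cdf N y) (at_right y)"
      using cont by (auto simp: isCont_def intro: tendsto_mono[OF at_le])
    from order_tendstoD(2)[OF this \<open>cdf N y < a\<close>] obtain b where b: "y < b" "\<And>w. y < w \<Longrightarrow> w < b \<Longrightarrow> cdf N w < a"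
      unfolding eventually_at_right_field by blast
    from avoid[OF b(1)] obtain w where w: "y < w" "w < b" "isCont (cdf N) w" by auto
    have "eventually (\<lambda>u. cdf (\<mu> (k u)) w < a) F"
      using order_tendstoD(2)[OF conv'[OF w(3)]] b w by blast
    moreover have "eventually (\<lambda>u. z u < w) F" using order_tendstoD(2)[OF z w(1)] .
    ultimately show "eventually (\<lambda>u. measure (\<mu> (k u)) {..<z u} < a) F"
    proof eventually_elim
      case (elim u)
      interpret \<mu>: real_distribution "\<mu> (k u)" by (rule \<mu>)
      have "measure (\<mu> (k u)) {..<z u} \<le> cdf (\<mu> (k u)) w"
        unfolding cdf_def using elim by (intro \<mu>.finite_measure_mono) auto
      with elim show ?case by simp
    qed
  }
qed

context prob_space
begin

lemma iid_vars_integral: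
  assumes iid: "iid_vars \<xi> UNIV" and [measurable]: "g \<in> borel_measurable borel"
  shows "integrable M (\<lambda>\<omega>. g (\<xi> i \<omega>) :: real) \<longleftrightarrow> integrable M (\<lambda>\<omega>. g (\<xi> 0 \<omega>))"
    and "expectation (\<lambda>\<omega>. g (\<xi> i \<omega>)) = expectation (\<lambda>\<omega>. g (\<xi> 0 \<omega>))"
proof -
  have [measurable]: "\<xi> i \<in> borel_measurable M" for i
    using iid_vars_measurable[OF iid] by simp
  have eq: "distr M borel (\<xi> i) = distr M borel (\<xi> 0)" by (rule iid_vars_distr_eq[OF iid]) auto
  have "integrable M (\<lambda>\<omega>. g (\<xi> i \<omega>)) \<longleftrightarrow> integrable (distr M borel (\<xi> i)) g" for i
    by (simp add: integrable_distr_eq)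
  then show "integrable M (\<lambda>\<omega>. g (\<xi> i \<omega>)) \<longleftrightarrow> integrable M (\<lambda>\<omega>. g (\<xi> 0 \<omega>))" using eq by metis
  have "expectation (\<lambda>\<omega>. g (\<xi> i \<omega>)) = integral\<^sup>L (distr M borel (\<xi> i)) g" for i
    by (simp add: integral_distr)
  then show "expectation (\<lambda>\<omega>. g (\<xi> i \<omega>)) = expectation (\<lambda>\<omega>. g (\<xi> 0 \<omega>))" using eq by metis
qed

text \<open>Normalising by \<open>sqrt n\<close> alone keeps variance 0 meaningful: then almost
  surely all steps vanish and the limit is the point mass. Otherwise the classical theorem,
  normalised by \<open>sqrt (n * v)\<close>, is rescaled.\<close>

lemma iid_vars_clt:
  assumes iid: "iid_vars \<xi> UNIV" and sq: "integrable M (\<lambda>\<omega>. (\<xi> 0 \<omega>)\<^sup>2)"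
    and mean: "expectation (\<xi> 0) = 0"
  shows "weak_conv_m (\<lambda>n. distr M borel (\<lambda>\<omega>. (\<Sum>i<n. \<xi> i \<omega>) / sqrt (real n)))
    (normal_distribution 0 (expectation (\<lambda>\<omega>. (\<xi> 0 \<omega>)\<^sup>2)))"
proof -
  define v where "v = expectation (\<lambda>\<omega>. (\<xi> 0 \<omega>)\<^sup>2)"
  have v: "0 \<le> v" unfolding v_def by simp
  have [measurable]: "\<xi> i \<in> borel_measurable M" for i
    using iid_vars_measurable[OF iid] by simp
  have sq_i: "integrable M (\<lambda>\<omega>. (\<xi> i \<omega>)\<^sup>2)" "expectation (\<lambda>\<omega>. (\<xi> i \<omega>)\<^sup>2) = v" for i
    using iid_vars_integral[OF iid, of "\<lambda>x. x\<^sup>2" i] sq by (auto simp: v_def)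
  have mean_i: "expectation (\<xi> i) = 0" for i
    using iid_vars_integral(2)[OF iid, of "\<lambda>x. x" i] mean by simp
  have cdf_eq: "cdf (distr M borel f) x = prob {\<omega>\<in>space M. f \<omega> \<le> x}"
    if [measurable]: "f \<in> borel_measurable M" for f :: "'a \<Rightarrow> real" and x
    unfolding cdf_def by (subst measure_distr) (auto intro!: arg_cong[where f=prob])
  show ?thesis
  proof (cases "v = 0")
    case True
    have "AE \<omega> in M. \<xi> i \<omega> = 0" for i
    proof -
      have "AE \<omega> in M. (\<xi> i \<omega>)\<^sup>2 = 0"
        using sq_i[of i] True by (subst integral_nonneg_eq_0_iff_AE[symmetric]) auto
      then show ?thesis by simp
    qed
    then have AE: "AE \<omega> in M. \<forall>i. \<xi> i \<omega> = 0" by (subst AE_all_countable) simp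
    have "cdf (distr M borel (\<lambda>\<omega>. (\<Sum>i<n. \<xi> i \<omega>) / sqrt (real n))) x = cdf (return borel 0) x" for n x
    proof -
      have "cdf (distr M borel (\<lambda>\<omega>. (\<Sum>i<n. \<xi> i \<omega>) / sqrt (real n))) x = prob {\<omega>\<in>space M. 0 \<le> x}"
      proof (subst cdf_eq)
        show "prob {\<omega>\<in>space M. (\<Sum>i<n. \<xi> i \<omega>) / sqrt (real n) \<le> x} = prob {\<omega>\<in>space M. 0 \<le> x}"
        proof (rule measure_eq_AE)
          show "AE \<omega> in M. (\<omega> \<in> {\<omega>\<in>space M. (\<Sum>i<n. \<xi> i \<omega>) / sqrt (real n) \<le> x}) =
              (\<omega> \<in> {\<omega>\<in>space M. 0 \<le> x})"
            using AE by eventually_elim simp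
        qed measurable
      qed measurable
      also have "\<dots> = cdf (return borel 0) x"
        by (auto simp: cdf_def measure_return indicator_def prob_space)
      finally show ?thesis .
    qed
    then show ?thesis
      using True by (simp add: weak_conv_m_def weak_conv_def normal_distribution_def v_def[symmetric])
  next
    case False
    with v have v0: "0 < v" by simp
    let ?S = "\<lambda>n \<omega>. \<Sum>i<n. \<xi> i \<omega>"
    have var: "variance (\<xi> i) = (sqrt v)\<^sup>2" for i
      using sq_i[of i] v by (simp add: mean_i)
    have "weak_conv_m (\<lambda>n. distr M borel (\<lambda>\<omega>. ?S n \<omega> / sqrt (real n * (sqrt v)\<^sup>2))) std_normal_distribution"
    proof (rule central_limit_theorem_zero_mean[where \<mu>="distr M borel (\<xi> 0)"])
      show "indep_vars (\<lambda>_. borel) \<xi> UNIV" using iid by (simp add: iid_vars_def)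
      show "distr M borel (\<xi> n) = distr M borel (\<xi> 0)" for n
        by (rule iid_vars_distr_eq[OF iid]) auto
    qed (use v0 sq_i(1) mean_i var in simp_all)
    then have clt: "(\<lambda>n. cdf (distr M borel (\<lambda>\<omega>. ?S n \<omega> / sqrt (real n * v))) x) \<longlonglongrightarrow> cdf (normal_distribution 0 1) x"
      if "isCont (cdf (normal_distribution 0 1)) x" for x
      using that v unfolding weak_conv_m_def weak_conv_def by (simp add: normal_distribution_def)
    have scale: "cdf (distr M borel (\<lambda>\<omega>. ?S n \<omega> / sqrt (real n))) x =
        cdf (distr M borel (\<lambda>\<omega>. ?S n \<omega> / sqrt (real n * v))) (x / sqrt v)" for n x
    proof -
      have "?S n \<omega> / sqrt (real n * v) \<le> x / sqrt v \<longleftrightarrow> ?S n \<omega> / sqrt (real n) \<le> x" for \<omega>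
      proof -
        have "?S n \<omega> / sqrt (real n * v) = (?S n \<omega> / sqrt (real n)) / sqrt v"
          by (simp add: real_sqrt_mult)
        then show ?thesis using v0 by (simp only: divide_le_cancel) simp
      qed
      then show ?thesis by (subst (1 2) cdf_eq) auto
    qed
    have normal: "cdf (normal_distribution 0 v) x = cdf (normal_distribution 0 1) (x / sqrt v)" for x
      using cdf_normal_distribution_scale[of "sqrt v" 1 "x / sqrt v"] v0 by simp
    have "(\<lambda>n. cdf (distr M borel (\<lambda>\<omega>. ?S n \<omega> / sqrt (real n))) x) \<longlonglongrightarrow> cdf (normal_distribution 0 v) x"
      if "isCont (cdf (normal_distribution 0 v)) x" for x
    proof -
      have "isCont (cdf (normal_distribution 0 1)) (x / sqrt v)"
        by (rule isCont_cdf_normal_distribution_scale[of "sqrt v"]) (use that v0 in simp_all)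
      from clt[OF this] show ?thesis by (simp only: scale normal)
    qed
    then show ?thesis unfolding weak_conv_m_def weak_conv_def v_def[symmetric] by blast
  qed
qed

end

section \<open>Passage times above a random walk\<close>

lemma filterlim_sequentially_of_real:
  assumes "filterlim f at_top F" "eventually (\<lambda>u. f u \<le> real (k u)) F"
  shows "filterlim k sequentially F"
  unfolding filterlim_at_top
proof
  fix Z :: nat
  have "eventually (\<lambda>u. real Z \<le> f u) F" using assms(1) by (simp add: filterlim_at_top)
  with assms(2) show "eventually (\<lambda>u. Z \<le> k u) F" by eventually_elim linarith
qed

text \<open>The two properties of the reflected process that matter: it lies above a random walk \<open>S\<close> at integer
  times, and its running supremum exceeds \<open>S\<close> only by a tight amount.\<close>

locale walk_passage = prob_space M for M :: "'a measure" +
  fixes \<xi> :: "nat \<Rightarrow> 'a \<Rightarrow> real" and T :: "real \<Rightarrow> 'a \<Rightarrow> ereal" and h :: "real \<Rightarrow> real"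
  assumes iid: "iid_vars \<xi> UNIV"
    and T_measurable [measurable]: "\<And>u. T u \<in> borel_measurable M"
    and T_nonneg: "\<And>u \<omega>. 0 \<le> T u \<omega>"
    and hit: "\<And>u n. AE \<omega> in M. (\<Sum>i<n. \<xi> i \<omega>) > u \<longrightarrow> T u \<omega> \<le> ereal (real n)"
    and no_hit: "\<And>u n a. prob {\<omega>\<in>space M. T u \<omega> < ereal (real n) \<and> (\<Sum>i<n. \<xi> i \<omega>) \<le> u - a} \<le> h a"
    and h: "(h \<longlongrightarrow> 0) at_top"
begin

abbreviation S :: "nat \<Rightarrow> 'a \<Rightarrow> real" where "S n \<omega> \<equiv> \<Sum>i<n. \<xi> i \<omega>"

lemma \<xi>_measurable [measurable]: "\<xi> i \<in> borel_measurable M"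
  using iid_vars_measurable[OF iid] by simp

lemma iid_uminus: "iid_vars (\<lambda>i \<omega>. - \<xi> i \<omega>) UNIV"
  by (rule iid_vars_compose[OF iid]) simp

lemma prob_T_greater_le: "prob {\<omega>\<in>space M. T u \<omega> > ereal (real n)} \<le> prob {\<omega>\<in>space M. S n \<omega> \<le> u}"
  using hit[of u n] by (intro finite_measure_mono_AE) (auto elim!: eventually_mono)

lemma prob_T_le_ge: "prob {\<omega>\<in>space M. S n \<omega> > u} \<le> prob {\<omega>\<in>space M. T u \<omega> \<le> ereal (real n)}"
  using hit[of u n] by (intro finite_measure_mono_AE) (auto elim!: eventually_mono)

text \<open>Passage before time \<open>n\<close> leaves two possibilities: the walk is itself near
  the level at time \<open>n\<close>, or the tight excess is at least \<open>a\<close>.\<close>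

lemma prob_T_less_le:
  "prob {\<omega>\<in>space M. T u \<omega> < ereal (real n)} \<le> h a + prob {\<omega>\<in>space M. S n \<omega> > u - a}"
proof -
  have "prob {\<omega>\<in>space M. T u \<omega> < ereal (real n)} \<le>
      prob ({\<omega>\<in>space M. T u \<omega> < ereal (real n) \<and> S n \<omega> \<le> u - a} \<union> {\<omega>\<in>space M. S n \<omega> > u - a})"
    by (intro finite_measure_mono) auto
  also have "\<dots> \<le> prob {\<omega>\<in>space M. T u \<omega> < ereal (real n) \<and> S n \<omega> \<le> u - a} + prob {\<omega>\<in>space M. S n \<omega> > u - a}"
    by (intro measure_Un_le) auto
  finally show ?thesis using no_hit[of u n a] by linarith
qed

text \<open>A speed \<open>- c\<close> above \<open>1 / q\<close> carries the walk past
  \<open>u\<close> before time \<open>q * u\<close>. With negated steps this becomes an instance of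
  the upper law, valid for infinite mean as well.\<close>

lemma late_passage:
  assumes q: "0 < q" and less: "ext_expectation M (\<lambda>\<omega>. - \<xi> 0 \<omega>) < ereal (- 1 / q)"
  shows "((\<lambda>u. prob {\<omega>\<in>space M. T u \<omega> > ereal (q * u)}) \<longlongrightarrow> 0) at_top"
proof -
  obtain c where c: "ext_expectation M (\<lambda>\<omega>. - \<xi> 0 \<omega>) < ereal c" "c < - 1 / q"
    using ereal_dense2[OF less] by auto
  have qc: "q * c < - 1" using c(2) q by (simp add: field_simps)
  have c0: "c < 0"
  proof (rule ccontr)
    assume "\<not> c < 0"
    then have "0 \<le> q * c" using q by simp
    with qc show False by simp
  qed
  \<comment> \<open>Rounding down keeps the integer time at or before \<open>q * u\<close>; the
    slack in \<open>q * c < - 1\<close> absorbs the lost unit.\<close>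
  let ?n = "\<lambda>u. nat \<lfloor>q * u\<rfloor>"
  have "filterlim (\<lambda>u. q * u - 1) at_top at_top" using q by real_asymp
  then have n: "filterlim ?n sequentially at_top"
    by (rule filterlim_sequentially_of_real) (intro always_eventually allI, linarith)
  have "(\<lambda>n. prob {\<omega>\<in>space M. (\<Sum>i<n. - \<xi> i \<omega>) \<ge> real n * c}) \<longlonglongrightarrow> 0"
    by (rule weak_law_upper[OF iid_uminus c(1)])
  from filterlim_compose[OF this n]
  show ?thesis
  proof (rule tendsto_sandwich[OF _ _ tendsto_const, rotated 2])
    have "eventually (\<lambda>u. (q * u - 1) * c \<le> - u) at_top" using q qc by real_asymp
    then show "eventually (\<lambda>u. prob {\<omega>\<in>space M. T u \<omega> > ereal (q * u)}
        \<le> prob {\<omega>\<in>space M. (\<Sum>i<?n u. - \<xi> i \<omega>) \<ge> real (?n u) * c}) at_top"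
      using eventually_ge_at_top[of 0]
    proof eventually_elim
      case (elim u)
      define k where "k = ?n u"
      have n: "real k \<le> q * u" "q * u - 1 \<le> real k"
        using elim(2) q mult_nonneg_nonneg[of q u] unfolding k_def by linarith+
      have "prob {\<omega>\<in>space M. T u \<omega> > ereal (q * u)} \<le> prob {\<omega>\<in>space M. T u \<omega> > ereal (real k)}"
        using n(1) by (intro finite_measure_mono) (auto intro: le_less_trans[rotated])
      also have "\<dots> \<le> prob {\<omega>\<in>space M. S k \<omega> \<le> u}" by (rule prob_T_greater_le)
      also have "\<dots> \<le> prob {\<omega>\<in>space M. (\<Sum>i<k. - \<xi> i \<omega>) \<ge> real k * c}"
      proof -
        have "real k * c \<le> (q * u - 1) * c"
          using n(2) c0 by (intro mult_right_mono_neg) auto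
        then have "real k * c \<le> - u" using elim(1) by linarith
        then show ?thesis by (intro finite_measure_mono) (auto simp: sum_negf)
      qed
      finally show ?case unfolding k_def .
    qed
  qed simp_all
qed

text \<open>Passage before \<open>q * u\<close> would require the walk to be near \<open>u\<close>
  at about that time, which a speed below \<open>1 / q\<close> makes unlikely.\<close>

lemma early_passage:
  assumes q: "0 < q" and less: "ext_expectation M (\<xi> 0) < ereal (1 / q)"
  shows "((\<lambda>u. prob {\<omega>\<in>space M. T u \<omega> < ereal (q * u)}) \<longlongrightarrow> 0) at_top"
proof -
  \<comment> \<open>The maximum with 0 yields a positive \<open>c\<close>, by which inequalities
    between times can be multiplied.\<close>
  have "max 0 (ext_expectation M (\<xi> 0)) < ereal (1 / q)" using less q by simp
  from ereal_dense2[OF this] obtain c where c: "ext_expectation M (\<xi> 0) < ereal c" "0 < c" "c < 1 / q"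
    by auto
  have qc: "q * c < 1" using c(3) q by (simp add: field_simps)
  let ?n = "\<lambda>u. nat \<lceil>q * u\<rceil>"
  have "filterlim (\<lambda>u. q * u) at_top at_top" using q by real_asymp
  then have n: "filterlim ?n sequentially at_top"
    by (rule filterlim_sequentially_of_real) (intro always_eventually allI, linarith)
  have "(\<lambda>n. prob {\<omega>\<in>space M. S n \<omega> \<ge> real n * c}) \<longlonglongrightarrow> 0"
    by (rule weak_law_upper[OF iid c(1)])
  from filterlim_compose[OF this n]
  have "((\<lambda>u. prob {\<omega>\<in>space M. S (?n u) \<omega> \<ge> real (?n u) * c}) \<longlongrightarrow> 0) at_top" .
  \<comment> \<open>The allowance \<open>sqrt u\<close> tends to infinity, so that a larger excess
    has vanishing probability, but it is negligible against \<open>u\<close>.\<close>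
  moreover have "((\<lambda>u. h (sqrt u)) \<longlongrightarrow> 0) at_top"
    by (rule filterlim_compose[OF h sqrt_at_top])
  ultimately have "((\<lambda>u. h (sqrt u) + prob {\<omega>\<in>space M. S (?n u) \<omega> \<ge> real (?n u) * c}) \<longlongrightarrow> 0 + 0) at_top"
    by (intro tendsto_add)
  then show ?thesis
    unfolding add_0
  proof (rule tendsto_sandwich[OF _ _ tendsto_const, rotated 2])
    have "eventually (\<lambda>u. (q * u + 1) * c \<le> u - sqrt u) at_top" using q qc c(2) by real_asymp
    then show "eventually (\<lambda>u. prob {\<omega>\<in>space M. T u \<omega> < ereal (q * u)}
        \<le> h (sqrt u) + prob {\<omega>\<in>space M. S (?n u) \<omega> \<ge> real (?n u) * c}) at_top"
      using eventually_ge_at_top[of 0]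
    proof eventually_elim
      case (elim u)
      define k where "k = ?n u"
      have n: "q * u \<le> real k" unfolding k_def by linarith
      have n': "real k \<le> q * u + 1"
        using elim(2) q mult_nonneg_nonneg[of q u] unfolding k_def by linarith
      have "prob {\<omega>\<in>space M. T u \<omega> < ereal (q * u)} \<le> prob {\<omega>\<in>space M. T u \<omega> < ereal (real k)}"
        using n by (intro finite_measure_mono) (auto intro: less_le_trans)
      also have "\<dots> \<le> h (sqrt u) + prob {\<omega>\<in>space M. S k \<omega> > u - sqrt u}" by (rule prob_T_less_le)
      also have "prob {\<omega>\<in>space M. S k \<omega> > u - sqrt u} \<le> prob {\<omega>\<in>space M. S k \<omega> \<ge> real k * c}"
      proof -
        have "real k * c \<le> (q * u + 1) * c"
          using n' c(2) by (intro mult_right_mono) auto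
        then have "real k * c \<le> u - sqrt u" using elim(1) by linarith
        then show ?thesis by (intro finite_measure_mono) auto
      qed
      finally show ?case unfolding k_def by simp
    qed
  qed simp_all
qed

text \<open>\<open>\<kappa>\<close> may be 0, the case of infinite mean. Deviations below matter
  only for \<open>e < \<kappa>\<close>, because passage times are nonnegative.\<close>

lemma passage_law_aux:
  assumes late: "\<And>e. 0 < e \<Longrightarrow> ((\<lambda>u. prob {\<omega>\<in>space M. T u \<omega> > ereal ((\<kappa> + e) * u)}) \<longlongrightarrow> 0) at_top"
    and early: "\<And>e. 0 < e \<Longrightarrow> e < \<kappa> \<Longrightarrow> ((\<lambda>u. prob {\<omega>\<in>space M. T u \<omega> < ereal ((\<kappa> - e) * u)}) \<longlongrightarrow> 0) at_top"
  shows "tendsto_in_prob M (\<lambda>u \<omega>. T u \<omega> / ereal u) (ereal \<kappa>) at_top"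
  unfolding tendsto_in_prob_def
proof (intro conjI allI impI)
  show "(\<lambda>\<omega>. T u \<omega> / ereal u) \<in> borel_measurable M" for u by measurable
  fix e :: real assume e: "0 < e"
  let ?g = "\<lambda>u. prob {\<omega>\<in>space M. T u \<omega> > ereal ((\<kappa> + e) * u)} +
    (if e < \<kappa> then prob {\<omega>\<in>space M. T u \<omega> < ereal ((\<kappa> - e) * u)} else 0)"
  have "((\<lambda>u. if e < \<kappa> then prob {\<omega>\<in>space M. T u \<omega> < ereal ((\<kappa> - e) * u)} else 0) \<longlongrightarrow> 0) at_top"
    using early[OF e] by (cases "e < \<kappa>") simp_all
  then have "(?g \<longlongrightarrow> 0 + 0) at_top"
    by (intro tendsto_add late e)
  then show "((\<lambda>u. prob {\<omega>\<in>space M. \<bar>T u \<omega> / ereal u - ereal \<kappa>\<bar> > ereal e}) \<longlongrightarrow> 0) at_top"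
    unfolding add_0
  proof (rule tendsto_sandwich[OF _ _ tendsto_const, rotated 2])
    show "eventually (\<lambda>u. prob {\<omega>\<in>space M. \<bar>T u \<omega> / ereal u - ereal \<kappa>\<bar> > ereal e} \<le> ?g u) at_top"
      using eventually_gt_at_top[of 0]
    proof eventually_elim
      case (elim u)
      let ?A = "{\<omega>\<in>space M. T u \<omega> > ereal ((\<kappa> + e) * u)}"
      let ?B = "if e < \<kappa> then {\<omega>\<in>space M. T u \<omega> < ereal ((\<kappa> - e) * u)} else {}"
      have "{\<omega>\<in>space M. \<bar>T u \<omega> / ereal u - ereal \<kappa>\<bar> > ereal e} \<subseteq> ?A \<union> ?B"
      proof
        fix \<omega> assume \<omega>: "\<omega> \<in> {\<omega>\<in>space M. \<bar>T u \<omega> / ereal u - ereal \<kappa>\<bar> > ereal e}"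
        show "\<omega> \<in> ?A \<union> ?B"
        proof (cases "T u \<omega>")
          case (real t)
          then have t0: "0 \<le> t" using T_nonneg[of u \<omega>] by simp
          from \<omega> real elim have "\<bar>t / u - \<kappa>\<bar> > e" by simp
          then consider "t / u > \<kappa> + e" | "t / u < \<kappa> - e" by linarith
          then show ?thesis
          proof cases
            case 1
            then show ?thesis using \<omega> real elim by (simp add: pos_less_divide_eq)
          next
            case 2
            have "0 \<le> t / u" using t0 elim by simp
            with 2 have "e < \<kappa>" by linarith
            then show ?thesis using 2 \<omega> real elim by (simp add: pos_divide_less_eq)
          qed
        qed (use \<omega> T_nonneg[of u \<omega>] in auto)
      qed
      then have "prob {\<omega>\<in>space M. \<bar>T u \<omega> / ereal u - ereal \<kappa>\<bar> > ereal e} \<le> prob (?A \<union> ?B)"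
        by (rule finite_measure_mono) auto
      also have "\<dots> \<le> prob ?A + prob ?B"
        by (rule measure_Un_le) auto
      finally show ?case by (simp split: if_splits)
    qed
  qed simp_all
qed

text \<open>For infinite mean the limit is \<open>1 / \<infinity> = 0\<close>, and only late passage
  has to be excluded. The assumption \<open>uminus\<close> rules out the ill-defined \<infinity> -
  \<infinity>.\<close>

theorem passage_law_of_large_numbers:
  assumes pos: "0 < ext_expectation M (\<xi> 0)"
    and uminus: "ext_expectation M (\<lambda>\<omega>. - \<xi> 0 \<omega>) = - ext_expectation M (\<xi> 0)"
  shows "tendsto_in_prob M (\<lambda>u \<omega>. T u \<omega> / ereal u) (1 / ext_expectation M (\<xi> 0)) at_top"
proof (cases "ext_expectation M (\<xi> 0)")
  case (real m)
  with pos have m: "0 < m" by simp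
  have "tendsto_in_prob M (\<lambda>u \<omega>. T u \<omega> / ereal u) (ereal (1 / m)) at_top"
  proof (rule passage_law_aux)
    fix e :: real assume e: "0 < e"
    have "1 / (1 / m + e) < m" using m e by (simp add: field_simps add_pos_pos)
    then show "((\<lambda>u. prob {\<omega>\<in>space M. T u \<omega> > ereal ((1 / m + e) * u)}) \<longlongrightarrow> 0) at_top"
      using m e by (intro late_passage) (auto simp: uminus real add_pos_pos)
    assume e': "e < 1 / m"
    then have "m < 1 / (1 / m - e)" using m e by (simp add: field_simps)
    then show "((\<lambda>u. prob {\<omega>\<in>space M. T u \<omega> < ereal ((1 / m - e) * u)}) \<longlongrightarrow> 0) at_top"
      using e' by (intro early_passage) (auto simp: real)
  qed
  with real m show ?thesis by (simp add: one_ereal_def)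
next
  case PInf
  have "tendsto_in_prob M (\<lambda>u \<omega>. T u \<omega> / ereal u) (ereal 0) at_top"
    by (rule passage_law_aux) (auto intro!: late_passage simp: uminus PInf)
  with PInf show ?thesis by (simp add: zero_ereal_def)
qed (use pos in auto)

end

text \<open>With \<open>k\<close> close to \<open>u / m + x * sqrt u\<close>, the numerator is about
  \<open>x * m * sqrt u\<close> and the denominator about \<open>sqrt (u / m)\<close>. Here
  \<open>d\<close> is the rounding error of \<open>k\<close>, and \<open>a\<close> a shift of the
  level of smaller order than \<open>sqrt u\<close>.\<close>

lemma clt_point_tendsto:
  fixes k :: "real \<Rightarrow> nat" and a d :: "real \<Rightarrow> real"
  assumes m: "0 < m"
    and k: "eventually (\<lambda>u. real (k u) = u / m + x * sqrt u + d u) at_top"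
    and d: "\<And>u. \<bar>d u\<bar> \<le> 1" and a: "((\<lambda>u. a u / sqrt u) \<longlongrightarrow> 0) at_top"
  shows "((\<lambda>u. (real (k u) * m - u + a u) / sqrt (real (k u))) \<longlongrightarrow> x * (m * sqrt m)) at_top"
proof -
  have d0: "((\<lambda>u. d u / sqrt u) \<longlongrightarrow> 0) at_top"
  proof (rule Lim_null_comparison)
    show "((\<lambda>u::real. 1 / sqrt u) \<longlongrightarrow> 0) at_top" by real_asymp
    show "eventually (\<lambda>u. norm (d u / sqrt u) \<le> 1 / sqrt u) at_top"
      using eventually_gt_at_top[of 0] by eventually_elim (use d in \<open>auto intro: divide_right_mono\<close>)
  qed
  have "((\<lambda>u. 1 / m + x * (1 / sqrt u) + d u / sqrt u * (1 / sqrt u)) \<longlongrightarrow> 1 / m + x * 0 + 0 * 0) at_top"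
    by (intro tendsto_intros d0) real_asymp+
  then have L: "((\<lambda>u. sqrt (1 / m + x * (1 / sqrt u) + d u / sqrt u * (1 / sqrt u))) \<longlongrightarrow> sqrt (1 / m)) at_top"
    by (intro tendsto_real_sqrt) simp
  have "((\<lambda>u. (x * m + m * (d u / sqrt u) + a u / sqrt u) /
      sqrt (1 / m + x * (1 / sqrt u) + d u / sqrt u * (1 / sqrt u))) \<longlongrightarrow> (x * m + m * 0 + 0) / sqrt (1 / m)) at_top"
    by (intro tendsto_divide tendsto_add tendsto_mult tendsto_const d0 a L) (use m in simp)
  moreover have "(x * m + m * 0 + 0) / sqrt (1 / m) = x * (m * sqrt m)"
    using m by (simp add: real_sqrt_divide)
  moreover have "eventually (\<lambda>u. (x * m + m * (d u / sqrt u) + a u / sqrt u) /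
      sqrt (1 / m + x * (1 / sqrt u) + d u / sqrt u * (1 / sqrt u)) =
      (real (k u) * m - u + a u) / sqrt (real (k u))) at_top"
    using k eventually_gt_at_top[of 0]
  proof eventually_elim
    case (elim u)
    define s where "s = sqrt u"
    have s: "0 < s" "u = s * s" using elim(2) by (auto simp: s_def)
    have K: "real (k u) = s * s / m + x * s + d u"
      using elim(1) s by (simp add: s_def[symmetric])
    have "s\<^sup>2 * (1 / m + x * (1 / s) + d u / s * (1 / s)) = s * s / m + x * s + d u"
      using s(1) m by (simp add: field_simps power2_eq_square)
    then have "real (k u) = s\<^sup>2 * (1 / m + x * (1 / s) + d u / s * (1 / s))"
      using K by simp
    then have "sqrt (real (k u)) = s * sqrt (1 / m + x * (1 / s) + d u / s * (1 / s))"
      using s by (simp add: real_sqrt_mult)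
    moreover have "real (k u) * m - s * s + a u = s * (x * m + m * (d u / s) + a u / s)"
      unfolding K using s(1) m by (simp add: field_simps)
    then have "real (k u) * m - u + a u = s * (x * m + m * (d u / s) + a u / s)"
      by (simp only: s(2)[symmetric])
    ultimately show ?case using s by (simp add: s_def[symmetric])
  qed
  ultimately show ?thesis by (auto intro: Lim_transform_eventually)
qed

context walk_passage
begin

text \<open>The event that passage occurs by \<open>t = u / m + x * sqrt u\<close> is caught between
  \<open>S k > u\<close> and \<open>S (Suc k) > u - a\<close>, where \<open>k\<close> is the integer
  part of \<open>t\<close>, up to an error \<open>h a\<close>. Both have limit
  \<open>cdf G (x * (m * sqrt m))\<close>, and rescaling turns this factor into the variance
  \<open>v / m ^ 3\<close>.\<close>

theorem passage_central_limit_theorem: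
  assumes sq: "integrable M (\<lambda>\<omega>. (\<xi> 0 \<omega>)\<^sup>2)" and mean: "0 < expectation (\<xi> 0)"
  shows "tendsto_in_distribution M
    (\<lambda>u \<omega>. (T u \<omega> - ereal (u / expectation (\<xi> 0))) / ereal (sqrt u))
    (normal_distribution 0 (variance (\<xi> 0) / expectation (\<xi> 0) ^ 3)) at_top"
proof -
  define m where "m = expectation (\<xi> 0)"
  define v where "v = variance (\<xi> 0)"
  define G where "G = normal_distribution 0 v"
  have m: "0 < m" using mean by (simp add: m_def)
  have v: "0 \<le> v" by (simp add: v_def)
  have int: "integrable M (\<xi> 0)" using sq by (rule square_integrable_imp_integrable[rotated]) simp
  \<comment> \<open>Centring as \<open>m - \<xi> i \<omega>\<close> turns
    \<open>S n \<omega> > y\<close> into a lower tail, the form treated by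
    \<open>weak_conv_moving_point\<close>.\<close>
  let ?R = "\<lambda>n \<omega>. (\<Sum>i<n. m - \<xi> i \<omega>) / sqrt (real n)"
  let ?\<mu> = "\<lambda>n. distr M borel (?R n)"
  have conv: "weak_conv_m ?\<mu> G"
  proof -
    have "iid_vars (\<lambda>i \<omega>. m - \<xi> i \<omega>) UNIV" by (rule iid_vars_compose[OF iid]) simp
    moreover have "integrable M (\<lambda>\<omega>. (m - \<xi> 0 \<omega>)\<^sup>2)"
      using sq int by (simp add: power2_diff)
    moreover have "expectation (\<lambda>\<omega>. m - \<xi> 0 \<omega>) = 0"
      using int by (simp add: m_def prob_space)
    moreover have "expectation (\<lambda>\<omega>. (m - \<xi> 0 \<omega>)\<^sup>2) = v"
      unfolding v_def m_def by (simp add: power2_commute)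
    ultimately show ?thesis unfolding G_def using iid_vars_clt[of "\<lambda>i \<omega>. m - \<xi> i \<omega>"] by simp
  qed
  have prob_S: "prob {\<omega>\<in>space M. S n \<omega> > y} = measure (?\<mu> n) {..<(real n * m - y) / sqrt (real n)}"
    if n: "0 < n" for n y
  proof -
    have "S n \<omega> > y \<longleftrightarrow> ?R n \<omega> < (real n * m - y) / sqrt (real n)" for \<omega>
      using n by (simp add: sum_subtractf divide_less_cancel)
    then show ?thesis
      by (subst measure_distr) (auto intro!: arg_cong[where f=prob])
  qed
  have limit: "((\<lambda>u. measure (?\<mu> (k u)) {..<(real (k u) * m - u + a u) / sqrt (real (k u))})
      \<longlongrightarrow> cdf G (x * (m * sqrt m))) at_top"
    if "eventually (\<lambda>u. real (k u) = u / m + x * sqrt u + d u) at_top" "\<And>u. \<bar>d u\<bar> \<le> 1"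
      "((\<lambda>u. a u / sqrt u) \<longlongrightarrow> 0) at_top" "isCont (cdf G) (x * (m * sqrt m))" for k x d a
  proof (rule weak_conv_moving_point[OF _ _ conv])
    show "real_distribution (?\<mu> n)" for n by (rule real_distribution_distr) measurable
    show "real_distribution G" unfolding G_def by (rule real_distribution_normal_distribution[OF v])
    have "filterlim (\<lambda>u. u / m + x * sqrt u - 1) at_top at_top" using m by real_asymp
    moreover have "eventually (\<lambda>u. u / m + x * sqrt u - 1 \<le> real (k u)) at_top"
      using that(1)
    proof eventually_elim
      case (elim u)
      with that(2)[of u] show ?case by linarith
    qed
    ultimately show "filterlim k sequentially at_top" by (rule filterlim_sequentially_of_real)
    show "((\<lambda>u. (real (k u) * m - u + a u) / sqrt (real (k u))) \<longlongrightarrow> x * (m * sqrt m)) at_top"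
      by (rule clt_point_tendsto[OF m that(1-3)])
  qed (rule that(4))
  have cube: "(1 / (m * sqrt m))\<^sup>2 * v = v / m ^ 3"
    using m by (simp add: power_divide power_mult_distrib power3_eq_cube power2_eq_square)
  show ?thesis
    unfolding tendsto_in_distribution_def v_def[symmetric]
    unfolding m_def[symmetric]
  proof (intro conjI allI impI)
    show "(\<lambda>\<omega>. (T u \<omega> - ereal (u / m)) / ereal (sqrt u)) \<in> borel_measurable M" for u by measurable
    fix x assume cont: "isCont (cdf (normal_distribution 0 (v / m ^ 3))) x"
    define y where "y = x * (m * sqrt m)"
    have y: "1 / (m * sqrt m) * y = x" using m by (simp add: y_def)
    have pos: "0 < 1 / (m * sqrt m)" using m by simp
    have contG: "isCont (cdf G) y"
      unfolding G_def
      by (rule isCont_cdf_normal_distribution_scale[OF pos v]) (unfold cube y, rule cont)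
    have cdfG: "cdf (normal_distribution 0 (v / m ^ 3)) x = cdf G y"
      using cdf_normal_distribution_scale[OF pos v, of y] unfolding cube y G_def .
    let ?t = "\<lambda>u. u / m + x * sqrt u"
    let ?k = "\<lambda>u. nat \<lfloor>?t u\<rfloor>"
    \<comment> \<open>From \<open>?t u \<ge> 1\<close> on, \<open>nat\<close> does not truncate and
      the divisor \<open>sqrt k\<close> is not 0.\<close>
    have t_pos: "eventually (\<lambda>u. 1 \<le> ?t u) at_top" using m by real_asymp
    have lower: "((\<lambda>u. measure (?\<mu> (?k u)) {..<(real (?k u) * m - u + 0) / sqrt (real (?k u))}) \<longlongrightarrow> cdf G y) at_top"
      unfolding y_def
    proof (rule limit)
      show "eventually (\<lambda>u. real (?k u) = ?t u + (of_int \<lfloor>?t u\<rfloor> - ?t u)) at_top"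
        using t_pos by eventually_elim simp
      show "\<bar>of_int \<lfloor>?t u\<rfloor> - ?t u\<bar> \<le> 1" for u by linarith
    qed (use contG in \<open>simp_all add: y_def\<close>)
    \<comment> \<open>The shift \<open>u powr (1/4)\<close> must tend to infinity for the sake of
      \<open>h\<close> and be of smaller order than \<open>sqrt u\<close>; any exponent between 0
      and 1/2 does both. \<open>Suc\<close> is there because \<open>no_hit\<close> asks for passage
      strictly before an integer time.\<close>
    have upper: "((\<lambda>u. h (u powr (1/4)) + measure (?\<mu> (Suc (?k u)))
        {..<(real (Suc (?k u)) * m - u + u powr (1/4)) / sqrt (real (Suc (?k u)))}) \<longlongrightarrow> 0 + cdf G y) at_top"
    proof (rule tendsto_add)
      have "filterlim (\<lambda>u::real. u powr (1/4)) at_top at_top" by real_asymp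
      then show "((\<lambda>u. h (u powr (1/4))) \<longlongrightarrow> 0) at_top" by (rule filterlim_compose[OF h])
      show "((\<lambda>u. measure (?\<mu> (Suc (?k u))) {..<(real (Suc (?k u)) * m - u + u powr (1/4)) / sqrt (real (Suc (?k u)))})
          \<longlongrightarrow> cdf G y) at_top"
        unfolding y_def
      proof (rule limit)
        show "eventually (\<lambda>u. real (Suc (?k u)) = ?t u + (of_int \<lfloor>?t u\<rfloor> + 1 - ?t u)) at_top"
          using t_pos by eventually_elim simp
        show "\<bar>of_int \<lfloor>?t u\<rfloor> + 1 - ?t u\<bar> \<le> 1" for u by linarith
        show "((\<lambda>u::real. u powr (1/4) / sqrt u) \<longlongrightarrow> 0) at_top" by real_asymp
      qed (use contG in \<open>simp add: y_def\<close>)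
    qed
    have event: "prob {\<omega>\<in>space M. (T u \<omega> - ereal (u / m)) / ereal (sqrt u) \<le> ereal x} =
        prob {\<omega>\<in>space M. T u \<omega> \<le> ereal (?t u)}" if u: "0 < u" for u
    proof -
      have "(T u \<omega> - ereal (u / m)) / ereal (sqrt u) \<le> ereal x \<longleftrightarrow> T u \<omega> \<le> ereal (?t u)" for \<omega>
        using u T_nonneg[of u \<omega>] by (cases "T u \<omega>") (auto simp: pos_divide_le_eq)
      then show ?thesis by simp
    qed
    show "((\<lambda>u. prob {\<omega>\<in>space M. (T u \<omega> - ereal (u / m)) / ereal (sqrt u) \<le> ereal x})
        \<longlongrightarrow> cdf (normal_distribution 0 (v / m ^ 3)) x) at_top"
      unfolding cdfG
    proof (rule tendsto_sandwich[OF _ _ lower upper[unfolded add_0]])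
      show "eventually (\<lambda>u. measure (?\<mu> (?k u)) {..<(real (?k u) * m - u + 0) / sqrt (real (?k u))} \<le>
          prob {\<omega>\<in>space M. (T u \<omega> - ereal (u / m)) / ereal (sqrt u) \<le> ereal x}) at_top"
        using t_pos eventually_gt_at_top[of 0]
      proof eventually_elim
        case (elim u)
        define k where "k = ?k u"
        have k: "0 < k" "real k \<le> ?t u" using elim(1) unfolding k_def by linarith+
        have "measure (?\<mu> k) {..<(real k * m - u + 0) / sqrt (real k)} = prob {\<omega>\<in>space M. S k \<omega> > u}"
          using prob_S[OF k(1), of u] by simp
        also have "\<dots> \<le> prob {\<omega>\<in>space M. T u \<omega> \<le> ereal (real k)}" by (rule prob_T_le_ge)
        also have "\<dots> \<le> prob {\<omega>\<in>space M. T u \<omega> \<le> ereal (?t u)}"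
          using k(2) by (intro finite_measure_mono) (auto intro: order_trans)
        finally show ?case unfolding event[OF elim(2)] k_def .
      qed
      show "eventually (\<lambda>u. prob {\<omega>\<in>space M. (T u \<omega> - ereal (u / m)) / ereal (sqrt u) \<le> ereal x} \<le>
          h (u powr (1/4)) + measure (?\<mu> (Suc (?k u)))
            {..<(real (Suc (?k u)) * m - u + u powr (1/4)) / sqrt (real (Suc (?k u)))}) at_top"
        using t_pos eventually_gt_at_top[of 0]
      proof eventually_elim
        case (elim u)
        define k where "k = Suc (?k u)"
        have k: "0 < k" "?t u < real k" unfolding k_def by (simp, linarith)
        have "prob {\<omega>\<in>space M. T u \<omega> \<le> ereal (?t u)} \<le> prob {\<omega>\<in>space M. T u \<omega> < ereal (real k)}"
          using k(2) by (intro finite_measure_mono) (auto intro: le_less_trans)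
        also have "\<dots> \<le> h (u powr (1/4)) + prob {\<omega>\<in>space M. S k \<omega> > u - u powr (1/4)}"
          by (rule prob_T_less_le)
        also have "prob {\<omega>\<in>space M. S k \<omega> > u - u powr (1/4)} =
            measure (?\<mu> k) {..<(real k * m - u + u powr (1/4)) / sqrt (real k)}"
          using prob_S[OF k(1), of "u - u powr (1/4)"] by (simp add: algebra_simps)
        finally show ?case unfolding event[OF elim(2)] k_def .
      qed
    qed
  qed
qed

end

section \<open>Reflection from a Levy barrier\<close>

text \<open>Negation swaps the two parts; finiteness of one excludes \<infinity> - \<infinity>,
  whose conventional value \<infinity> would not change its sign.\<close>

lemma ext_expectation_uminus:
  assumes "(\<integral>\<^sup>+\<omega>. ennreal (- f \<omega>) \<partial>M) < \<infinity>"
  shows "ext_expectation M (\<lambda>\<omega>. - f \<omega>) = - ext_expectation M f"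
  using assms unfolding ext_expectation_def
  by (cases "\<integral>\<^sup>+\<omega>. ennreal (f \<omega>) \<partial>M"; cases "\<integral>\<^sup>+\<omega>. ennreal (- f \<omega>) \<partial>M") auto

text \<open>The positive part of a difference is at most the positive part of \<open>f\<close> plus
  the negative part of \<open>g\<close>.\<close>

lemma nn_integral_pos_part_diff:
  fixes f g :: "'a \<Rightarrow> real"
  assumes [measurable]: "f \<in> borel_measurable M" "g \<in> borel_measurable M"
    and "(\<integral>\<^sup>+\<omega>. ennreal (f \<omega>) \<partial>M) < \<infinity>" "(\<integral>\<^sup>+\<omega>. ennreal (- g \<omega>) \<partial>M) < \<infinity>"
  shows "(\<integral>\<^sup>+\<omega>. ennreal (f \<omega> - g \<omega>) \<partial>M) < \<infinity>"
proof -
  have "ennreal (f \<omega> - g \<omega>) \<le> ennreal (f \<omega>) + ennreal (- g \<omega>)" for \<omega>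
  proof -
    have "ennreal (f \<omega> - g \<omega>) \<le> ennreal (max 0 (f \<omega>) + max 0 (- g \<omega>))"
      by (intro ennreal_leI) linarith
    also have "\<dots> = ennreal (max 0 (f \<omega>)) + ennreal (max 0 (- g \<omega>))" by (intro ennreal_plus) auto
    finally show ?thesis by (simp add: max_def ennreal_neg split: if_splits)
  qed
  then have "(\<integral>\<^sup>+\<omega>. ennreal (f \<omega> - g \<omega>) \<partial>M) \<le> (\<integral>\<^sup>+\<omega>. ennreal (f \<omega>) + ennreal (- g \<omega>) \<partial>M)"
    by (intro nn_integral_mono)
  also have "\<dots> = (\<integral>\<^sup>+\<omega>. ennreal (f \<omega>) \<partial>M) + (\<integral>\<^sup>+\<omega>. ennreal (- g \<omega>) \<partial>M)"
    by (intro nn_integral_add) auto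
  also have "\<dots> < \<infinity>" using assms(3,4) by simp
  finally show ?thesis .
qed

text \<open>If the negative part were infinite, existence would make the positive part finite and
  the expectation -\<infinity>.\<close>

lemma ext_expectation_pos_imp_neg_part:
  assumes "expectation_exists M f" "0 < ext_expectation M f"
  shows "(\<integral>\<^sup>+\<omega>. ennreal (- f \<omega>) \<partial>M) < \<infinity>"
  using assms unfolding expectation_exists_def ext_expectation_def
  by (cases "\<integral>\<^sup>+\<omega>. ennreal (f \<omega>) \<partial>M"; cases "\<integral>\<^sup>+\<omega>. ennreal (- f \<omega>) \<partial>M") auto

text \<open>An infinite positive part gives \<infinity>, whatever is subtracted.\<close>

lemma ext_expectation_less_top_imp_pos_part:
  assumes "ext_expectation M f < \<infinity>"
  shows "(\<integral>\<^sup>+\<omega>. ennreal (f \<omega>) \<partial>M) < \<infinity>"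
  using assms unfolding ext_expectation_def
  by (cases "\<integral>\<^sup>+\<omega>. ennreal (f \<omega>) \<partial>M") auto

text \<open>Common frame of the two drift cases, with \<open>X\<close> or \<open>Y\<close> as
  \<open>W\<close>. The event \<open>E n a\<close> has to contain all outcomes whose dyadic supremum
  up to time \<open>n\<close> exceeds \<open>W (real n)\<close> by more than
  \<open>a\<close>.\<close>

lemma walk_passage_dyadic_passage:
  assumes X: "levy_process M X" and Y: "levy_process M Y" and W: "levy_process M W"
    and h: "(h \<longlongrightarrow> 0) at_top"
    and hit: "\<And>\<omega> u n. X 0 \<omega> = 0 \<Longrightarrow> Y 0 \<omega> = 0 \<Longrightarrow> W (real n) \<omega> > u \<Longrightarrow>
      dyadic_passage X Y u \<omega> \<le> ereal (real n)"
    and E: "\<And>n a. E n a \<in> sets M" "\<And>n a. measure M (E n a) \<le> h a"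
    and no_hit: "\<And>\<omega> n a r s. \<omega> \<in> space M \<Longrightarrow> r \<in> dyadics \<Longrightarrow> s \<in> dyadics \<Longrightarrow> r \<le> s \<Longrightarrow> s \<le> real n \<Longrightarrow>
      X s \<omega> - X r \<omega> + Y r \<omega> - W (real n) \<omega> > a \<Longrightarrow> \<omega> \<in> E n a"
  shows "walk_passage M (\<lambda>i \<omega>. W (real (Suc i)) \<omega> - W (real i) \<omega>) (dyadic_passage X Y) h"
proof -
  interpret prob_space M by (rule levy_prob_space[OF X])
  have sum: "(\<Sum>i<n. W (real (Suc i)) \<omega> - W (real i) \<omega>) = W (real n) \<omega> - W 0 \<omega>" for n \<omega>
    using sum_lessThan_telescope[of "\<lambda>i. W (real i) \<omega>" n] by simp
  have AE0: "AE \<omega> in M. X 0 \<omega> = 0 \<and> Y 0 \<omega> = 0 \<and> W 0 \<omega> = 0"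
    using levy_AE_0[OF X] levy_AE_0[OF Y] levy_AE_0[OF W] by eventually_elim simp
  show ?thesis
  proof
    show "iid_vars (\<lambda>i \<omega>. W (real (Suc i)) \<omega> - W (real i) \<omega>) UNIV"
      using levy_increments_iid[OF W, of 1] by simp
    show "dyadic_passage X Y u \<in> borel_measurable M" for u
      by (intro measurable_dyadic_passage levy_measurable[OF X] levy_measurable[OF Y])
    show "0 \<le> dyadic_passage X Y u \<omega>" for u \<omega> by (rule dyadic_passage_nonneg)
    show "(h \<longlongrightarrow> 0) at_top" by (rule h)
    show "AE \<omega> in M. (\<Sum>i<n. W (real (Suc i)) \<omega> - W (real i) \<omega>) > u \<longrightarrow> dyadic_passage X Y u \<omega> \<le> ereal (real n)"
      for u n
      using AE0 unfolding sum by eventually_elim (auto intro: hit)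
    fix u a :: real and n :: nat
    have "prob {\<omega>\<in>space M. dyadic_passage X Y u \<omega> < ereal (real n) \<and>
        (\<Sum>i<n. W (real (Suc i)) \<omega> - W (real i) \<omega>) \<le> u - a} \<le> prob (E n a)"
    proof (rule finite_measure_mono_AE)
      show "AE \<omega> in M. \<omega> \<in> {\<omega>\<in>space M. dyadic_passage X Y u \<omega> < ereal (real n) \<and>
          (\<Sum>i<n. W (real (Suc i)) \<omega> - W (real i) \<omega>) \<le> u - a} \<longrightarrow> \<omega> \<in> E n a"
        using AE0
      proof eventually_elim
        case (elim \<omega>)
        show ?case
        proof
          assume "\<omega> \<in> {\<omega>\<in>space M. dyadic_passage X Y u \<omega> < ereal (real n) \<and>
            (\<Sum>i<n. W (real (Suc i)) \<omega> - W (real i) \<omega>) \<le> u - a}"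
          then have \<omega>: "\<omega> \<in> space M" "W (real n) \<omega> - W 0 \<omega> \<le> u - a"
            and less: "dyadic_passage X Y u \<omega> < ereal (real n)"
            unfolding sum by auto
          from less obtain r s where "r \<in> dyadics" "s \<in> dyadics" "r \<le> s" "s < real n" "X s \<omega> - X r \<omega> + Y r \<omega> > u"
            unfolding dyadic_passage_less_iff by blast
          with \<omega> elim show "\<omega> \<in> E n a" by (intro no_hit[of \<omega> r s]) auto
        qed
      qed
    qed (rule E(1))
    also have "\<dots> \<le> h a" by (rule E(2))
    finally show "prob {\<omega>\<in>space M. dyadic_passage X Y u \<omega> < ereal (real n) \<and>
        (\<Sum>i<n. W (real (Suc i)) \<omega> - W (real i) \<omega>) \<le> u - a} \<le> h a" .
  qed
qed

lemma tendsto_half_at_top: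
  fixes h :: "real \<Rightarrow> real"
  assumes "(h \<longlongrightarrow> 0) at_top"
  shows "((\<lambda>a. h (a / 2)) \<longlongrightarrow> 0) at_top"
  by (rule filterlim_compose[OF assms]) real_asymp

text \<open>The level is reached along \<open>X\<close> by taking \<open>r = 0\<close>. The excess
  is shared in halves between a backward supremum of \<open>- X\<close> and a forward supremum of
  \<open>- (X - Y)\<close>.\<close>

lemma walk_passage_positive_drift:
  assumes X: "levy_process M X" and Y: "levy_process M Y" and XY: "indep_processes M X Y"
    and mX: "ext_expectation M (\<lambda>\<omega>. - X 1 \<omega>) < 0"
    and mZ: "ext_expectation M (\<lambda>\<omega>. - (X 1 \<omega> - Y 1 \<omega>)) < 0"
  shows "\<exists>h. walk_passage M (\<lambda>i \<omega>. X (real (Suc i)) \<omega> - X (real i) \<omega>) (dyadic_passage X Y) h"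
proof -
  note A = levy_process_uminus[OF X]
  note B = levy_process_uminus[OF levy_process_diff[OF X Y XY]]
  from levy_exceeds_bound[OF A mX] obtain h1 where h1: "(h1 \<longlongrightarrow> 0) at_top"
    "\<forall>a N. measure M {\<omega>\<in>space M. \<exists>r\<in>dyadics. r \<le> real N \<and> - X r \<omega> > a} \<le> h1 a"
    "\<forall>a N. measure M {\<omega>\<in>space M. \<exists>r\<in>dyadics. r \<le> real N \<and> - X (real N) \<omega> - - X r \<omega> > a} \<le> h1 a"
    by (elim exE conjE)
  from levy_exceeds_bound[OF B mZ] obtain h2 where h2: "(h2 \<longlongrightarrow> 0) at_top"
    "\<forall>a N. measure M {\<omega>\<in>space M. \<exists>r\<in>dyadics. r \<le> real N \<and> - (X r \<omega> - Y r \<omega>) > a} \<le> h2 a"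
    "\<forall>a N. measure M {\<omega>\<in>space M. \<exists>r\<in>dyadics. r \<le> real N \<and>
      - (X (real N) \<omega> - Y (real N) \<omega>) - - (X r \<omega> - Y r \<omega>) > a} \<le> h2 a"
    by (elim exE conjE)
  let ?E1 = "\<lambda>n a. {\<omega>\<in>space M. \<exists>r\<in>dyadics. r \<le> real n \<and> - X (real n) \<omega> - - X r \<omega> > a}"
  let ?E2 = "\<lambda>n a. {\<omega>\<in>space M. \<exists>r\<in>dyadics. r \<le> real n \<and> - (X r \<omega> - Y r \<omega>) > a}"
  have E1: "?E1 n a \<in> sets M" for n :: nat and a
    by (intro sets_dyadics_exceed borel_measurable_diff levy_measurable[OF A] dyadics_nonneg) simp
  have E2: "?E2 n a \<in> sets M" for n :: nat and a
    by (intro sets_dyadics_exceed levy_measurable[OF B] dyadics_nonneg)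
  have "walk_passage M (\<lambda>i \<omega>. X (real (Suc i)) \<omega> - X (real i) \<omega>) (dyadic_passage X Y) (\<lambda>a. h1 (a / 2) + h2 (a / 2))"
  proof (rule walk_passage_dyadic_passage[OF X Y X])
    show "((\<lambda>a. h1 (a / 2) + h2 (a / 2)) \<longlongrightarrow> 0) at_top"
      using tendsto_add[OF tendsto_half_at_top[OF h1(1)] tendsto_half_at_top[OF h2(1)]] by simp
    show "dyadic_passage X Y u \<omega> \<le> ereal (real n)" if "X 0 \<omega> = 0" "Y 0 \<omega> = 0" "X (real n) \<omega> > u" for \<omega> u n
      using that real_in_dyadics[of 0] by (intro dyadic_passage_leI[of 0]) auto
    show "?E1 n (a / 2) \<union> ?E2 n (a / 2) \<in> sets M" for n :: nat and a
      by (intro sets.Un E1 E2)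
    show "measure M (?E1 n (a / 2) \<union> ?E2 n (a / 2)) \<le> h1 (a / 2) + h2 (a / 2)" for n :: nat and a
      by (rule order_trans[OF measure_Un_le[OF E1 E2] add_mono[OF h1(3)[rule_format] h2(2)[rule_format]]])
    fix \<omega> n a r s
    assume *: "\<omega> \<in> space M" "r \<in> dyadics" "s \<in> dyadics" "r \<le> s" "s \<le> real n"
      and gt: "X s \<omega> - X r \<omega> + Y r \<omega> - X (real n) \<omega> > a"
    have "- X (real n) \<omega> - - X s \<omega> > a / 2 \<or> - (X r \<omega> - Y r \<omega>) > a / 2"
      using gt by linarith
    then show "\<omega> \<in> ?E1 n (a / 2) \<union> ?E2 n (a / 2)"
      using * order_trans[of r s "real n"] by blast
  qed
  then show ?thesis by (rule exI[of _ "\<lambda>a. h1 (a / 2) + h2 (a / 2)"])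
qed

text \<open>The level is reached along \<open>Y\<close> by taking \<open>r = s = n\<close>. Both
  halves of the excess are now backward suprema, one of \<open>- X\<close> and one of
  \<open>X - Y\<close>.\<close>

lemma walk_passage_negative_drift:
  assumes X: "levy_process M X" and Y: "levy_process M Y" and XY: "indep_processes M X Y"
    and mX: "ext_expectation M (\<lambda>\<omega>. - X 1 \<omega>) < 0"
    and mZ: "ext_expectation M (\<lambda>\<omega>. X 1 \<omega> - Y 1 \<omega>) < 0"
  shows "\<exists>h. walk_passage M (\<lambda>i \<omega>. Y (real (Suc i)) \<omega> - Y (real i) \<omega>) (dyadic_passage X Y) h"
proof -
  note A = levy_process_uminus[OF X]
  note B = levy_process_diff[OF X Y XY]
  from levy_exceeds_bound[OF A mX] obtain h1 where h1: "(h1 \<longlongrightarrow> 0) at_top"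
    "\<forall>a N. measure M {\<omega>\<in>space M. \<exists>r\<in>dyadics. r \<le> real N \<and> - X r \<omega> > a} \<le> h1 a"
    "\<forall>a N. measure M {\<omega>\<in>space M. \<exists>r\<in>dyadics. r \<le> real N \<and> - X (real N) \<omega> - - X r \<omega> > a} \<le> h1 a"
    by (elim exE conjE)
  from levy_exceeds_bound[OF B mZ] obtain h2 where h2: "(h2 \<longlongrightarrow> 0) at_top"
    "\<forall>a N. measure M {\<omega>\<in>space M. \<exists>r\<in>dyadics. r \<le> real N \<and> X r \<omega> - Y r \<omega> > a} \<le> h2 a"
    "\<forall>a N. measure M {\<omega>\<in>space M. \<exists>r\<in>dyadics. r \<le> real N \<and>
      X (real N) \<omega> - Y (real N) \<omega> - (X r \<omega> - Y r \<omega>) > a} \<le> h2 a"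
    by (elim exE conjE)
  let ?E1 = "\<lambda>n a. {\<omega>\<in>space M. \<exists>r\<in>dyadics. r \<le> real n \<and> - X (real n) \<omega> - - X r \<omega> > a}"
  let ?E2 = "\<lambda>n a. {\<omega>\<in>space M. \<exists>r\<in>dyadics. r \<le> real n \<and> X (real n) \<omega> - Y (real n) \<omega> - (X r \<omega> - Y r \<omega>) > a}"
  have E1: "?E1 n a \<in> sets M" for n :: nat and a
    by (intro sets_dyadics_exceed borel_measurable_diff levy_measurable[OF A] dyadics_nonneg) simp
  have E2: "?E2 n a \<in> sets M" for n :: nat and a
    by (intro sets_dyadics_exceed borel_measurable_diff levy_measurable[OF X] levy_measurable[OF Y] dyadics_nonneg) simp_all
  have "walk_passage M (\<lambda>i \<omega>. Y (real (Suc i)) \<omega> - Y (real i) \<omega>) (dyadic_passage X Y) (\<lambda>a. h1 (a / 2) + h2 (a / 2))"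
  proof (rule walk_passage_dyadic_passage[OF X Y Y])
    show "((\<lambda>a. h1 (a / 2) + h2 (a / 2)) \<longlongrightarrow> 0) at_top"
      using tendsto_add[OF tendsto_half_at_top[OF h1(1)] tendsto_half_at_top[OF h2(1)]] by simp
    show "dyadic_passage X Y u \<omega> \<le> ereal (real n)" if "Y (real n) \<omega> > u" for \<omega> u n
      using that real_in_dyadics[of n] by (intro dyadic_passage_leI[of "real n"]) auto
    show "?E1 n (a / 2) \<union> ?E2 n (a / 2) \<in> sets M" for n :: nat and a
      by (intro sets.Un E1 E2)
    show "measure M (?E1 n (a / 2) \<union> ?E2 n (a / 2)) \<le> h1 (a / 2) + h2 (a / 2)" for n :: nat and a
      by (rule order_trans[OF measure_Un_le[OF E1 E2] add_mono[OF h1(3)[rule_format] h2(3)[rule_format]]])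
    fix \<omega> n a r s
    assume *: "\<omega> \<in> space M" "r \<in> dyadics" "s \<in> dyadics" "r \<le> s" "s \<le> real n"
      and gt: "X s \<omega> - X r \<omega> + Y r \<omega> - Y (real n) \<omega> > a"
    have "- X (real n) \<omega> - - X s \<omega> > a / 2 \<or> X (real n) \<omega> - Y (real n) \<omega> - (X r \<omega> - Y r \<omega>) > a / 2"
      using gt by linarith
    then show "\<omega> \<in> ?E1 n (a / 2) \<union> ?E2 n (a / 2)"
      using * order_trans[of r s "real n"] by blast
  qed
  then show ?thesis by (rule exI[of _ "\<lambda>a. h1 (a / 2) + h2 (a / 2)"])
qed

text \<open>\<open>W\<close> is the process that governs the passage. The limits are proved for the
  dyadic passage time, a random variable on \<open>M\<close>, and carry over to the almost surely
  equal \<open>\<tau>\<close> on the completion.\<close>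

lemma first_passage_limits:
  assumes X: "levy_process M X" and Y: "levy_process M Y" and W: "levy_process M W"
    and walk: "\<exists>h. walk_passage M (\<lambda>i \<omega>. W (real (Suc i)) \<omega> - W (real i) \<omega>) (dyadic_passage X Y) h"
    and pos: "0 < ext_expectation M (W 1)" and neg_part: "(\<integral>\<^sup>+\<omega>. ennreal (- W 1 \<omega>) \<partial>M) < \<infinity>"
  defines "\<tau> \<equiv> first_passage (reflected X Y)"
  shows "tendsto_in_prob (completion M) (\<lambda>u \<omega>. \<tau> u \<omega> / ereal u) (1 / ext_expectation M (W 1)) at_top \<and>
    (integrable M (\<lambda>\<omega>. (W 1 \<omega>)\<^sup>2) \<longrightarrow>
      tendsto_in_distribution (completion M)
        (\<lambda>u \<omega>. (\<tau> u \<omega> - ereal (u / prob_space.expectation M (W 1))) / ereal (sqrt u))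
        (normal_distribution 0 (prob_space.variance M (W 1) / prob_space.expectation M (W 1) ^ 3)) at_top)"
proof -
  let ?\<xi> = "\<lambda>i \<omega>. W (real (Suc i)) \<omega> - W (real i) \<omega>"
  obtain h where h: "walk_passage M ?\<xi> (dyadic_passage X Y) h" using walk ..
  interpret walk_passage M ?\<xi> "dyadic_passage X Y" h by (rule h)
  have [measurable]: "W 1 \<in> borel_measurable M" "W 0 \<in> borel_measurable M"
    by (auto intro: levy_measurable[OF W])
  have \<xi>: "AE \<omega> in M. ?\<xi> 0 \<omega> = W 1 \<omega>" using levy_AE_increment[OF W, of 1] by simp
  have ext: "ext_expectation M (?\<xi> 0) = ext_expectation M (W 1)"
    "ext_expectation M (\<lambda>\<omega>. - ?\<xi> 0 \<omega>) = ext_expectation M (\<lambda>\<omega>. - W 1 \<omega>)"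
    using \<xi> by (auto intro!: ext_expectation_cong_AE)
  have \<tau>: "AE \<omega> in M. \<tau> u \<omega> = dyadic_passage X Y u \<omega>" for u
    using levy_AE_cadlag[OF X] levy_AE_cadlag[OF Y] unfolding \<tau>_def
    by eventually_elim (rule first_passage_eq_dyadic_passage)
  show ?thesis
  proof (intro conjI impI)
    have "tendsto_in_prob M (\<lambda>u \<omega>. dyadic_passage X Y u \<omega> / ereal u) (1 / ext_expectation M (W 1)) at_top"
      using passage_law_of_large_numbers pos unfolding ext ext_expectation_uminus[OF neg_part] by simp
    then show "tendsto_in_prob (completion M) (\<lambda>u \<omega>. \<tau> u \<omega> / ereal u) (1 / ext_expectation M (W 1)) at_top"
    proof (rule tendsto_in_prob_completion)
      show "AE \<omega> in M. \<tau> u \<omega> / ereal u = dyadic_passage X Y u \<omega> / ereal u" for u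
        using \<tau>[of u] by eventually_elim simp
    qed
  next
    assume sq: "integrable M (\<lambda>\<omega>. (W 1 \<omega>)\<^sup>2)"
    then have int: "integrable M (W 1)" by (rule square_integrable_imp_integrable[rotated]) simp
    have mean: "expectation (?\<xi> 0) = expectation (W 1)"
      by (rule integral_cong_AE) (use \<xi> in simp_all)
    have var: "expectation (\<lambda>\<omega>. (?\<xi> 0 \<omega> - c)\<^sup>2) = expectation (\<lambda>\<omega>. (W 1 \<omega> - c)\<^sup>2)" for c
      by (rule integral_cong_AE) (use \<xi> in \<open>auto elim: eventually_mono\<close>)
    have "integrable M (\<lambda>\<omega>. (?\<xi> 0 \<omega>)\<^sup>2) \<longleftrightarrow> integrable M (\<lambda>\<omega>. (W 1 \<omega>)\<^sup>2)"
      by (rule integrable_cong_AE) (use \<xi> in \<open>auto elim: eventually_mono\<close>)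
    then have sq\<xi>: "integrable M (\<lambda>\<omega>. (?\<xi> 0 \<omega>)\<^sup>2)" using sq by blast
    have "0 < expectation (?\<xi> 0)"
      using pos unfolding mean ext_expectation_integrable[OF int] by simp
    from passage_central_limit_theorem[OF sq\<xi> this]
    have "tendsto_in_distribution M (\<lambda>u \<omega>. (dyadic_passage X Y u \<omega> - ereal (u / expectation (W 1))) / ereal (sqrt u))
        (normal_distribution 0 (variance (W 1) / expectation (W 1) ^ 3)) at_top"
      unfolding mean var .
    then show "tendsto_in_distribution (completion M)
        (\<lambda>u \<omega>. (\<tau> u \<omega> - ereal (u / expectation (W 1))) / ereal (sqrt u))
        (normal_distribution 0 (variance (W 1) / expectation (W 1) ^ 3)) at_top"
    proof (rule tendsto_in_distribution_completion)
      show "AE \<omega> in M. (\<tau> u \<omega> - ereal (u / expectation (W 1))) / ereal (sqrt u) =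
          (dyadic_passage X Y u \<omega> - ereal (u / expectation (W 1))) / ereal (sqrt u)" for u
        using \<tau>[of u] by eventually_elim simp
    qed
  qed
qed

theorem theorem2p1:
  fixes M :: "'a measure" and X Y :: "real \<Rightarrow> 'a \<Rightarrow> real"
    and V :: "real \<Rightarrow> 'a \<Rightarrow> real" and \<tau> :: "real \<Rightarrow> 'a \<Rightarrow> ereal"
  assumes "prob_space M"
    and "levy_process M X" and "levy_process M Y" and "indep_processes M X Y"
    and "expectation_exists M (X 1)" and "ext_expectation M (X 1) > 0"
    and "expectation_exists M (Y 1)" and "ext_expectation M (Y 1) < \<infinity>"
  defines "V \<equiv> reflected X Y" and "\<tau> \<equiv> first_passage V"
  shows
    "(ext_expectation M (\<lambda>\<omega>. X 1 \<omega> - Y 1 \<omega>) > 0 \<longrightarrow>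
        tendsto_in_prob (completion M)
          (\<lambda>u \<omega>. \<tau> u \<omega> / ereal u) (1 / ext_expectation M (X 1)) at_top \<and>
        (integrable M (\<lambda>\<omega>. (X 1 \<omega>)\<^sup>2) \<longrightarrow>
          tendsto_in_distribution (completion M)
            (\<lambda>u \<omega>. (\<tau> u \<omega> - ereal (u / prob_space.expectation M (X 1))) / ereal (sqrt u))
            (normal_distribution 0
              (prob_space.variance M (X 1) / prob_space.expectation M (X 1) ^ 3))
            at_top)) \<and>
     (ext_expectation M (\<lambda>\<omega>. X 1 \<omega> - Y 1 \<omega>) < 0 \<longrightarrow>
        tendsto_in_prob (completion M)
          (\<lambda>u \<omega>. \<tau> u \<omega> / ereal u) (1 / ext_expectation M (Y 1)) at_top \<and>
        (integrable M (\<lambda>\<omega>. (Y 1 \<omega>)\<^sup>2) \<longrightarrow>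
          tendsto_in_distribution (completion M)
            (\<lambda>u \<omega>. (\<tau> u \<omega> - ereal (u / prob_space.expectation M (Y 1))) / ereal (sqrt u))
            (normal_distribution 0
              (prob_space.variance M (Y 1) / prob_space.expectation M (Y 1) ^ 3))
            at_top))"
proof -
  note X = \<open>levy_process M X\<close> and Y = \<open>levy_process M Y\<close> and XY = \<open>indep_processes M X Y\<close>
  have [measurable]: "X 1 \<in> borel_measurable M" "Y 1 \<in> borel_measurable M"
    by (auto intro: levy_measurable[OF X] levy_measurable[OF Y])
  have negX: "(\<integral>\<^sup>+\<omega>. ennreal (- X 1 \<omega>) \<partial>M) < \<infinity>"
    by (rule ext_expectation_pos_imp_neg_part) fact+
  have posY: "(\<integral>\<^sup>+\<omega>. ennreal (Y 1 \<omega>) \<partial>M) < \<infinity>"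
    by (rule ext_expectation_less_top_imp_pos_part) fact
  have mX: "ext_expectation M (\<lambda>\<omega>. - X 1 \<omega>) < 0"
    using \<open>ext_expectation M (X 1) > 0\<close> unfolding ext_expectation_uminus[OF negX]
    by (cases "ext_expectation M (X 1)") auto
  show ?thesis
    unfolding \<tau>_def V_def
  proof (intro conjI[of "_ \<longrightarrow> _" "_ \<longrightarrow> _"] impI[of "_ < _"])
    assume pos: "ext_expectation M (\<lambda>\<omega>. X 1 \<omega> - Y 1 \<omega>) > 0"
    \<comment> \<open>This is the negative part of the difference. Its finiteness, a consequence of
      the assumptions on the two means, makes the expectation of the difference well
      defined.\<close>
    have "(\<integral>\<^sup>+\<omega>. ennreal (Y 1 \<omega> - X 1 \<omega>) \<partial>M) < \<infinity>"
      using negX posY by (intro nn_integral_pos_part_diff) auto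
    then have "ext_expectation M (\<lambda>\<omega>. - (X 1 \<omega> - Y 1 \<omega>)) = - ext_expectation M (\<lambda>\<omega>. X 1 \<omega> - Y 1 \<omega>)"
      by (intro ext_expectation_uminus) simp
    with pos have mZ: "ext_expectation M (\<lambda>\<omega>. - (X 1 \<omega> - Y 1 \<omega>)) < 0"
      by (cases "ext_expectation M (\<lambda>\<omega>. X 1 \<omega> - Y 1 \<omega>)") auto
    show "tendsto_in_prob (completion M) (\<lambda>u \<omega>. first_passage (reflected X Y) u \<omega> / ereal u)
        (1 / ext_expectation M (X 1)) at_top \<and>
      (integrable M (\<lambda>\<omega>. (X 1 \<omega>)\<^sup>2) \<longrightarrow>
        tendsto_in_distribution (completion M)
          (\<lambda>u \<omega>. (first_passage (reflected X Y) u \<omega> - ereal (u / prob_space.expectation M (X 1))) / ereal (sqrt u))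
          (normal_distribution 0 (prob_space.variance M (X 1) / prob_space.expectation M (X 1) ^ 3)) at_top)"
      by (rule first_passage_limits[OF X Y X walk_passage_positive_drift[OF X Y XY mX mZ] _ negX]) fact
  next
    assume neg: "ext_expectation M (\<lambda>\<omega>. X 1 \<omega> - Y 1 \<omega>) < 0"
    have posZ: "(\<integral>\<^sup>+\<omega>. ennreal (X 1 \<omega> - Y 1 \<omega>) \<partial>M) < \<infinity>"
      by (rule ext_expectation_less_top_imp_pos_part) (use neg in \<open>auto intro: less_trans\<close>)
    \<comment> \<open>Writing \<open>- Y\<close> as \<open>(X - Y) - X\<close> and, next,
      \<open>X\<close> as \<open>(X - Y) + Y\<close> bounds the remaining parts. So both means are
      finite in this case, and that of \<open>Y\<close> is positive because it exceeds that of
      \<open>X\<close>.\<close>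
    have negY: "(\<integral>\<^sup>+\<omega>. ennreal (- Y 1 \<omega>) \<partial>M) < \<infinity>"
      using nn_integral_pos_part_diff[OF _ _ posZ negX] by simp
    have posX: "(\<integral>\<^sup>+\<omega>. ennreal (X 1 \<omega>) \<partial>M) < \<infinity>"
      using nn_integral_pos_part_diff[OF _ _ posZ, of "\<lambda>\<omega>. - Y 1 \<omega>"] posY by simp
    have intX: "integrable M (X 1)" and intY: "integrable M (Y 1)"
      using posX negX posY negY by (auto simp: real_integrable_def)
    have "(\<integral>\<omega>. X 1 \<omega> \<partial>M) - (\<integral>\<omega>. Y 1 \<omega> \<partial>M) < 0"
      using neg intX intY ext_expectation_integrable[OF Bochner_Integration.integrable_diff[OF intX intY]] by simp
    moreover have "0 < (\<integral>\<omega>. X 1 \<omega> \<partial>M)"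
      using \<open>ext_expectation M (X 1) > 0\<close> unfolding ext_expectation_integrable[OF intX] by simp
    ultimately have "0 < ext_expectation M (Y 1)"
      unfolding ext_expectation_integrable[OF intY] by simp
    then show "tendsto_in_prob (completion M) (\<lambda>u \<omega>. first_passage (reflected X Y) u \<omega> / ereal u)
        (1 / ext_expectation M (Y 1)) at_top \<and>
      (integrable M (\<lambda>\<omega>. (Y 1 \<omega>)\<^sup>2) \<longrightarrow>
        tendsto_in_distribution (completion M)
          (\<lambda>u \<omega>. (first_passage (reflected X Y) u \<omega> - ereal (u / prob_space.expectation M (Y 1))) / ereal (sqrt u))
          (normal_distribution 0 (prob_space.variance M (Y 1) / prob_space.expectation M (Y 1) ^ 3)) at_top)"
      by (rule first_passage_limits[OF X Y Y walk_passage_negative_drift[OF X Y XY mX neg] _ negY])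
  qed
qed

end
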